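(* Let $\rho$ be a Lévy measure on $\mathbb{R}\setminus\{0\}$, $\lambda$ the Lebesgue measure on $[0,\infty)$, and consider the signed point process $Z$ on $[0,\infty)^2$ defined by the hierarchical model $$W=\sum_{i=1}^\infty w_i\delta_{\theta_i},\quad W\sim CRSM(\rho,\lambda),$$ $$D=\sum_{i=1}^\infty\sum_{j=1}^\infty n_{ij}\delta_{(\theta_i,\theta_j)}=D_+-D_-,\quad D_+\mid W_+\sim PP(W_+\times W_+),\ D_-\mid W_-\sim PP(W_-\times W_-),$$ $$Z=\sum_{i=1}^\infty\sum_{j=1}^\infty \mathrm{sign}(n_{ij}+n_{ji})\min(|n_{ij}+n_{ji}|,1)\,\delta_{(\theta_i,\theta_j)},$$ with $D_+$ and $D_-$ independent. For $\alpha>0$ let $$N_\alpha=\mathrm{card}\{\theta_i\in[0,\alpha]:Z(\{\theta_i\}\times[0,\alpha])\neq0\},\qquad N_\alpha^{(e)}=|Z|(\{(x,y)\in[0,\infty)^2:0\le x\le y\le\alpha\}).$$ Assume that $\int_{\mathbb{R}\setminus\{0\}}|w|\rho(dw)<\infty$. If $W$ has finite activity, i.e. $\int_{\mathbb{R}\setminus\{0\}}\rho(dw)<\infty$, then $N_\alpha^{(e)}=\Theta(N_\alpha^2)$ almost surely as $\alpha\to\infty$. If $W$ has infinite activity, i.e. $\int_{\mathbb{R}\setminus\{0\}}\rho(dw)=\infty$, then $N_\alpha^{(e)}=o(N_\alpha^2)$ almost surely as $\alpha\to\infty$.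
   Context: $W\sim CRSM(\rho,\lambda)$ means that $W=\sum_iw_i\delta_{\theta_i}$, $w_i\in\mathbb{R}\setminus\{0\}$, $\theta_i\in[0,\infty)$, is a completely random signed measure on $[0,\infty)$ (a random real-valued countably additive set function on bounded Borel sets, with independent values on disjoint sets) without fixed atoms and without deterministic component, i.e. $W(B)=\int_{\mathbb{R}\setminus\{0\}}x\,\Psi(B\times dx)$ for a Poisson process $\Psi$ on $[0,\infty)\times(\mathbb{R}\setminus\{0\})$ with intensity $\lambda(d\theta)\rho(dw)$, where $\int_{\mathbb{R}\setminus\{0\}}(1\wedge|w|)\rho(dw)<\infty$. $W_+=\sum_{i:w_i>0}w_i\delta_{\theta_i}$ and $W_-=\sum_{i:w_i<0}|w_i|\delta_{\theta_i}$ form its Jordan decomposition; they are independent completely random measures. $PP(\mu)$ denotes the law of a Poisson process with mean measure $\mu$, which is allowed to have atoms. $|Z|$ is the total variation measure of $Z$. $N_\alpha$ is the number of observed nodes and $N^{(e)}_\alpha$ the number of edges of the restriction of the signed graph $Z$ to $[0,\alpha]^2$. $\Theta(\cdot)$ and $o(\cdot)$ are the usual asymptotic notations, holding almost surely. *)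

theory Defs
  imports "HOL-Probability.Probability" "HOL-Library.Landau_Symbols"
begin

section \<open>Random measures and Poisson processes\<close>

text \<open>The analogue of \<^const>\<open>subprob_algebra\<close> for arbitrary measures: the coarsest
  \<open>\<sigma>\<close>-algebra on the measures over \<open>S\<close> that makes every evaluation map measurable.\<close>

definition measure_algebra :: "'a measure \<Rightarrow> 'a measure measure" where
  "measure_algebra S =
     (SUP A \<in> sets S. vimage_algebra {N. sets N = sets S} (\<lambda>N. emeasure N A) borel)"

lemma space_measure_algebra [simp]: "space (measure_algebra S) = {N. sets N = sets S}"
  by (auto simp: measure_algebra_def space_Sup_eq_UN)

lemma measurable_emeasure_measure_algebra [measurable]:
  "A \<in> sets S \<Longrightarrow> (\<lambda>N. emeasure N A) \<in> borel_measurable (measure_algebra S)"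
  by (auto intro!: measurable_Sup1 measurable_vimage_algebra1 simp: measure_algebra_def)

lemma measurable_measure_algebraI:
  assumes "\<And>\<omega>. \<omega> \<in> space M \<Longrightarrow> sets (X \<omega>) = sets S"
    and "\<And>A. A \<in> sets S \<Longrightarrow> (\<lambda>\<omega>. emeasure (X \<omega>) A) \<in> borel_measurable M"
  shows "X \<in> M \<rightarrow>\<^sub>M measure_algebra S"
  unfolding measure_algebra_def
  using assms by (auto intro!: measurable_Sup2 measurable_vimage_algebra2)

text \<open>\<open>poisson_law \<mu> P\<close>: the law \<open>P\<close> on the space of measures is \<open>PP(\<mu>)\<close>. The mean measure may
  have atoms, and \<open>\<mu> B = 0\<close> is covered by the convention \<open>0 ^ 0 = 1\<close>.\<close>

definition poisson_law :: "'a measure \<Rightarrow> 'a measure measure \<Rightarrow> bool" where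
  "poisson_law \<mu> P \<longleftrightarrow>
     prob_space P \<and> sets P = sets (measure_algebra \<mu>) \<and>
     (\<forall>B\<in>sets \<mu>. emeasure \<mu> B < \<infinity> \<longrightarrow>
        (\<forall>k::nat. measure P {N \<in> space P. emeasure N B = of_nat k} =
                    measure \<mu> B ^ k / fact k * exp (- measure \<mu> B))) \<and>
     (\<forall>B\<in>sets \<mu>. emeasure \<mu> B = \<infinity> \<longrightarrow> (AE N in P. emeasure N B = \<infinity>)) \<and>
     (\<forall>(n::nat) B. (\<forall>i<n. B i \<in> sets \<mu>) \<longrightarrow> disjoint_family_on B {..<n} \<longrightarrow>
        prob_space.indep_vars P (\<lambda>_. borel) (\<lambda>i N. emeasure N (B i)) {..<n})"

definition poisson_process :: "'w measure \<Rightarrow> 'a measure \<Rightarrow> ('w \<Rightarrow> 'a measure) \<Rightarrow> bool" where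
  "poisson_process M \<mu> X \<longleftrightarrow>
     X \<in> M \<rightarrow>\<^sub>M measure_algebra \<mu> \<and> poisson_law \<mu> (distr M (measure_algebra \<mu>) X)"

text \<open>\<open>K\<close> is a regular conditional distribution of the \<open>T\<close>-valued random element \<open>X\<close> given \<open>F\<close>.\<close>

definition regular_cond_distr ::
    "'w measure \<Rightarrow> 'w measure \<Rightarrow> 't measure \<Rightarrow> ('w \<Rightarrow> 't) \<Rightarrow> ('w \<Rightarrow> 't measure) \<Rightarrow> bool" where
  "regular_cond_distr M F T X K \<longleftrightarrow>
     subalgebra M F \<and> X \<in> M \<rightarrow>\<^sub>M T \<and> K \<in> F \<rightarrow>\<^sub>M prob_algebra T \<and>
     (\<forall>A\<in>sets T. AE \<omega> in M.
        real_cond_exp M F (indicator (X -` A \<inter> space M)) \<omega> = measure (K \<omega>) A)"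

text \<open>\<open>D | V \<sim> PP(V \<times> V)\<close> for a random measure \<open>V\<close> on \<open>S\<close>; the conditioning is on \<open>\<sigma>(V)\<close>.\<close>

definition cond_poisson_square ::
    "'w measure \<Rightarrow> 'a measure \<Rightarrow> ('w \<Rightarrow> 'a measure) \<Rightarrow> ('w \<Rightarrow> ('a \<times> 'a) measure) \<Rightarrow> bool" where
  "cond_poisson_square M S V D \<longleftrightarrow>
     V \<in> M \<rightarrow>\<^sub>M measure_algebra S \<and>
     (\<exists>K. regular_cond_distr M (vimage_algebra (space M) V (measure_algebra S))
            (measure_algebra (S \<Otimes>\<^sub>M S)) D K \<and>
          (AE \<omega> in M. poisson_law (V \<omega> \<Otimes>\<^sub>M V \<omega>) (K \<omega>)))"

section \<open>Completely random signed measures\<close>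

definition half_line :: "real measure" where
  "half_line = restrict_space borel {0..}"

definition lebesgue_half_line :: "real measure" where
  "lebesgue_half_line = restrict_space lborel {0..}"

definition levy_measure :: "real measure \<Rightarrow> bool" where
  "levy_measure \<rho> \<longleftrightarrow>
     sets \<rho> = sets (restrict_space borel (- {0})) \<and> (\<integral>\<^sup>+ w. ennreal (min 1 (w\<^sup>2)) \<partial>\<rho>) < \<infinity>"

definition bounded_borel :: "real set set" where
  "bounded_borel = {B \<in> sets half_line. bounded B}"

text \<open>A signed measure on \<open>[0,\<infinity>)\<close> that is only required to be finite on bounded sets is a real set
  function of which only the values on \<^const>\<open>bounded_borel\<close> matter.\<close>

definition signed_measure :: "(real set \<Rightarrow> real) \<Rightarrow> bool" where
  "signed_measure \<nu> \<longleftrightarrow>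
     (\<forall>A::nat \<Rightarrow> real set. range A \<subseteq> bounded_borel \<longrightarrow> disjoint_family A \<longrightarrow>
        (\<Union>i. A i) \<in> bounded_borel \<longrightarrow> (\<lambda>i. \<nu> (A i)) sums \<nu> (\<Union>i. A i))"

text \<open>\<open>W \<sim> CRSM(\<rho>,\<Lambda>)\<close>. Independence of the values on disjoint sets and absence of fixed atoms and of
  a deterministic component are contained in the Poisson representation.\<close>

definition crsm ::
    "'w measure \<Rightarrow> real measure \<Rightarrow> real measure \<Rightarrow> ('w \<Rightarrow> real set \<Rightarrow> real) \<Rightarrow> bool" where
  "crsm M \<rho> \<Lambda> W \<longleftrightarrow>
     (\<forall>\<omega>\<in>space M. signed_measure (W \<omega>)) \<and>
     (\<forall>B\<in>bounded_borel. (\<lambda>\<omega>. W \<omega> B) \<in> borel_measurable M) \<and>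
     (\<integral>\<^sup>+ w. ennreal (min 1 \<bar>w\<bar>) \<partial>\<rho>) < \<infinity> \<and>
     (\<exists>\<Psi>. poisson_process M (\<Lambda> \<Otimes>\<^sub>M \<rho>) \<Psi> \<and>
        (AE \<omega> in M. \<forall>B\<in>bounded_borel. W \<omega> B = (LINT z:(B \<times> (- {0}))|\<Psi> \<omega>. snd z)))"

text \<open>The locations \<open>\<theta>\<^sub>i\<close>; the weight of the atom at \<open>\<theta>\<close> is \<open>\<nu> {\<theta>}\<close>.\<close>

definition atoms :: "(real set \<Rightarrow> real) \<Rightarrow> real set" where
  "atoms \<nu> = {\<theta>. 0 \<le> \<theta> \<and> \<nu> {\<theta>} \<noteq> 0}"

text \<open>The purely atomic measures \<open>\<Sum> w\<^sub>i \<delta>\<^bsub>\<theta>\<^sub>i\<^esub>\<close> over \<open>w\<^sub>i > 0\<close> and \<open>\<Sum> |w\<^sub>i| \<delta>\<^bsub>\<theta>\<^sub>i\<^esub>\<close> over \<open>w\<^sub>i < 0\<close>: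
  \<^const>\<open>ennreal\<close> sends negative reals to \<open>0\<close>.\<close>

definition pos_part :: "(real set \<Rightarrow> real) \<Rightarrow> real measure" where
  "pos_part \<nu> = distr (density (count_space {0..}) (\<lambda>\<theta>. ennreal (\<nu> {\<theta>}))) half_line (\<lambda>\<theta>. \<theta>)"

definition neg_part :: "(real set \<Rightarrow> real) \<Rightarrow> real measure" where
  "neg_part \<nu> = distr (density (count_space {0..}) (\<lambda>\<theta>. ennreal (- \<nu> {\<theta>}))) half_line (\<lambda>\<theta>. \<theta>)"

section \<open>The signed graph\<close>

definition signed_diff :: "'a measure \<Rightarrow> 'a measure \<Rightarrow> 'a set \<Rightarrow> real" where
  "signed_diff P N A = measure P A - measure N A"

text \<open>\<open>Z\<close> as a set function, from a realisation \<open>\<nu>\<close> of \<open>W\<close> and \<open>d\<close> of \<open>D\<close>, with \<open>n\<^sub>i\<^sub>j = d {(\<theta>\<^sub>i, \<theta>\<^sub>j)}\<close>.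
  On bounded sets the sum has almost surely only finitely many nonzero terms.\<close>

definition signed_graph ::
    "(real set \<Rightarrow> real) \<Rightarrow> ((real \<times> real) set \<Rightarrow> real) \<Rightarrow> (real \<times> real) set \<Rightarrow> real" where
  "signed_graph \<nu> d A =
     infsum (\<lambda>(x, y). sgn (d {(x, y)} + d {(y, x)}) * min \<bar>d {(x, y)} + d {(y, x)}\<bar> 1)
       (A \<inter> atoms \<nu> \<times> atoms \<nu>)"

definition total_variation :: "'a measure \<Rightarrow> ('a set \<Rightarrow> real) \<Rightarrow> 'a set \<Rightarrow> ennreal" where
  "total_variation S \<zeta> A =
     (SUP Q \<in> {Q. finite Q \<and> disjoint Q \<and> Q \<subseteq> sets S \<and> \<Union>Q \<subseteq> A}. \<Sum>B\<in>Q. ennreal \<bar>\<zeta> B\<bar>)"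

definition num_nodes ::
    "(real set \<Rightarrow> real) \<Rightarrow> ((real \<times> real) set \<Rightarrow> real) \<Rightarrow> real \<Rightarrow> nat" where
  "num_nodes \<nu> \<zeta> \<alpha> = card {\<theta> \<in> atoms \<nu> \<inter> {0..\<alpha>}. \<zeta> ({\<theta>} \<times> {0..\<alpha>}) \<noteq> 0}"

definition num_edges :: "((real \<times> real) set \<Rightarrow> real) \<Rightarrow> real \<Rightarrow> real" where
  "num_edges \<zeta> \<alpha> =
     enn2real (total_variation (half_line \<Otimes>\<^sub>M half_line) \<zeta> {(x, y). 0 \<le> x \<and> x \<le> y \<and> y \<le> \<alpha>})"

end

theory Submission
  imports Defs
begin

text \<open>All quantities are monotone in \<open>\<alpha>\<close>, so it is enough to control them along \<open>\<alpha> = 2\<^sup>r\<close>, where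
  exponential Poisson tails and the Borel-Cantelli lemma apply. Points of \<open>W\<close> of opposite signs are never
  joined, so nothing cancels, the nodes and edges are counted by sets of atoms of \<open>D\<^sub>+\<close> and \<open>D\<^sub>-\<close>, and only
  the two joint laws of \<open>W\<^sub>\<plusminus>\<close> and \<open>D\<^sub>\<plusminus>\<close> matter.

  Finite activity: there are \<open>O(\<alpha>)\<close> atoms, and of the pairs of unit cells on which \<open>W\<^sub>+\<close> (or \<open>W\<^sub>-\<close>) is bounded below,
  a positive proportion is hit by \<open>D\<close>, which gives at least \<open>c \<alpha>\<^sup>2\<close> edges; edges never exceed squared nodes.

  Infinite activity: for every \<open>m\<close> a positive proportion of the cells of length \<open>2\<^sup>-\<^sup>m\<close> contains a node, so
  nodes outgrow every multiple of \<open>\<alpha>\<close>. Edges between two points of weight less than 1 number \<open>O(\<alpha>\<^sup>2)\<close>,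
  and those with an endpoint of weight at least 1 number at most \<open>O(\<alpha>)\<close> times the nodes.\<close>

section \<open>The Poisson law\<close>

text \<open>The hypotheses prescribe laws of counts in fixed sets, whereas the graph is made of
  points. Points are recovered from counts in dyadic cells: decreasing natural numbers become
  constant, so every charged cell contains an atom. Conditioning has the same limitation, since the
  atoms of \<open>W\<close> form a random set with too many values. Only random sets with finitely
  many values, decided by the masses of cells, are plugged into the conditional law of
  \<open>D\<close>; the rest is reached by monotone limits. The light/heavy threshold has this
  reason. A light jump in bin \<open>l\<close> weighs at most \<open>(1 / 2) ^ l\<close>, so
  exponential tails for the Poisson counts of the bins, summed with these weights, bound the light
  mass by a multiple of \<alpha>, and the conditional mean number of points of \<open>D\<close>
  between light points is the square of that mass. The mass of heavy jumps need not have exponential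
  moments; they are only counted, and each is charged with as many edges as there are nodes.\<close>

lemma measurable_emeasure_poisson_law:
  assumes "poisson_law \<mu> P" "B \<in> sets \<mu>"
  shows "(\<lambda>N. emeasure N B) \<in> borel_measurable P"
proof -
  have "sets P = sets (measure_algebra \<mu>)" using assms by (simp add: poisson_law_def)
  then show ?thesis
    using measurable_emeasure_measure_algebra[OF assms(2)] measurable_cong_sets by blast
qed

text \<open>The law fixes only the probabilities of the values \<open>k\<close>. These sum to 1,
  which excludes every other value in the extended half-line, infinity included.\<close>

lemma poisson_law_AE_nat:
  assumes P: "poisson_law \<mu> P" and B: "B \<in> sets \<mu>" "emeasure \<mu> B < \<infinity>"
  shows "AE N in P. \<exists>k::nat. emeasure N B = of_nat k"
proof -
  interpret prob_space P using P by (simp add: poisson_law_def)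
  note [measurable] = measurable_emeasure_poisson_law[OF P B(1)]
  let ?A = "\<lambda>k::nat. {N \<in> space P. emeasure N B = of_nat k}"
  have dj: "disjoint_family ?A" by (auto simp: disjoint_family_on_def)
  have pr: "prob (?A k) = measure \<mu> B ^ k / fact k * exp (- measure \<mu> B)" for k
    using P B by (simp add: poisson_law_def)
  have "(\<lambda>k. prob (?A k)) sums prob (\<Union>k. ?A k)"
    by (rule finite_measure_UNION) (auto intro: dj)
  moreover have "(\<lambda>k. prob (?A k)) sums 1"
  proof -
    have "(\<lambda>k. measure \<mu> B ^ k / fact k) sums exp (measure \<mu> B)"
      using exp_converges[of "measure \<mu> B"] by (simp add: field_simps)
    then have "(\<lambda>k. measure \<mu> B ^ k / fact k * exp (- measure \<mu> B)) sums (exp (measure \<mu> B) * exp (- measure \<mu> B))"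
      by (rule sums_mult2)
    then show ?thesis unfolding pr by (simp add: exp_minus)
  qed
  ultimately have "prob (\<Union>k. ?A k) = 1" using sums_unique2 by blast
  then have "AE N in P. N \<in> (\<Union>k. ?A k)" by (intro AE_prob_1) auto
  then show ?thesis by eventually_elim auto
qed

text \<open>Chernoff bound at parameter 1; the factor 2 absorbs \<open>e - 1\<close>.\<close>

lemma poisson_law_tail:
  assumes P: "poisson_law \<mu> P" and B: "B \<in> sets \<mu>" "emeasure \<mu> B < \<infinity>"
  shows "measure P {N \<in> space P. emeasure N B \<ge> ennreal (2 * measure \<mu> B + t)} \<le> exp (- t)"
proof -
  interpret prob_space P using P by (simp add: poisson_law_def)
  note [measurable] = measurable_emeasure_poisson_law[OF P B(1)]
  define x where "x = measure \<mu> B"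
  have x: "x \<ge> 0" by (simp add: x_def)
  let ?A = "\<lambda>k::nat. {N \<in> space P. emeasure N B = of_nat k \<and> real k \<ge> 2 * x + t}"
  have pr: "prob {N \<in> space P. emeasure N B = of_nat k} = x ^ k / fact k * exp (- x)" for k
    using P B by (simp add: poisson_law_def x_def)
  have le: "prob (?A k) \<le> (exp 1 * x) ^ k / fact k * (exp (- x) * exp (- (2 * x + t)))" (is "_ \<le> ?g k") for k
  proof (cases "real k \<ge> 2 * x + t")
    case True
    have "1 \<le> exp (real k - (2 * x + t))" using True by simp
    also have "\<dots> = exp 1 ^ k * exp (- (2 * x + t))"
      using exp_of_nat_mult[of k "1::real"] by (simp add: exp_diff exp_minus divide_inverse exp_add)
    finally have "1 \<le> exp 1 ^ k * exp (- (2 * x + t))" .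
    then have "x ^ k / fact k * exp (- x) * 1 \<le> x ^ k / fact k * exp (- x) * (exp 1 ^ k * exp (- (2 * x + t)))"
      using x by (intro mult_left_mono) auto
    then show ?thesis using pr[of k] True by (simp add: power_mult_distrib field_simps)
  next
    case False
    then show ?thesis using x by simp
  qed
  have sm: "?g sums (exp (exp 1 * x) * (exp (- x) * exp (- (2 * x + t))))"
    using exp_converges[of "exp 1 * x"] by (intro sums_mult2) (simp add: field_simps)
  have dj: "disjoint_family ?A" by (auto simp: disjoint_family_on_def)
  have s2: "(\<lambda>k. prob (?A k)) sums prob (\<Union>k. ?A k)"
    by (rule finite_measure_UNION) (auto intro: dj)
  have "prob {N \<in> space P. emeasure N B \<ge> ennreal (2 * x + t)} = prob (\<Union>k. ?A k)"
  proof (rule finite_measure_eq_AE)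
    show "AE N in P. (N \<in> {N \<in> space P. ennreal (2 * x + t) \<le> emeasure N B}) = (N \<in> (\<Union>k. ?A k))"
      using poisson_law_AE_nat[OF assms]
    proof eventually_elim
      case (elim N)
      then obtain k where k: "emeasure N B = of_nat k" by auto
      have "ennreal (2 * x + t) \<le> of_nat k \<longleftrightarrow> 2 * x + t \<le> real k"
        unfolding ennreal_of_nat_eq_real_of_nat by (rule ennreal_le_iff) simp
      then show ?case using k by auto
    qed
  qed auto
  also have "\<dots> \<le> exp (exp 1 * x) * (exp (- x) * exp (- (2 * x + t)))"
    using sums_le[OF le s2 sm] .
  also have "\<dots> = exp ((exp 1 - 3) * x - t)"
  proof -
    have "exp 1 * x + (- x + - (2 * x + t)) = (exp 1 - 3) * x - t" by (simp add: algebra_simps)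
    then show ?thesis by (metis exp_add)
  qed
  also have "\<dots> \<le> exp (- t)"
  proof -
    have "(exp 1 - 3) * x \<le> 0" using exp_le x by (intro mult_nonpos_nonneg) auto
    then show ?thesis by simp
  qed
  finally show ?thesis by (simp add: x_def)
qed

lemma poisson_law_nonzero:
  assumes P: "poisson_law \<mu> P" and B: "B \<in> sets \<mu>" "emeasure \<mu> B < \<infinity>"
  shows "measure P {N \<in> space P. emeasure N B \<noteq> 0} = 1 - exp (- measure \<mu> B)"
proof -
  interpret prob_space P using P by (simp add: poisson_law_def)
  note [measurable] = measurable_emeasure_poisson_law[OF P B(1)]
  have "\<forall>k::nat. prob {N \<in> space P. emeasure N B = of_nat k} = measure \<mu> B ^ k / fact k * exp (- measure \<mu> B)"
    using P B by (simp add: poisson_law_def)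
  then have "prob {N \<in> space P. emeasure N B = 0} = exp (- measure \<mu> B)"
    by (auto dest!: spec[of _ 0])
  moreover have "{N \<in> space P. emeasure N B \<noteq> 0} = space P - {N \<in> space P. emeasure N B = 0}"
    by auto
  ultimately show ?thesis by (simp add: prob_compl)
qed

text \<open>The exponent 2 is the point: summed over the \<open>2 ^ (n + m)\<close> cells of level
  \<open>m\<close>, each of mean of order \<open>1 / 2 ^ m\<close>, the bound vanishes as
  \<open>m\<close> grows. Simplicity of the jump process rests on this.\<close>

lemma poisson_law_ge2:
  assumes P: "poisson_law \<mu> P" and B: "B \<in> sets \<mu>" "emeasure \<mu> B < \<infinity>"
  shows "measure P {N \<in> space P. emeasure N B \<noteq> 0 \<and> emeasure N B \<noteq> 1} \<le> (measure \<mu> B)\<^sup>2"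
proof -
  interpret prob_space P using P by (simp add: poisson_law_def)
  note [measurable] = measurable_emeasure_poisson_law[OF P B(1)]
  define x where "x = measure \<mu> B"
  have *: "\<forall>k::nat. prob {N \<in> space P. emeasure N B = of_nat k} = x ^ k / fact k * exp (- x)"
    using P B by (simp add: poisson_law_def x_def)
  have p0: "prob {N \<in> space P. emeasure N B = 0} = exp (- x)"
    using * by (auto dest!: spec[of _ 0])
  have p1: "prob {N \<in> space P. emeasure N B = 1} = x * exp (- x)"
    using * by (auto dest!: spec[of _ 1])
  have "{N \<in> space P. emeasure N B \<noteq> 0 \<and> emeasure N B \<noteq> 1} =
     space P - ({N \<in> space P. emeasure N B = 0} \<union> {N \<in> space P. emeasure N B = 1})"
    by auto
  then have "prob {N \<in> space P. emeasure N B \<noteq> 0 \<and> emeasure N B \<noteq> 1} = 1 - (exp (- x) + x * exp (- x))"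
    by (simp add: prob_compl p0 p1 finite_measure_Union disjoint_iff)
  also have "\<dots> = 1 - (1 + x) * exp (- x)" by (simp add: algebra_simps)
  also have "\<dots> \<le> 1 - (1 + x) * (1 - x)"
    using exp_ge_add_one_self[of "-x"] by (intro diff_left_mono mult_left_mono) (auto simp: x_def)
  also have "\<dots> = x\<^sup>2" by (simp add: power2_eq_square algebra_simps)
  finally show ?thesis by (simp add: x_def)
qed

text \<open>A lower Chernoff bound. The variable \<open>exp (- count)\<close> is a product over
  disjoint, hence independent, sets, and each set is hit with probability at least
  \<open>1 - exp (- c)\<close>; the threshold is half of the resulting mean.\<close>

lemma poisson_law_hits_nat:
  fixes B :: "nat \<Rightarrow> 'a set"
  assumes P: "poisson_law \<mu> P" and B: "\<And>i. i < n \<Longrightarrow> B i \<in> sets \<mu>"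
    and fin: "\<And>i. i < n \<Longrightarrow> emeasure \<mu> (B i) < \<infinity>"
    and dj: "disjoint_family_on B {..<n}"
    and c: "\<And>i. i < n \<Longrightarrow> measure \<mu> (B i) \<ge> c" "c \<ge> 0"
  shows "measure P {N \<in> space P. real (card {i. i < n \<and> emeasure N (B i) \<noteq> 0}) \<le> (1 - exp (- c)) / 2 * n}
    \<le> exp (- (1 - exp (- c)) / 10 * n)"
proof -
  interpret prob_space P using P by (simp add: poisson_law_def)
  have mB[measurable]: "(\<lambda>N. emeasure N (B i)) \<in> borel_measurable P" if "i < n" for i
    using measurable_emeasure_poisson_law[OF P B] that by blast
  define p where "p = 1 - exp (- c)"
  \<comment> \<open>A hit lowers the factor of \<open>exp (- count)\<close> from 1 to
    \<open>1 - e\<close>. The threshold at half the mean costs \<open>exp (p / 2 * n)\<close>, so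
    \<open>e >= 3 / 5\<close> leaves the rate \<open>1 / 10\<close>.\<close>
  define e where "e = (1 - exp (-1) :: real)"
  have e0: "e \<ge> 3 / 5"
  proof -
    have "exp (1::real) \<ge> 5 / 2" using exp_lower_Taylor_quadratic[of 1] by simp
    then show ?thesis by (simp add: e_def exp_minus field_simps)
  qed
  have p0: "0 \<le> p" "p \<le> 1" using c by (auto simp: p_def)
  define f :: "ennreal \<Rightarrow> ennreal" where "f x = (if x = 0 then 1 else ennreal (exp (-1)))" for x
  have fm[measurable]: "f \<in> borel_measurable borel" unfolding f_def by measurable
  have ind: "indep_vars (\<lambda>_. borel) (\<lambda>i N. emeasure N (B i)) {..<n}"
    using P B dj by (auto simp: poisson_law_def)
  have ind2: "indep_vars (\<lambda>_. borel) (\<lambda>i N. f (emeasure N (B i))) {..<n}"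
    using indep_vars_compose2[OF ind, of "\<lambda>_. f" "\<lambda>_. borel"] by simp
  have each: "(\<integral>\<^sup>+N. f (emeasure N (B i)) \<partial>P) \<le> ennreal (exp (- e * p))" if i: "i < n" for i
  proof -
    note [measurable] = mB[OF i]
    let ?A = "{N \<in> space P. emeasure N (B i) \<noteq> 0}"
    have "(\<integral>\<^sup>+N. f (emeasure N (B i)) \<partial>P) = (\<integral>\<^sup>+N. ennreal (1 - e * indicator ?A N) \<partial>P)"
      by (intro nn_integral_cong) (auto simp: f_def e_def indicator_def)
    also have "\<dots> = ennreal (\<integral>N. 1 - e * indicator ?A N \<partial>P)"
      by (intro nn_integral_eq_integral) (auto simp: e_def indicator_def intro!: integrable_const_bound[where B=1])
    also have "(\<integral>N. 1 - e * indicator ?A N \<partial>P) = 1 - e * prob ?A"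
    proof -
      have A: "?A \<in> events" by measurable
      then have "integrable P (indicator ?A :: _ \<Rightarrow> real)" by (intro integrable_real_indicator) (auto simp: emeasure_eq_measure)
      then have "(\<integral>N. 1 - e * indicator ?A N \<partial>P) = (\<integral>N. 1 \<partial>P) - (\<integral>N. e * indicator ?A N \<partial>P)"
        by (intro Bochner_Integration.integral_diff) auto
      with A show ?thesis by (simp add: prob_space)
    qed
    also have "prob ?A = 1 - exp (- measure \<mu> (B i))"
      using poisson_law_nonzero[OF P B[OF i] fin[OF i]] .
    also have "ennreal (1 - e * (1 - exp (- measure \<mu> (B i)))) \<le> ennreal (exp (- e * p))"
    proof (rule ennreal_leI)
      have "1 - e * (1 - exp (- measure \<mu> (B i))) \<le> 1 - e * p"
        using c(1)[OF i] e0 by (intro diff_left_mono mult_left_mono) (auto simp: p_def)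
      also have "\<dots> \<le> exp (- e * p)" using exp_ge_add_one_self[of "- e * p"] by simp
      finally show "1 - e * (1 - exp (- measure \<mu> (B i))) \<le> exp (- e * p)" .
    qed
    finally show ?thesis .
  qed
  let ?h = "\<lambda>N. card {i. i < n \<and> emeasure N (B i) \<noteq> 0}"
  have prodf: "(\<Prod>i<n. f (emeasure N (B i))) = ennreal (exp (- real (?h N)))" for N
  proof -
    have "(\<Prod>i<n. f (emeasure N (B i))) = (\<Prod>i<n. if i \<in> {i. i < n \<and> emeasure N (B i) \<noteq> 0} then ennreal (exp (-1)) else 1)"
      by (intro prod.cong) (auto simp: f_def)
    also have "\<dots> = ennreal (exp (-1)) ^ ?h N"
      by (subst prod.inter_restrict[symmetric]) (auto simp: Int_def intro!: arg_cong[of _ _ card])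
    also have "\<dots> = ennreal (exp (- real (?h N)))"
      by (simp add: ennreal_power flip: exp_of_nat_mult)
    finally show ?thesis .
  qed
  have meash[measurable]: "?h \<in> measurable P (count_space UNIV)"
  proof -
    have "?h = (\<lambda>N. \<Sum>i<n. if emeasure N (B i) \<noteq> 0 then 1 else 0)"
      by (auto simp: sum.If_cases Int_def)
    moreover have "\<dots> \<in> measurable P (count_space UNIV)"
      by (intro measurable_sum_nat measurable_If) auto
    ultimately show ?thesis by simp
  qed
  have int: "(\<integral>\<^sup>+N. ennreal (exp (- real (?h N))) \<partial>P) \<le> ennreal (exp (- e * p * n))"
  proof -
    have "(\<integral>\<^sup>+N. ennreal (exp (- real (?h N))) \<partial>P) = (\<integral>\<^sup>+N. (\<Prod>i<n. f (emeasure N (B i))) \<partial>P)"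
      by (simp add: prodf)
    also have "\<dots> = (\<Prod>i<n. \<integral>\<^sup>+N. f (emeasure N (B i)) \<partial>P)"
      by (rule indep_vars_nn_integral[OF _ ind2]) auto
    also have "\<dots> \<le> (\<Prod>i<n. ennreal (exp (- e * p)))"
    proof -
      have "(\<Prod>i\<in>J. g i) \<le> (\<Prod>i\<in>J. h)" if "finite J" "\<And>i. i \<in> J \<Longrightarrow> g i \<le> h"
        for J :: "nat set" and g and h :: ennreal
        using that
      proof (induction J)
        case (insert i J)
        have "g i * (\<Prod>i\<in>J. g i) \<le> h * (\<Prod>i\<in>J. h)"
          by (rule mult_mono) (use insert in auto)
        then show ?case using insert.hyps by simp
      qed simp
      then show ?thesis using each by (meson finite_lessThan lessThan_iff)
    qed
    also have "\<dots> = ennreal (exp (- e * p * n))"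
      using exp_of_nat_mult[of n "- e * p"] by (simp add: ennreal_power mult.commute)
    finally show ?thesis .
  qed
  let ?E = "{N \<in> space P. real (?h N) \<le> p / 2 * n}"
  have "emeasure P ?E \<le> ennreal (exp (p / 2 * n)) * (\<integral>\<^sup>+N. ennreal (exp (- real (?h N))) * indicator (space P) N \<partial>P)"
  proof -
    have "?E = {N \<in> space P. 1 \<le> ennreal (exp (p / 2 * n)) * ennreal (exp (- real (?h N)))}"
    proof -
      have "1 \<le> ennreal (exp a) * ennreal (exp (- b)) \<longleftrightarrow> b \<le> a" for a b
      proof -
        have "ennreal (exp a) * ennreal (exp (- b)) = ennreal (exp (a - b))"
          by (subst ennreal_mult[symmetric]) (simp_all add: exp_add[symmetric])
        then show ?thesis by (simp add: ennreal_ge_1)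
      qed
      then show ?thesis by simp
    qed
    then show ?thesis
      using nn_integral_Markov_inequality[of "\<lambda>N. ennreal (exp (- real (?h N)))" "space P" P "ennreal (exp (p / 2 * n))"]
      by simp
  qed
  also have "\<dots> \<le> ennreal (exp (p / 2 * n)) * ennreal (exp (- e * p * n))"
  proof -
    have "(\<integral>\<^sup>+N. ennreal (exp (- real (?h N))) * indicator (space P) N \<partial>P) = (\<integral>\<^sup>+N. ennreal (exp (- real (?h N))) \<partial>P)"
      by (intro nn_integral_cong) auto
    then show ?thesis using int by (auto intro!: mult_left_mono)
  qed
  also have "\<dots> = ennreal (exp ((1 / 2 - e) * p * n))"
  proof -
    have "p / 2 * n + - e * p * n = (1 / 2 - e) * p * n" by (simp add: algebra_simps)
    then have "exp (p / 2 * n) * exp (- e * p * n) = exp ((1 / 2 - e) * p * n)"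
      by (metis exp_add)
    then show ?thesis by (metis ennreal_mult exp_ge_zero)
  qed
  also have "\<dots> \<le> ennreal (exp (- p / 10 * n))"
  proof -
    have "(1 / 2 - e) * (p * n) \<le> (- 1 / 10) * (p * n)"
      using e0 p0 by (intro mult_right_mono) auto
    then show ?thesis by (simp add: algebra_simps)
  qed
  finally show ?thesis by (simp add: emeasure_eq_measure p_def)
qed

text \<open>Independence in \<open>poisson_law\<close> is stated for families indexed by an initial
  segment of the naturals; a bijection transports the bound to any finite index set.\<close>

lemma poisson_law_hits:
  fixes B :: "'i \<Rightarrow> 'a set"
  assumes P: "poisson_law \<mu> P" and I: "finite I" and B: "\<And>i. i \<in> I \<Longrightarrow> B i \<in> sets \<mu>"
    and fin: "\<And>i. i \<in> I \<Longrightarrow> emeasure \<mu> (B i) < \<infinity>"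
    and dj: "disjoint_family_on B I"
    and c: "\<And>i. i \<in> I \<Longrightarrow> measure \<mu> (B i) \<ge> c" "c \<ge> 0"
  shows "measure P {N \<in> space P. real (card {i \<in> I. emeasure N (B i) \<noteq> 0}) \<le> (1 - exp (- c)) / 2 * card I}
    \<le> exp (- (1 - exp (- c)) / 10 * card I)"
proof -
  obtain g where g: "bij_betw g {..<card I} I"
    using ex_bij_betw_nat_finite[OF I] by (auto simp: atLeast0LessThan)
  have "card {i \<in> I. emeasure N (B i) \<noteq> 0} = card {i. i < card I \<and> emeasure N (B (g i)) \<noteq> 0}" for N
  proof (rule bij_betw_same_card[symmetric, of g])
    show "bij_betw g {i. i < card I \<and> emeasure N (B (g i)) \<noteq> 0} {i \<in> I. emeasure N (B i) \<noteq> 0}"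
      using g unfolding bij_betw_def inj_on_def by auto
  qed
  moreover have "g i \<in> I" if "i < card I" for i using g that by (auto simp: bij_betw_def)
  moreover have "disjoint_family_on (B \<circ> g) {..<card I}"
    using g dj unfolding disjoint_family_on_def bij_betw_def inj_on_def by (metis comp_apply image_eqI)
  ultimately show ?thesis
    using poisson_law_hits_nat[OF P, of "card I" "B \<circ> g" c] B fin c by simp
qed

section \<open>Conditioning on the mean measure\<close>

definition sigma_gen :: "'w measure \<Rightarrow> 'a measure \<Rightarrow> ('w \<Rightarrow> 'a measure) \<Rightarrow> 'w measure" where
  "sigma_gen M S V = vimage_algebra (space M) V (measure_algebra S)"

lemma space_sigma_gen [simp]: "space (sigma_gen M S V) = space M"
  by (simp add: sigma_gen_def)

lemma measurable_sigma_gen [measurable]: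
  assumes "V \<in> M \<rightarrow>\<^sub>M measure_algebra S" "B \<in> sets S"
  shows "(\<lambda>\<omega>. emeasure (V \<omega>) B) \<in> borel_measurable (sigma_gen M S V)"
proof -
  have "V \<in> sigma_gen M S V \<rightarrow>\<^sub>M measure_algebra S"
    unfolding sigma_gen_def using assms(1) by (intro measurable_vimage_algebra1) (auto simp: measurable_def)
  from measurable_compose[OF this measurable_emeasure_measure_algebra[OF assms(2)]] show ?thesis .
qed

lemma (in prob_space) AE_eventually_notin:
  assumes E: "\<And>n. E n \<in> events" and le: "\<And>n. prob (E n) \<le> (1 / 2) ^ n * c"
  shows "AE x in M. \<forall>\<^sub>F n in sequentially. x \<notin> E n"
proof -
  have "summable (\<lambda>n. (1 / 2) ^ n * c)" by (intro summable_mult2 summable_geometric) simp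
  then have "summable (\<lambda>n. prob (E n))" by (rule summable_comparison_test') (use le in simp)
  with E have "AE x in M. \<forall>\<^sub>F n in sequentially. x \<in> space M - E n"
    by (intro borel_cantelli_AE1) (auto simp: emeasure_eq_measure)
  then show ?thesis by eventually_elim (auto elim: eventually_mono)
qed

text \<open>Since \<open>exp x >= x\<close>, the doubly exponential decay along powers of 2 is at
  least geometric, which is the form that \<open>AE_eventually_notin\<close> asks for.\<close>

lemma exp_minus_mult_power2_le:
  assumes "(a::real) > 0" shows "exp (- (a * 2 ^ n)) \<le> (1 / 2) ^ n * inverse a"
proof -
  have "a * 2 ^ n > 0" using assms by simp
  then have "exp (- (a * 2 ^ n)) \<le> inverse (a * 2 ^ n)"
    using exp_ge_add_one_self[of "a * 2 ^ n"] unfolding exp_minus by (intro le_imp_inverse_le) linarith+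
  then show ?thesis by (simp add: power_one_over field_simps)
qed

lemma measurable_card_Collect:
  assumes "finite I" "\<And>i. i \<in> I \<Longrightarrow> {x \<in> space M. q i x} \<in> sets M"
  shows "(\<lambda>x. card {i \<in> I. q i x}) \<in> M \<rightarrow>\<^sub>M count_space (UNIV :: nat set)"
proof -
  have "(\<lambda>x. card {i \<in> I. q i x}) = (\<lambda>x. \<Sum>i\<in>I. if q i x then 1 else 0)"
    using assms(1) by (auto simp: sum.If_cases Int_def)
  moreover have "\<dots> \<in> M \<rightarrow>\<^sub>M count_space (UNIV :: nat set)"
    using assms(2) by (intro measurable_sum_nat measurable_If) auto
  ultimately show ?thesis by simp
qed

text \<open>The property \<open>A\<close> of \<open>D\<close> may be selected by \<open>g\<close>, a
  function of \<open>V\<close> with finitely many values: each level set of \<open>g\<close> lies in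
  the conditioning \<sigma>-algebra and the property is fixed on it, so the conditional probability
  can be integrated there. The bound is required for every Poisson law with the given mean, because
  nothing more is known about the kernel.\<close>

lemma cond_poisson_square_bound:
  assumes M: "prob_space M" and D: "cond_poisson_square M S V D"
    and J: "finite J" "\<And>\<omega>. \<omega> \<in> space M \<Longrightarrow> g \<omega> \<in> J"
    and g: "\<And>i. i \<in> J \<Longrightarrow> {\<omega> \<in> space M. g \<omega> = i} \<in> sets (sigma_gen M S V)"
    and A: "\<And>i. i \<in> J \<Longrightarrow> A i \<in> sets (measure_algebra (S \<Otimes>\<^sub>M S))"
    and f: "AE \<omega> in M. \<forall>P. poisson_law (V \<omega> \<Otimes>\<^sub>M V \<omega>) P \<longrightarrow> measure P (A (g \<omega>)) \<le> f"
  shows "measure M {\<omega> \<in> space M. D \<omega> \<in> A (g \<omega>)} \<le> f"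
    and "{\<omega> \<in> space M. D \<omega> \<in> A (g \<omega>)} \<in> sets M"
proof -
  interpret prob_space M by fact
  define F where "F = sigma_gen M S V"
  obtain K where K: "regular_cond_distr M F (measure_algebra (S \<Otimes>\<^sub>M S)) D K"
    and KP: "AE \<omega> in M. poisson_law (V \<omega> \<Otimes>\<^sub>M V \<omega>) (K \<omega>)"
    using D by (auto simp: cond_poisson_square_def F_def sigma_gen_def)
  have sub: "subalgebra M F" and Dm: "D \<in> M \<rightarrow>\<^sub>M measure_algebra (S \<Otimes>\<^sub>M S)"
    and Km: "K \<in> F \<rightarrow>\<^sub>M prob_algebra (measure_algebra (S \<Otimes>\<^sub>M S))"
    and KA: "\<And>A. A \<in> sets (measure_algebra (S \<Otimes>\<^sub>M S)) \<Longrightarrow>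
      AE \<omega> in M. real_cond_exp M F (indicator (D -` A \<inter> space M)) \<omega> = measure (K \<omega>) A"
    using K by (auto simp: regular_cond_distr_def)
  interpret finite_measure_subalgebra M F
    by unfold_locales (rule sub)
  define G where "G i = {\<omega> \<in> space M. g \<omega> = i}" for i
  define E where "E i = D -` A i \<inter> space M" for i
  have GF: "G i \<in> sets F" if "i \<in> J" for i using g[OF that] by (simp add: F_def G_def)
  have GM: "G i \<in> sets M" if "i \<in> J" for i using GF[OF that] sub by (auto simp: subalgebra_def)
  have EM: "E i \<in> sets M" if "i \<in> J" for i
    unfolding E_def using Dm A[OF that] by (rule measurable_sets)
  have eq: "{\<omega> \<in> space M. D \<omega> \<in> A (g \<omega>)} = (\<Union>i\<in>J. G i \<inter> E i)"
    using J by (auto simp: G_def E_def)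
  show "{\<omega> \<in> space M. D \<omega> \<in> A (g \<omega>)} \<in> sets M"
    unfolding eq using J GM EM by (intro sets.finite_UN) auto
  have each: "prob (G i \<inter> E i) \<le> f * prob (G i)" if i: "i \<in> J" for i
  proof -
    have int: "integrable M (indicator (E i) :: _ \<Rightarrow> real)"
      using EM[OF i] by (intro integrable_real_indicator) (auto simp: emeasure_eq_measure)
    have "prob (G i \<inter> E i) = (\<integral>x. indicator (G i \<inter> E i) x \<partial>M)"
      using GM EM i by (simp add: sets.sets_into_space Int_absorb2)
    also have "\<dots> = (\<integral>x\<in>G i. indicator (E i) x \<partial>M)"
      by (simp add: set_lebesgue_integral_def indicator_inter_arith)
    also have "\<dots> = (\<integral>x\<in>G i. real_cond_exp M F (indicator (E i)) x \<partial>M)"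
      by (rule real_cond_exp_intA[OF int GF[OF i]])
    also have "\<dots> \<le> (\<integral>x. f * indicator (G i) x \<partial>M)"
      unfolding set_lebesgue_integral_def
    proof (rule integral_mono_AE)
      show "integrable M (\<lambda>x. indicat_real (G i) x *\<^sub>R real_cond_exp M F (indicat_real (E i)) x)"
        using GM[OF i] real_cond_exp_int(1)[OF int] by (rule integrable_mult_indicator)
      show "integrable M (\<lambda>x. f * indicat_real (G i) x)"
        using GM[OF i] by (intro integrable_mult_right integrable_real_indicator) (auto simp: emeasure_eq_measure)
      show "AE x in M. indicat_real (G i) x *\<^sub>R real_cond_exp M F (indicat_real (E i)) x \<le> f * indicat_real (G i) x"
        using KA[OF A[OF i]] KP f
      proof eventually_elim
        case (elim x)
        then show ?case by (auto simp: G_def E_def indicator_def)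
      qed
    qed
    also have "\<dots> = f * prob (G i)" using GM[OF i] by (simp add: sets.sets_into_space Int_absorb2)
    finally show ?thesis .
  qed
  have "prob (\<Union>i\<in>J. G i \<inter> E i) = (\<Sum>i\<in>J. prob (G i \<inter> E i))"
    by (intro finite_measure_finite_Union J) (use GM EM in \<open>auto simp: disjoint_family_on_def G_def\<close>)
  also have "\<dots> \<le> (\<Sum>i\<in>J. f * prob (G i))" by (intro sum_mono each)
  also have "\<dots> = f * prob (\<Union>i\<in>J. G i)"
    by (subst finite_measure_finite_Union) (use J GM in \<open>auto simp: disjoint_family_on_def G_def sum_distrib_left\<close>)
  also have "(\<Union>i\<in>J. G i) = space M" using J by (auto simp: G_def)
  finally show "measure M {\<omega> \<in> space M. D \<omega> \<in> A (g \<omega>)} \<le> f" by (simp add: eq prob_space)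
qed

section \<open>Locally finite measures and random rectangles\<close>

definition locally_finite :: "real measure \<Rightarrow> bool" where
  "locally_finite v \<longleftrightarrow> sets v = sets half_line \<and> (\<forall>r::nat. emeasure v {0..<2 ^ r} < \<infinity>)"

lemma half_line_simps [simp]: "space half_line = {0..}"
  by (simp add: half_line_def)

lemma sets_half_line: "A \<in> sets half_line \<longleftrightarrow> A \<in> sets borel \<and> A \<subseteq> {0..}"
  by (auto simp: half_line_def sets_restrict_space_iff)

lemma ex_real_less_power2: "\<exists>r::nat. (x::real) < 2 ^ r"
  by (rule real_arch_pow) simp

lemma locally_finite_sigma_finite:
  assumes "locally_finite v" shows "sigma_finite_measure v"
proof
  have v: "sets v = sets half_line" "\<And>r::nat. emeasure v {0..<2 ^ r} < \<infinity>"
    using assms by (auto simp: locally_finite_def)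
  have sp: "space v = {0..}" using sets_eq_imp_space_eq[OF v(1)] by simp
  show "\<exists>A. countable A \<and> A \<subseteq> sets v \<and> \<Union>A = space v \<and> (\<forall>a\<in>A. emeasure v a \<noteq> \<infinity>)"
  proof (intro exI conjI ballI)
    let ?A = "range (\<lambda>r::nat. {0..<(2::real) ^ r})"
    show "countable ?A" by simp
    show "?A \<subseteq> sets v" by (auto simp: v sets_half_line)
    show "\<Union>?A = space v" using ex_real_less_power2 by (auto simp: sp)
    show "emeasure v a \<noteq> \<infinity>" if "a \<in> ?A" for a using that v(2) by (auto simp: less_top)
  qed
qed

lemma locally_finite_bounded:
  assumes v: "locally_finite v" and B: "B \<in> sets half_line" "bounded B"
  shows "emeasure v B < \<infinity>"
proof -
  obtain a where a: "\<And>x. x \<in> B \<Longrightarrow> \<bar>x\<bar> \<le> a" using B(2) by (auto simp: bounded_iff)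
  obtain r :: nat where r: "a < 2 ^ r" using ex_real_less_power2 by blast
  have "B \<subseteq> {0..<2 ^ r}" using a r B(1) by (fastforce simp: sets_half_line)
  then have "emeasure v B \<le> emeasure v {0..<2 ^ r}"
    using v by (intro emeasure_mono) (auto simp: locally_finite_def sets_half_line)
  then show ?thesis using v by (auto simp: locally_finite_def intro: le_less_trans)
qed

lemma locally_finite_times:
  assumes "locally_finite v" "A \<in> sets half_line" "B \<in> sets half_line"
  shows "emeasure (v \<Otimes>\<^sub>M v) (A \<times> B) = emeasure v A * emeasure v B"
proof -
  interpret sigma_finite_measure v using assms(1) by (rule locally_finite_sigma_finite)
  show ?thesis using assms by (intro emeasure_pair_measure_Times) (auto simp: locally_finite_def)
qed

lemma sets_locally_finite_pair:
  assumes "locally_finite v"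
  shows "sets (v \<Otimes>\<^sub>M v) = sets (half_line \<Otimes>\<^sub>M half_line)"
  using assms by (intro sets_pair_measure_cong) (auto simp: locally_finite_def)

lemma sets_measure_algebra_cong: "sets S = sets S' \<Longrightarrow> measure_algebra S = measure_algebra S'"
  by (simp add: measure_algebra_def)

lemma measurable_Collect_measure_algebra:
  assumes "B \<in> sets S" "Q \<in> sets borel"
  shows "{N \<in> space (measure_algebra S). emeasure N B \<in> Q} \<in> sets (measure_algebra S)"
  using measurable_sets[OF measurable_emeasure_measure_algebra[OF assms(1)] assms(2)]
  by (simp add: vimage_def Int_def conj_commute)

lemma poisson_law_space:
  assumes "poisson_law \<mu> P" "sets \<mu> = sets S" shows "space P = space (measure_algebra S)"
  using assms sets_measure_algebra_cong[OF assms(2)] by (auto simp: poisson_law_def dest: sets_eq_imp_space_eq)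

text \<open>An estimate uniform over all mean measures, so that it survives conditioning, where the
  mean is random. It is applied with \<open>Q\<close> the positive values, the large values and the
  values that are not natural numbers.\<close>

definition poisson_bound :: "ennreal set \<Rightarrow> real \<Rightarrow> real \<Rightarrow> bool" where
  "poisson_bound Q b f \<longleftrightarrow> (\<forall>(\<mu> :: (real \<times> real) measure) P B. poisson_law \<mu> P \<longrightarrow> B \<in> sets \<mu> \<longrightarrow>
     emeasure \<mu> B \<le> ennreal b \<longrightarrow> measure P {N \<in> space P. emeasure N B \<in> Q} \<le> f)"

lemma cond_poisson_rect_bound:
  fixes g :: "'w \<Rightarrow> 'i" and D :: "'w \<Rightarrow> (real \<times> real) measure"
  assumes M: "prob_space M" and D: "cond_poisson_square M half_line V D"
    and V: "AE \<omega> in M. locally_finite (V \<omega>)"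
    and J: "finite J" "\<And>\<omega>. \<omega> \<in> space M \<Longrightarrow> g \<omega> \<in> J"
    and g: "\<And>i. i \<in> J \<Longrightarrow> {\<omega> \<in> space M. g \<omega> = i} \<in> sets (sigma_gen M half_line V)"
    and R: "\<And>i. i \<in> J \<Longrightarrow> R1 i \<in> sets half_line" "\<And>i. i \<in> J \<Longrightarrow> R2 i \<in> sets half_line"
    and Q: "Q \<in> sets borel"
    and bf: "poisson_bound Q b f"
    and f: "f \<ge> 0"
  shows "measure M {\<omega> \<in> space M. emeasure (V \<omega>) (R1 (g \<omega>)) * emeasure (V \<omega>) (R2 (g \<omega>)) \<le> ennreal b \<and>
     emeasure (D \<omega>) (R1 (g \<omega>) \<times> R2 (g \<omega>)) \<in> Q} \<le> f" (is "measure M ?E \<le> f")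
   and "{\<omega> \<in> space M. emeasure (V \<omega>) (R1 (g \<omega>)) * emeasure (V \<omega>) (R2 (g \<omega>)) \<le> ennreal b \<and>
     emeasure (D \<omega>) (R1 (g \<omega>) \<times> R2 (g \<omega>)) \<in> Q} \<in> sets M"
proof -
  let ?F = "sigma_gen M half_line V" and ?T = "measure_algebra (half_line \<Otimes>\<^sub>M half_line)"
  have Vm: "V \<in> M \<rightarrow>\<^sub>M measure_algebra half_line" and Dm: "D \<in> M \<rightarrow>\<^sub>M ?T"
    using D by (auto simp: cond_poisson_square_def regular_cond_distr_def)
  \<comment> \<open>Whether the conditional mean is at most \<open>b\<close> is decided by
    \<open>V\<close>, so it can be a second coordinate of the selector. Where it fails, the selected
    property is empty and \<open>f >= 0\<close> suffices.\<close>
  define h where "h \<omega> = (g \<omega>, emeasure (V \<omega>) (R1 (g \<omega>)) * emeasure (V \<omega>) (R2 (g \<omega>)) \<le> ennreal b)" for \<omega>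
  define A where "A = (\<lambda>(i, t). if t then {N \<in> space ?T. emeasure N (R1 i \<times> R2 i) \<in> Q} else {})"
  have R12: "R1 i \<times> R2 i \<in> sets (half_line \<Otimes>\<^sub>M half_line)" if "i \<in> J" for i using R that by auto
  have hm: "{\<omega> \<in> space M. h \<omega> = i} \<in> sets ?F" if i: "i \<in> J \<times> UNIV" for i
  proof -
    obtain j t where jt: "i = (j, t)" "j \<in> J" using i by auto
    have [measurable]: "(\<lambda>\<omega>. emeasure (V \<omega>) (R1 j)) \<in> borel_measurable ?F" "(\<lambda>\<omega>. emeasure (V \<omega>) (R2 j)) \<in> borel_measurable ?F"
      using measurable_sigma_gen[OF Vm] R jt by auto
    have "{\<omega> \<in> space ?F. (emeasure (V \<omega>) (R1 j) * emeasure (V \<omega>) (R2 j) \<le> ennreal b) = t} \<in> sets ?F"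
      by measurable
    with g[OF jt(2)] have "{\<omega> \<in> space M. g \<omega> = j} \<inter> {\<omega> \<in> space ?F. (emeasure (V \<omega>) (R1 j) * emeasure (V \<omega>) (R2 j) \<le> ennreal b) = t} \<in> sets ?F"
      by (rule sets.Int)
    also have "{\<omega> \<in> space M. g \<omega> = j} \<inter> {\<omega> \<in> space ?F. (emeasure (V \<omega>) (R1 j) * emeasure (V \<omega>) (R2 j) \<le> ennreal b) = t} = {\<omega> \<in> space M. h \<omega> = i}"
      by (auto simp: h_def jt)
    finally show ?thesis .
  qed
  have Am: "A i \<in> sets ?T" if "i \<in> J \<times> UNIV" for i
    using that measurable_Collect_measure_algebra[OF R12 Q] by (auto simp: A_def)
  have bound: "AE \<omega> in M. \<forall>P. poisson_law (V \<omega> \<Otimes>\<^sub>M V \<omega>) P \<longrightarrow> measure P (A (h \<omega>)) \<le> f"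
    using V AE_space
  proof eventually_elim
    case (elim \<omega>)
    have gJ: "g \<omega> \<in> J" using J(2) elim(2) .
    show ?case
    proof (intro allI impI)
      fix P assume P: "poisson_law (V \<omega> \<Otimes>\<^sub>M V \<omega>) P"
      have sp: "space P = space ?T"
        using poisson_law_space[OF P sets_locally_finite_pair[OF elim(1)]] .
      show "measure P (A (h \<omega>)) \<le> f"
      proof (cases "emeasure (V \<omega>) (R1 (g \<omega>)) * emeasure (V \<omega>) (R2 (g \<omega>)) \<le> ennreal b")
        case True
        have "measure P {N \<in> space P. emeasure N (R1 (g \<omega>) \<times> R2 (g \<omega>)) \<in> Q} \<le> f"
          using R12[OF gJ] R gJ elim(1) True P bf[unfolded poisson_bound_def]
          by (auto simp: sets_locally_finite_pair locally_finite_times)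
        then show ?thesis using True by (simp add: A_def h_def sp)
      qed (simp add: A_def h_def f)
    qed
  qed
  have Dsp: "D \<omega> \<in> space ?T" if "\<omega> \<in> space M" for \<omega> using Dm that by (rule measurable_space)
  have eq: "?E = {\<omega> \<in> space M. D \<omega> \<in> A (h \<omega>)}"
    using Dsp by (auto simp: A_def h_def)
  show "measure M ?E \<le> f" "?E \<in> sets M" unfolding eq
    using cond_poisson_square_bound[OF M D, of "J \<times> UNIV" h A f] J hm Am bound by (auto simp: h_def)
qed

text \<open>The selector is the set of rectangles of conditional mean at least \<open>c\<close>. It
  is determined by \<open>V\<close> and has finitely many values; given it,
  \<open>poisson_law_hits\<close> applies to a fixed disjoint family.\<close>

lemma cond_poisson_hits:
  fixes D :: "'w \<Rightarrow> (real \<times> real) measure" and I :: "'i set"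
  assumes M: "prob_space M" and D: "cond_poisson_square M half_line V D"
    and V: "AE \<omega> in M. locally_finite (V \<omega>)"
    and I: "finite I" and R: "\<And>i. i \<in> I \<Longrightarrow> R1 i \<in> sets half_line" "\<And>i. i \<in> I \<Longrightarrow> R2 i \<in> sets half_line"
    and bnd: "\<And>i. i \<in> I \<Longrightarrow> bounded (R1 i)" "\<And>i. i \<in> I \<Longrightarrow> bounded (R2 i)"
    and dj: "disjoint_family_on (\<lambda>i. R1 i \<times> R2 i) I"
    and c: "c \<ge> 0"
  shows "measure M {\<omega> \<in> space M. real n \<le> card {i \<in> I. emeasure (V \<omega>) (R1 i) * emeasure (V \<omega>) (R2 i) \<ge> ennreal c} \<and>
     real (card {i \<in> I. emeasure (D \<omega>) (R1 i \<times> R2 i) \<noteq> 0}) \<le> (1 - exp (- c)) / 2 * n} \<le> exp (- (1 - exp (- c)) / 10 * n)"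
     (is "measure M ?E \<le> ?f")
   and "{\<omega> \<in> space M. real n \<le> card {i \<in> I. emeasure (V \<omega>) (R1 i) * emeasure (V \<omega>) (R2 i) \<ge> ennreal c} \<and>
     real (card {i \<in> I. emeasure (D \<omega>) (R1 i \<times> R2 i) \<noteq> 0}) \<le> (1 - exp (- c)) / 2 * n} \<in> sets M" (is ?m)
proof -
  interpret prob_space M by fact
  let ?F = "sigma_gen M half_line V" and ?T = "measure_algebra (half_line \<Otimes>\<^sub>M half_line)"
  have Vm: "V \<in> M \<rightarrow>\<^sub>M measure_algebra half_line" and Dm: "D \<in> M \<rightarrow>\<^sub>M ?T"
    using D by (auto simp: cond_poisson_square_def regular_cond_distr_def)
  define h where "h \<omega> = {i \<in> I. emeasure (V \<omega>) (R1 i) * emeasure (V \<omega>) (R2 i) \<ge> ennreal c}" for \<omega>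
  define A where "A G = {N \<in> space ?T. n \<le> card G \<and> real (card {i \<in> G. emeasure N (R1 i \<times> R2 i) \<noteq> 0}) \<le> (1 - exp (- c)) / 2 * card G}" for G
  have R12: "R1 i \<times> R2 i \<in> sets (half_line \<Otimes>\<^sub>M half_line)" if "i \<in> I" for i using R that by auto
  have hm: "{\<omega> \<in> space M. h \<omega> = G} \<in> sets ?F" if G: "G \<in> Pow I" for G
  proof -
    have [measurable]: "(\<lambda>\<omega>. emeasure (V \<omega>) (R1 j)) \<in> borel_measurable ?F" "(\<lambda>\<omega>. emeasure (V \<omega>) (R2 j)) \<in> borel_measurable ?F"
       if "j \<in> I" for j
      using measurable_sigma_gen[OF Vm] R that by auto
    have "{\<omega> \<in> space ?F. \<forall>j\<in>I. (emeasure (V \<omega>) (R1 j) * emeasure (V \<omega>) (R2 j) \<ge> ennreal c) = (j \<in> G)} \<in> sets ?F"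
    proof (intro sets.sets_Collect_finite_All I)
      fix j assume [simp]: "j \<in> I"
      show "{\<omega> \<in> space ?F. (emeasure (V \<omega>) (R1 j) * emeasure (V \<omega>) (R2 j) \<ge> ennreal c) = (j \<in> G)} \<in> sets ?F"
        by measurable
    qed
    also have "{\<omega> \<in> space ?F. \<forall>j\<in>I. (emeasure (V \<omega>) (R1 j) * emeasure (V \<omega>) (R2 j) \<ge> ennreal c) = (j \<in> G)} = {\<omega> \<in> space M. h \<omega> = G}"
      using G by (auto simp: h_def)
    finally show ?thesis .
  qed
  have Am: "A G \<in> sets ?T" if G: "G \<in> Pow I" for G
  proof -
    have [measurable]: "(\<lambda>N. emeasure N (R1 j \<times> R2 j)) \<in> borel_measurable ?T" if "j \<in> G" for j
      using G that R12 by auto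
    have fG: "finite G" using G I finite_subset by blast
    have [measurable]: "(\<lambda>N. card {i \<in> G. emeasure N (R1 i \<times> R2 i) \<noteq> 0}) \<in> measurable ?T (count_space UNIV)"
    proof (rule measurable_card_Collect[OF fG])
      fix i assume [simp]: "i \<in> G"
      show "{N \<in> space ?T. emeasure N (R1 i \<times> R2 i) \<noteq> 0} \<in> sets ?T" by measurable
    qed
    show ?thesis unfolding A_def by measurable
  qed
  have pc: "0 \<le> (1 - exp (- c))" using c by simp
  have bound: "AE \<omega> in M. \<forall>P. poisson_law (V \<omega> \<Otimes>\<^sub>M V \<omega>) P \<longrightarrow> measure P (A (h \<omega>)) \<le> ?f"
    using V
  proof eventually_elim
    case (elim \<omega>)
    note vfin = locally_finite_bounded[OF elim]
    show ?case
    proof (intro allI impI)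
      fix P assume P: "poisson_law (V \<omega> \<Otimes>\<^sub>M V \<omega>) P"
      have sp: "space P = space ?T"
        using poisson_law_space[OF P sets_locally_finite_pair[OF elim(1)]] .
      show "measure P (A (h \<omega>)) \<le> ?f"
      proof (cases "n \<le> card (h \<omega>)")
        case True
        have m: "measure (V \<omega> \<Otimes>\<^sub>M V \<omega>) (R1 i \<times> R2 i) \<ge> c" "emeasure (V \<omega> \<Otimes>\<^sub>M V \<omega>) (R1 i \<times> R2 i) < \<infinity>"
           if "i \<in> h \<omega>" for i
        proof -
          have i: "i \<in> I" and ge: "emeasure (V \<omega>) (R1 i) * emeasure (V \<omega>) (R2 i) \<ge> ennreal c"
            using that by (auto simp: h_def)
          have e: "emeasure (V \<omega> \<Otimes>\<^sub>M V \<omega>) (R1 i \<times> R2 i) = emeasure (V \<omega>) (R1 i) * emeasure (V \<omega>) (R2 i)"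
            using R i elim by (intro locally_finite_times) auto
          show fin: "emeasure (V \<omega> \<Otimes>\<^sub>M V \<omega>) (R1 i \<times> R2 i) < \<infinity>"
            unfolding e using vfin R bnd i by (simp add: ennreal_mult_less_top)
          then have "emeasure (V \<omega> \<Otimes>\<^sub>M V \<omega>) (R1 i \<times> R2 i) = ennreal (measure (V \<omega> \<Otimes>\<^sub>M V \<omega>) (R1 i \<times> R2 i))"
            by (intro emeasure_eq_ennreal_measure) auto
          with ge e show "measure (V \<omega> \<Otimes>\<^sub>M V \<omega>) (R1 i \<times> R2 i) \<ge> c"
            by (metis ennreal_le_iff measure_nonneg)
        qed
        have "measure P {N \<in> space P. real (card {i \<in> h \<omega>. emeasure N (R1 i \<times> R2 i) \<noteq> 0}) \<le> (1 - exp (- c)) / 2 * card (h \<omega>)}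
            \<le> exp (- (1 - exp (- c)) / 10 * card (h \<omega>))"
        proof (intro poisson_law_hits[OF P] m c)
          show "finite (h \<omega>)" using I by (simp add: h_def)
          show "R1 i \<times> R2 i \<in> sets (V \<omega> \<Otimes>\<^sub>M V \<omega>)" if "i \<in> h \<omega>" for i
            using R12 that sets_locally_finite_pair[OF elim(1)] by (auto simp: h_def)
          show "disjoint_family_on (\<lambda>i. R1 i \<times> R2 i) (h \<omega>)"
            using dj by (rule disjoint_family_on_mono[rotated]) (auto simp: h_def)
        qed
        also have "\<dots> \<le> ?f"
        proof -
          have "(1 - exp (- c)) * real n \<le> (1 - exp (- c)) * real (card (h \<omega>))"
            using True pc by (intro mult_left_mono) auto
          then show ?thesis by (simp add: field_simps)
        qed
        finally show ?thesis using True by (simp add: A_def sp)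
      qed (simp add: A_def)
    qed
  qed
  have Dsp: "D \<omega> \<in> space ?T" if "\<omega> \<in> space M" for \<omega> using Dm that by (rule measurable_space)
  have mea: "{\<omega> \<in> space M. D \<omega> \<in> A (h \<omega>)} \<in> sets M" and le: "measure M {\<omega> \<in> space M. D \<omega> \<in> A (h \<omega>)} \<le> ?f"
    using cond_poisson_square_bound[OF M D, of "Pow I" h A ?f] I hm Am bound by (auto simp: h_def)
  \<comment> \<open>Restricting to the selected rectangles can only lower the number of hits, and
    \<open>n <= card (h \<omega>)\<close> can only raise the threshold.\<close>
  have sub: "?E \<subseteq> {\<omega> \<in> space M. D \<omega> \<in> A (h \<omega>)}"
  proof
    fix \<omega> assume w: "\<omega> \<in> ?E"
    have "card {i \<in> h \<omega>. emeasure (D \<omega>) (R1 i \<times> R2 i) \<noteq> 0} \<le> card {i \<in> I. emeasure (D \<omega>) (R1 i \<times> R2 i) \<noteq> 0}"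
      using I by (intro card_mono) (auto simp: h_def)
    then have "real (card {i \<in> h \<omega>. emeasure (D \<omega>) (R1 i \<times> R2 i) \<noteq> 0}) \<le> (1 - exp (- c)) / 2 * n"
      using w by auto
    also have "\<dots> \<le> (1 - exp (- c)) / 2 * card (h \<omega>)"
      using w pc by (intro mult_left_mono) (auto simp: h_def)
    finally show "\<omega> \<in> {\<omega> \<in> space M. D \<omega> \<in> A (h \<omega>)}"
      using w Dsp by (auto simp: A_def h_def)
  qed
  show "?m"
  proof -
    have [measurable]: "(\<lambda>\<omega>. emeasure (V \<omega>) (R1 j)) \<in> borel_measurable M" "(\<lambda>\<omega>. emeasure (V \<omega>) (R2 j)) \<in> borel_measurable M"
       "(\<lambda>\<omega>. emeasure (D \<omega>) (R1 j \<times> R2 j)) \<in> borel_measurable M" if "j \<in> I" for j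
      using measurable_compose[OF Vm measurable_emeasure_measure_algebra] measurable_compose[OF Dm measurable_emeasure_measure_algebra] R R12 that by auto
    have [measurable]: "(\<lambda>\<omega>. card {i \<in> I. emeasure (D \<omega>) (R1 i \<times> R2 i) \<noteq> 0}) \<in> measurable M (count_space UNIV)"
    proof (rule measurable_card_Collect[OF I])
      fix i assume [simp]: "i \<in> I"
      show "{\<omega> \<in> space M. emeasure (D \<omega>) (R1 i \<times> R2 i) \<noteq> 0} \<in> sets M" by measurable
    qed
    have [measurable]: "(\<lambda>\<omega>. card {i \<in> I. emeasure (V \<omega>) (R1 i) * emeasure (V \<omega>) (R2 i) \<ge> ennreal c}) \<in> measurable M (count_space UNIV)"
    proof (rule measurable_card_Collect[OF I])
      fix i assume [simp]: "i \<in> I"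
      show "{\<omega> \<in> space M. emeasure (V \<omega>) (R1 i) * emeasure (V \<omega>) (R2 i) \<ge> ennreal c} \<in> sets M" by measurable
    qed
    show ?thesis by measurable
  qed
  show "measure M ?E \<le> ?f"
    using finite_measure_mono[OF sub mea] le by simp
qed

section \<open>Dyadic cells and light points\<close>

definition cell :: "nat \<Rightarrow> nat \<Rightarrow> real set" where
  "cell m j = {real j / 2 ^ m ..< (real j + 1) / 2 ^ m}"

lemma sets_cell [measurable, simp]: "cell m j \<in> sets half_line"
  by (auto simp: cell_def sets_half_line intro: order_trans[rotated])

lemma bounded_cell [simp]: "bounded (cell m j)"
  by (auto simp: cell_def)

text \<open>Makes the index of the cell a function of the point, so that disjointness and the
  nesting of the cells around a point reduce to equations between indices.\<close>

lemma mem_cell: "x \<in> cell m j \<longleftrightarrow> 0 \<le> x \<and> nat \<lfloor>x * 2 ^ m\<rfloor> = j"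
proof -
  have "x \<in> cell m j \<longleftrightarrow> real j \<le> x * 2 ^ m \<and> x * 2 ^ m < real j + 1"
    by (simp add: cell_def pos_divide_le_eq pos_less_divide_eq)
  also have "\<dots> \<longleftrightarrow> \<lfloor>x * 2 ^ m\<rfloor> = int j" by (simp add: floor_eq_iff)
  also have "\<dots> \<longleftrightarrow> 0 \<le> x \<and> nat \<lfloor>x * 2 ^ m\<rfloor> = j"
  proof (cases "0 \<le> x")
    case False
    then have "x * 2 ^ m < 0" by (simp add: mult_neg_pos)
    then have "\<lfloor>x * 2 ^ m\<rfloor> \<noteq> int j" by linarith
    then show ?thesis using False by simp
  qed (auto simp: nat_eq_iff)
  finally show ?thesis .
qed

lemma disjoint_cell: "j \<noteq> k \<Longrightarrow> cell m j \<inter> cell m k = {}"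
  by (auto simp: mem_cell)

lemma cell_Suc: "cell m j = cell (Suc m) (2 * j) \<union> cell (Suc m) (2 * j + 1)"
  by (auto simp: cell_def field_simps)

lemma cell_Suc_subset: "cell (Suc m) j \<subseteq> cell m (j div 2)"
proof -
  have "j = 2 * (j div 2) \<or> j = 2 * (j div 2) + 1" by presburger
  then show ?thesis using cell_Suc[of m "j div 2"] by (metis Un_upper1 Un_upper2)
qed

lemma UN_cell: "(\<Union>j<2 ^ (r + m). cell m j) = {0..<2 ^ r}"
proof (intro set_eqI)
  fix x :: real
  have "x \<in> (\<Union>j<2 ^ (r + m). cell m j) \<longleftrightarrow> 0 \<le> x \<and> nat \<lfloor>x * 2 ^ m\<rfloor> < 2 ^ (r + m)"
    by (auto simp: mem_cell)
  also have "\<dots> \<longleftrightarrow> 0 \<le> x \<and> \<lfloor>x * 2 ^ m\<rfloor> < 2 ^ (r + m)"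
    by (intro conj_cong refl) (simp add: nat_less_iff)
  also have "\<dots> \<longleftrightarrow> 0 \<le> x \<and> x * 2 ^ m < 2 ^ r * 2 ^ m"
    by (simp add: floor_less_iff power_add)
  also have "\<dots> \<longleftrightarrow> x \<in> {0..<2 ^ r}" by simp
  finally show "x \<in> (\<Union>j<2 ^ (r + m). cell m j) \<longleftrightarrow> x \<in> {0..<2 ^ r}" .
qed

lemma cell_subset: "j < 2 ^ (r + m) \<Longrightarrow> cell m j \<subseteq> {0..<2 ^ r}"
  using UN_cell[where r=r and m=m] by blast

lemma INT_cell_index:
  fixes x :: real
  assumes "x \<ge> 0" shows "(\<Inter>m. cell m (nat \<lfloor>x * 2 ^ m\<rfloor>)) = {x}"
proof -
  have "y = x" if y: "\<And>m. y \<in> cell m (nat \<lfloor>x * 2 ^ m\<rfloor>)" for y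
  proof (rule ccontr)
    assume "y \<noteq> x"
    then have "\<bar>y - x\<bar> > 0" by simp
    then obtain m :: nat where m: "inverse \<bar>y - x\<bar> < 2 ^ m" using ex_real_less_power2 by blast
    have "x \<in> cell m (nat \<lfloor>x * 2 ^ m\<rfloor>)" using assms by (simp add: mem_cell)
    with y[of m] have "\<bar>y - x\<bar> < 1 / 2 ^ m" unfolding cell_def by (auto simp: add_divide_distrib abs_less_iff)
    with m \<open>\<bar>y - x\<bar> > 0\<close> show False by (simp add: field_simps)
  qed
  moreover have "x \<in> cell m (nat \<lfloor>x * 2 ^ m\<rfloor>)" for m using assms by (simp add: mem_cell)
  ultimately show ?thesis by auto
qed

lemma decseq_cell_index: "(x::real) \<ge> 0 \<Longrightarrow> decseq (\<lambda>m. cell m (nat \<lfloor>x * 2 ^ m\<rfloor>))"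
proof (rule decseq_SucI)
  fix m assume x: "x \<ge> 0"
  have "x \<in> cell (Suc m) (nat \<lfloor>x * 2 ^ Suc m\<rfloor>)" using x by (simp add: mem_cell)
  then have "x \<in> cell m (nat \<lfloor>x * 2 ^ Suc m\<rfloor> div 2)" using cell_Suc_subset by blast
  then have "nat \<lfloor>x * 2 ^ Suc m\<rfloor> div 2 = nat \<lfloor>x * 2 ^ m\<rfloor>" by (simp add: mem_cell)
  then show "cell (Suc m) (nat \<lfloor>x * 2 ^ Suc m\<rfloor>) \<subseteq> cell m (nat \<lfloor>x * 2 ^ m\<rfloor>)"
    using cell_Suc_subset by metis
qed

text \<open>Only events of the form \<open>D \<in> A\<close> with \<open>A\<close> fixed can be conditioned on \<open>V\<close>. The set of points \<open>x < 2\<^sup>r\<close> with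
  \<open>v {x} < e\<close> is therefore exhausted by unions of dyadic cells of measure less than \<open>e\<close>, which take finitely many
  values at each level \<open>m\<close>.\<close>

definition light_cells :: "real measure \<Rightarrow> ennreal \<Rightarrow> nat \<Rightarrow> nat \<Rightarrow> nat set" where
  "light_cells v e r m = {j. j < 2 ^ (r + m) \<and> emeasure v (cell m j) < e}"

definition light_approx :: "real measure \<Rightarrow> ennreal \<Rightarrow> nat \<Rightarrow> nat \<Rightarrow> real set" where
  "light_approx v e r m = (\<Union>j\<in>light_cells v e r m. cell m j)"

definition light :: "real measure \<Rightarrow> ennreal \<Rightarrow> nat \<Rightarrow> real set" where
  "light v e r = {x \<in> {0..<2 ^ r}. emeasure v {x} < e}"

lemma finite_light_cells [simp]: "finite (light_cells v e r m)"
  by (auto simp: light_cells_def)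

lemma sets_light_approx [measurable, simp]: "light_approx v e r m \<in> sets half_line"
  by (auto simp: light_approx_def)

text \<open>Both halves of a light cell are light, so no point is lost under refinement.\<close>

lemma incseq_light_approx:
  assumes v: "sets v = sets half_line"
  shows "incseq (light_approx v e r)"
proof (rule incseq_SucI, rule subsetI)
  fix m x assume "x \<in> light_approx v e r m"
  then obtain j where j: "x \<in> cell m j" "j < 2 ^ (r + m)" "emeasure v (cell m j) < e"
    by (auto simp: light_approx_def light_cells_def)
  then obtain k where k: "x \<in> cell (Suc m) k" "k \<in> {2 * j, 2 * j + 1}" using cell_Suc[of m j] by blast
  have "cell (Suc m) k \<subseteq> cell m j" using k cell_Suc[of m j] by blast
  then have "emeasure v (cell (Suc m) k) \<le> emeasure v (cell m j)" by (rule emeasure_mono) (simp add: v)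
  then have "k \<in> light_cells v e r (Suc m)" using j k by (auto simp: light_cells_def intro: le_less_trans)
  then show "x \<in> light_approx v e r (Suc m)" using k by (auto simp: light_approx_def)
qed

lemma emeasure_cell_index:
  assumes v: "locally_finite v" and x: "x \<ge> 0"
  shows "(\<lambda>m. emeasure v (cell m (nat \<lfloor>x * 2 ^ m\<rfloor>))) \<longlonglongrightarrow> emeasure v {x}"
proof -
  have s: "sets v = sets half_line" using v by (simp add: locally_finite_def)
  have fin: "emeasure v (cell m j) \<noteq> \<infinity>" for m j using locally_finite_bounded[OF v, of "cell m j"] by simp
  show ?thesis
  proof -
    have "range (\<lambda>m. cell m (nat \<lfloor>x * 2 ^ m\<rfloor>)) \<subseteq> sets v" by (auto simp: s)
    from Lim_emeasure_decseq[OF this decseq_cell_index[OF x] fin] show ?thesis by (simp add: INT_cell_index[OF x])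
  qed
qed

text \<open>The measures of the cells around \<open>x\<close> decrease to that of \<open>{x}\<close>
  by local finiteness. The strict inequality in \<open>light\<close> is what makes some cell around
  a light point light.\<close>

lemma UN_light_approx:
  assumes v: "locally_finite v"
  shows "(\<Union>m. light_approx v e r m) = light v e r"
proof (intro equalityI subsetI)
  have s: "sets v = sets half_line" using v by (simp add: locally_finite_def)
  fix x assume "x \<in> (\<Union>m. light_approx v e r m)"
  then obtain m j where j: "x \<in> cell m j" "j < 2 ^ (r + m)" "emeasure v (cell m j) < e"
    by (auto simp: light_approx_def light_cells_def)
  have "emeasure v {x} \<le> emeasure v (cell m j)"
    using j by (intro emeasure_mono) (auto simp: s)
  then show "x \<in> light v e r" using j cell_subset[of j r m] by (auto simp: light_def intro: le_less_trans)
next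
  fix x assume x: "x \<in> light v e r"
  then have "(\<lambda>m. emeasure v (cell m (nat \<lfloor>x * 2 ^ m\<rfloor>))) \<longlonglongrightarrow> emeasure v {x}"
    by (intro emeasure_cell_index v) (auto simp: light_def)
  moreover have "emeasure v {x} < e" using x by (simp add: light_def)
  ultimately have "eventually (\<lambda>m. emeasure v (cell m (nat \<lfloor>x * 2 ^ m\<rfloor>)) < e) sequentially"
    by (rule order_tendstoD(2))
  then obtain m where m: "emeasure v (cell m (nat \<lfloor>x * 2 ^ m\<rfloor>)) < e" by (auto simp: eventually_sequentially)
  have "x \<in> {0..<2 ^ r}" using x by (simp add: light_def)
  then obtain j where j: "j < 2 ^ (r + m)" "x \<in> cell m j" using UN_cell[where r=r and m=m] by blast
  then have "j = nat \<lfloor>x * 2 ^ m\<rfloor>" by (simp add: mem_cell)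
  then have "j \<in> light_cells v e r m" using m j by (simp add: light_cells_def)
  then show "x \<in> (\<Union>m. light_approx v e r m)" using j by (auto simp: light_approx_def)
qed

lemma sets_light [measurable, simp]:
  assumes v: "locally_finite v" shows "light v e r \<in> sets half_line"
  unfolding UN_light_approx[OF v, symmetric] by auto

text \<open>With threshold \<open>top\<close> a light set is the whole interval, so statements about
  products of two light sets also cover a light set times the interval.\<close>

lemma light_top:
  assumes v: "locally_finite v" shows "light v top r = {0..<2 ^ r}"
proof -
  have "emeasure v {x} < top" if "x \<in> {0..<2 ^ r}" for x
  proof -
    have "emeasure v {x} \<le> emeasure v {0..<2 ^ r}" using that v
      by (intro emeasure_mono) (auto simp: locally_finite_def sets_half_line)
    then show ?thesis using v by (auto simp: locally_finite_def intro: le_less_trans)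
  qed
  then show ?thesis by (auto simp: light_def)
qed

lemma light_measurable_index:
  assumes V: "V \<in> M \<rightarrow>\<^sub>M measure_algebra half_line"
  shows "{\<omega> \<in> space M. light_cells (V \<omega>) e r m = J} \<in> sets (sigma_gen M half_line V)"
proof (cases "J \<subseteq> {..<2 ^ (r + m)}")
  case True
  let ?F = "sigma_gen M half_line V"
  have [measurable]: "(\<lambda>\<omega>. emeasure (V \<omega>) (cell m j)) \<in> borel_measurable ?F" for j
    using measurable_sigma_gen[OF V] by auto
  have "{\<omega> \<in> space ?F. \<forall>j\<in>{..<2 ^ (r + m)}. (emeasure (V \<omega>) (cell m j) < e) = (j \<in> J)} \<in> sets ?F"
    by measurable
  also have "{\<omega> \<in> space ?F. \<forall>j\<in>{..<2 ^ (r + m)}. (emeasure (V \<omega>) (cell m j) < e) = (j \<in> J)} = {\<omega> \<in> space M. light_cells (V \<omega>) e r m = J}"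
    using True by (auto simp: light_cells_def)
  finally show ?thesis .
next
  case False
  then have "{\<omega> \<in> space M. light_cells (V \<omega>) e r m = J} = {}" by (auto simp: light_cells_def)
  then show ?thesis by (simp only: sets.empty_sets)
qed

text \<open>Each level \<open>m\<close> involves finitely many possible sets and is covered by
  \<open>cond_poisson_rect_bound\<close>; continuity from below passes the same bound to the union
  over \<open>m\<close>. Phrasing the event through the approximations makes it measurable, which is
  not evident for the random set \<open>light\<close> itself.\<close>

lemma cond_poisson_light:
  fixes D :: "'w \<Rightarrow> (real \<times> real) measure" and e e' :: ennreal and r :: nat
  assumes M: "prob_space M" and D: "cond_poisson_square M half_line V D"
    and V: "AE \<omega> in M. locally_finite (V \<omega>)"
    and Q: "Q \<in> sets borel" and up: "\<And>x y. x \<in> Q \<Longrightarrow> x \<le> y \<Longrightarrow> y \<in> Q"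
    and bf: "poisson_bound Q b f"
    and f: "f \<ge> 0"
  defines "E \<equiv> {\<omega> \<in> space M. (\<forall>m. emeasure (V \<omega>) (light_approx (V \<omega>) e r m) * emeasure (V \<omega>) (light_approx (V \<omega>) e' r m) \<le> ennreal b) \<and>
     (\<exists>m. emeasure (D \<omega>) (light_approx (V \<omega>) e r m \<times> light_approx (V \<omega>) e' r m) \<in> Q)}"
  shows "measure M E \<le> f" "E \<in> sets M"
proof -
  interpret prob_space M by fact
  let ?T = "measure_algebra (half_line \<Otimes>\<^sub>M half_line)"
  have Vm: "V \<in> M \<rightarrow>\<^sub>M measure_algebra half_line" and Dm: "D \<in> M \<rightarrow>\<^sub>M ?T"
    using D by (auto simp: cond_poisson_square_def regular_cond_distr_def)
  let ?v = "\<lambda>\<omega> m. emeasure (V \<omega>) (light_approx (V \<omega>) e r m) * emeasure (V \<omega>) (light_approx (V \<omega>) e' r m)"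
  let ?d = "\<lambda>\<omega> m. emeasure (D \<omega>) (light_approx (V \<omega>) e r m \<times> light_approx (V \<omega>) e' r m)"
  let ?g = "\<lambda>m \<omega>. (light_cells (V \<omega>) e r m, light_cells (V \<omega>) e' r m)"
  let ?J = "\<lambda>m::nat. Pow {..<(2::nat) ^ (r + m)} \<times> Pow {..<(2::nat) ^ (r + m)}"
  have J: "finite (?J m)" for m by simp
  have gJ: "?g m \<omega> \<in> ?J m" for m \<omega> by (auto simp: light_cells_def)
  have g: "{\<omega> \<in> space M. ?g m \<omega> = i} \<in> sets (sigma_gen M half_line V)" for m i
  proof -
    have "{\<omega> \<in> space M. ?g m \<omega> = i} = {\<omega> \<in> space M. light_cells (V \<omega>) e r m = fst i} \<inter> {\<omega> \<in> space M. light_cells (V \<omega>) e' r m = snd i}"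
      by (auto simp: prod_eq_iff)
    then show ?thesis using light_measurable_index[OF Vm] by auto
  qed
  define R1 where "R1 m i = (\<Union>j\<in>fst i. cell m j)" for m and i :: "nat set \<times> nat set"
  define R2 where "R2 m i = (\<Union>j\<in>snd i. cell m j)" for m and i :: "nat set \<times> nat set"
  have R: "R1 m i \<in> sets half_line" "R2 m i \<in> sets half_line" for m i
    unfolding R1_def R2_def by (intro sets.countable_UN') auto
  have Rg: "R1 m (?g m \<omega>) = light_approx (V \<omega>) e r m" "R2 m (?g m \<omega>) = light_approx (V \<omega>) e' r m" for m \<omega>
    by (auto simp: R1_def R2_def light_approx_def)
  define G where "G m = {\<omega> \<in> space M. ?v \<omega> m \<le> ennreal b \<and> ?d \<omega> m \<in> Q}" for m
  have G': "prob (G m) \<le> f \<and> G m \<in> events" for m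
  proof -
    note * = cond_poisson_rect_bound[where ?R1.0 = "R1 m" and ?R2.0 = "R2 m" and g = "?g m" and J = "?J m" and Q = Q and f = f and b = b, OF M D V J gJ g R Q bf f]
    show ?thesis using * unfolding Rg G_def by blast
  qed
  then have G: "prob (G m) \<le> f" "G m \<in> events" for m by auto
  have vm: "{\<omega> \<in> space M. ?v \<omega> m \<le> ennreal b} \<in> events" for m
  proof -
    \<comment> \<open>A trivial bound: with \<open>Q = UNIV\<close> only the measurability half of
      the rectangle lemma is wanted.\<close>
    have "poisson_bound UNIV b 1"
      by (auto simp: poisson_bound_def poisson_law_def prob_space.prob_le_1)
    note * = cond_poisson_rect_bound(2)[where ?R1.0 = "R1 m" and ?R2.0 = "R2 m" and g = "?g m" and J = "?J m" and Q = UNIV and f = 1 and b = b, OF M D V J gJ g R _ this]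
    show ?thesis using * unfolding Rg by simp
  qed
  \<comment> \<open>The mean bound is imposed at all levels and not only at level \<open>m\<close>;
    together with the upward closure of \<open>Q\<close> this makes \<open>H\<close>
    increasing.\<close>
  define H where "H m = (\<Inter>k. {\<omega> \<in> space M. ?v \<omega> k \<le> ennreal b}) \<inter> G m" for m
  have H: "H m \<in> events" for m unfolding H_def using vm G by (intro sets.Int sets.countable_INT) auto
  have Eq: "E = (\<Union>m. H m)" by (auto simp: E_def H_def G_def)
  show "E \<in> sets M" unfolding Eq using H by auto
  have inc: "incseq H"
  proof (intro incseq_SucI subsetI)
    fix m \<omega> assume w: "\<omega> \<in> H m"
    then have sp: "\<omega> \<in> space M" by (auto simp: H_def)
    have s: "sets (V \<omega>) = sets half_line" "sets (D \<omega>) = sets (half_line \<Otimes>\<^sub>M half_line)"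
      using measurable_space[OF Vm sp] measurable_space[OF Dm sp] by auto
    have "?d \<omega> m \<le> ?d \<omega> (Suc m)"
      using incseq_light_approx[OF s(1), of e r] incseq_light_approx[OF s(1), of e' r]
      by (intro emeasure_mono) (auto simp: s dest: incseq_SucD)
    then show "\<omega> \<in> H (Suc m)" using w up by (auto simp: H_def G_def)
  qed
  have "(\<lambda>m. prob (H m)) \<longlonglongrightarrow> prob E"
    unfolding Eq using H inc by (intro finite_Lim_measure_incseq) auto
  moreover have "prob (H m) \<le> f" for m
    using finite_measure_mono[of "H m" "G m"] G[of m] by (auto simp: H_def intro: order_trans)
  ultimately show "prob E \<le> f" by (intro LIMSEQ_le_const2) auto
qed

lemma emeasure_times_light:
  assumes d: "sets d = sets (half_line \<Otimes>\<^sub>M half_line)" and v: "locally_finite v"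
  shows "emeasure d (light v e r \<times> light v e' r) = (SUP m. emeasure d (light_approx v e r m \<times> light_approx v e' r m))"
proof -
  have s: "sets v = sets half_line" using v by (simp add: locally_finite_def)
  note inc = incseq_light_approx[OF s, of _ r]
  have i: "incseq (\<lambda>m. light_approx v e r m \<times> light_approx v e' r m)"
    using inc[of e] inc[of e'] by (fastforce simp: incseq_def)
  have L: "light v e r = (\<Union>m. light_approx v e r m)" for e by (simp add: UN_light_approx[OF v])
  have "light v e r \<times> light v e' r = (\<Union>m. light_approx v e r m \<times> light_approx v e' r m)"
  proof (intro equalityI subsetI)
    fix p assume "p \<in> light v e r \<times> light v e' r"
    then obtain x y m n where p: "p = (x, y)" "x \<in> light_approx v e r m" "y \<in> light_approx v e' r n"
      unfolding L by auto
    then have "x \<in> light_approx v e r (max m n)" "y \<in> light_approx v e' r (max m n)"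
      using incseqD[OF inc, of m "max m n" e] incseqD[OF inc, of n "max m n" e'] by auto
    then show "p \<in> (\<Union>m. light_approx v e r m \<times> light_approx v e' r m)" using p by auto
  qed (auto simp: L)
  then show ?thesis using i d by (subst SUP_emeasure_incseq) auto
qed

lemma emeasure_light_approx_le:
  assumes v: "locally_finite v"
  shows "emeasure v (light_approx v e r m) \<le> emeasure v (light v e r)"
  unfolding UN_light_approx[OF v, symmetric]
  by (rule emeasure_mono) (use v in \<open>auto simp: locally_finite_def\<close>)

section \<open>Almost sure properties of the conditional Poisson processes\<close>

text \<open>A bound uniform in \<open>k\<close> offers no summability for Borel-Cantelli. It does
  pass to the limit inferior over \<open>k\<close>, an increasing union of intersections; then
  \<open>i\<close> tends to infinity.\<close>

lemma (in prob_space) AE_not_all_liminf: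
  assumes E: "\<And>i k::nat. E i k \<in> events" "\<And>i k. prob (E i k) \<le> f i"
    and f: "f \<longlonglongrightarrow> 0"
  shows "AE \<omega> in M. \<not> (\<forall>i::nat. \<exists>n. \<forall>k\<ge>n. \<omega> \<in> E i k)"
proof -
  define L where "L i = (\<Union>n. \<Inter>k\<in>{n..}. E i k)" for i
  have L: "L i \<in> events" for i unfolding L_def using E by (intro sets.countable_UN sets.countable_INT') auto
  have "prob (L i) \<le> f i" for i
  proof -
    have "(\<lambda>n. prob (\<Inter>k\<in>{n..}. E i k)) \<longlonglongrightarrow> prob (L i)"
      unfolding L_def
    proof (rule finite_Lim_measure_incseq)
      show "range (\<lambda>n. \<Inter>k\<in>{n..}. E i k) \<subseteq> events" using E by (auto intro!: sets.countable_INT')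
      show "incseq (\<lambda>n. \<Inter>k\<in>{n..}. E i k)" by (auto simp: incseq_def)
    qed
    moreover have "prob (\<Inter>k\<in>{n..}. E i k) \<le> f i" for n
      using finite_measure_mono[of "\<Inter>k\<in>{n..}. E i k" "E i n"] E[of i n] by (auto intro: order_trans)
    ultimately show ?thesis by (intro LIMSEQ_le_const2) auto
  qed
  then have "prob (\<Inter>i. L i) \<le> f i" for i
    using finite_measure_mono[of "\<Inter>i. L i" "L i"] L[of i] by (fastforce intro: order_trans)
  then have "prob (\<Inter>i. L i) \<le> 0" using f by (intro LIMSEQ_le_const) auto
  then have "prob (\<Inter>i. L i) = 0" by (simp add: measure_le_0_iff)
  moreover have "(\<Inter>i. L i) \<in> events" using L by (intro sets.countable_INT') auto
  ultimately have "AE \<omega> in M. \<omega> \<notin> (\<Inter>i. L i)" by (simp add: prob_eq_0)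
  then show ?thesis
    unfolding L_def by eventually_elim (metis (no_types, lifting) INT_I UN_I atLeast_iff UNIV_I)
qed

lemma poisson_bound_nonzero:
  assumes "b \<ge> 0" shows "poisson_bound {0<..} b b"
  unfolding poisson_bound_def
proof (intro allI impI)
  fix \<mu> :: "(real \<times> real) measure" and P B
  assume P: "poisson_law \<mu> P" and B: "B \<in> sets \<mu>" and le: "emeasure \<mu> B \<le> ennreal b"
  have fin: "emeasure \<mu> B < \<infinity>" using le by (auto intro: le_less_trans)
  have "measure \<mu> B \<le> b" using le assms by (simp add: measure_def enn2real_leI)
  have "measure P {N \<in> space P. emeasure N B \<in> {0<..}} = 1 - exp (- measure \<mu> B)"
    using poisson_law_nonzero[OF P B fin] by (simp add: zero_less_iff_neq_zero)
  also have "\<dots> \<le> measure \<mu> B" using exp_ge_add_one_self[of "- measure \<mu> B"] by simp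
  finally show "measure P {N \<in> space P. emeasure N B \<in> {0<..}} \<le> b" using \<open>measure \<mu> B \<le> b\<close> by simp
qed

text \<open>The Poisson tail with \<open>t = b\<close>: the level \<open>3 * b\<close> is at least
  twice the mean plus \<open>b\<close>.\<close>

lemma poisson_bound_tail:
  assumes "b \<ge> 0" shows "poisson_bound {ennreal (3 * b)..} b (exp (- b))"
  unfolding poisson_bound_def
proof (intro allI impI)
  fix \<mu> :: "(real \<times> real) measure" and P B
  assume P: "poisson_law \<mu> P" and B: "B \<in> sets \<mu>" and le: "emeasure \<mu> B \<le> ennreal b"
  interpret prob_space P using P by (simp add: poisson_law_def)
  note [measurable] = measurable_emeasure_poisson_law[OF P B(1)]
  have fin: "emeasure \<mu> B < \<infinity>" using le by (auto intro: le_less_trans)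
  have mle: "measure \<mu> B \<le> b" using le assms by (simp add: measure_def enn2real_leI)
  have "measure P {N \<in> space P. emeasure N B \<in> {ennreal (3 * b)..}} \<le> measure P {N \<in> space P. emeasure N B \<ge> ennreal (2 * measure \<mu> B + b)}"
  proof (rule finite_measure_mono)
    have "ennreal (2 * measure \<mu> B + b) \<le> ennreal (3 * b)" using mle by (intro ennreal_leI) simp
    then show "{N \<in> space P. emeasure N B \<in> {ennreal (3 * b)..}} \<subseteq> {N \<in> space P. emeasure N B \<ge> ennreal (2 * measure \<mu> B + b)}"
      by (auto intro: order_trans)
  qed auto
  also have "\<dots> \<le> exp (- b)" by (rule poisson_law_tail[OF P B fin])
  finally show "measure P {N \<in> space P. emeasure N B \<in> {ennreal (3 * b)..}} \<le> exp (- b)" .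
qed

lemma poisson_bound_not_nat: "poisson_bound (- range of_nat) b 0"
  unfolding poisson_bound_def
proof (intro allI impI)
  fix \<mu> :: "(real \<times> real) measure" and P B
  assume P: "poisson_law \<mu> P" and B: "B \<in> sets \<mu>" and le: "emeasure \<mu> B \<le> ennreal b"
  interpret prob_space P using P by (simp add: poisson_law_def)
  have fin: "emeasure \<mu> B < \<infinity>" using le by (auto intro: le_less_trans)
  have "AE N in P. N \<notin> {N \<in> space P. emeasure N B \<in> - range of_nat}"
    using poisson_law_AE_nat[OF P B fin] by eventually_elim auto
  then have "prob {N \<in> space P. emeasure N B \<in> - range of_nat} = 0"
    by (cases "{N \<in> space P. emeasure N B \<in> - range of_nat} \<in> sets P") (auto simp: prob_eq_0 measure_notin_sets)
  then show "measure P {N \<in> space P. emeasure N B \<in> - range of_nat} \<le> 0" by simp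
qed

text \<open>A hit of mean at most \<open>1 / (i + 1)\<close> has at most that probability, uniformly in \<open>k\<close>; the hits for all \<open>k\<close>
  would imply hits of arbitrarily small mean.\<close>

lemma cond_poisson_AE_light_zero:
  fixes D :: "'w \<Rightarrow> (real \<times> real) measure" and e e' :: "nat \<Rightarrow> ennreal"
  assumes M: "prob_space M" and D: "cond_poisson_square M half_line V D"
    and V: "AE \<omega> in M. locally_finite (V \<omega>)"
    and lim: "AE \<omega> in M. (\<lambda>k. emeasure (V \<omega>) (light (V \<omega>) (e k) r) * emeasure (V \<omega>) (light (V \<omega>) (e' k) r)) \<longlonglongrightarrow> 0"
  shows "AE \<omega> in M. \<exists>k. emeasure (D \<omega>) (light (V \<omega>) (e k) r \<times> light (V \<omega>) (e' k) r) = 0"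
proof -
  interpret prob_space M by fact
  have Dm: "D \<in> M \<rightarrow>\<^sub>M measure_algebra (half_line \<Otimes>\<^sub>M half_line)"
    using D by (auto simp: cond_poisson_square_def regular_cond_distr_def)
  define b where "b i = inverse (real (Suc i))" for i :: nat
  have b: "b i > 0" for i by (simp add: b_def)
  define E where "E i k = {\<omega> \<in> space M. (\<forall>m. emeasure (V \<omega>) (light_approx (V \<omega>) (e k) r m) * emeasure (V \<omega>) (light_approx (V \<omega>) (e' k) r m) \<le> ennreal (b i)) \<and>
     (\<exists>m. emeasure (D \<omega>) (light_approx (V \<omega>) (e k) r m \<times> light_approx (V \<omega>) (e' k) r m) \<in> {0<..})}" for i k
  have up: "\<And>x y::ennreal. x \<in> {0<..} \<Longrightarrow> x \<le> y \<Longrightarrow> y \<in> {0<..}" by auto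
  have E: "E i k \<in> events" "prob (E i k) \<le> b i" for i k
    unfolding E_def using cond_poisson_light[where b = "b i" and e = "e k" and r = r and e' = "e' k", OF M D V _ up poisson_bound_nonzero] b[of i] by auto
  have "b \<longlonglongrightarrow> 0" unfolding b_def by (rule LIMSEQ_inverse_real_of_nat)
  then have "AE \<omega> in M. \<not> (\<forall>i::nat. \<exists>n. \<forall>k\<ge>n. \<omega> \<in> E i k)"
    by (rule AE_not_all_liminf[OF E])
  with V lim AE_space show ?thesis
  proof eventually_elim
    case (elim \<omega>)
    have sD: "sets (D \<omega>) = sets (half_line \<Otimes>\<^sub>M half_line)"
      using measurable_space[OF Dm elim(3)] by simp
    show ?case
    proof (rule ccontr)
      assume neg: "\<not> ?thesis"
      have "\<exists>n. \<forall>k\<ge>n. \<omega> \<in> E i k" for i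
      proof -
        have "eventually (\<lambda>k. emeasure (V \<omega>) (light (V \<omega>) (e k) r) * emeasure (V \<omega>) (light (V \<omega>) (e' k) r) < ennreal (b i)) sequentially"
          using elim(2) b[of i] by (intro order_tendstoD(2)) auto
        then obtain n where n: "\<And>k. k \<ge> n \<Longrightarrow> emeasure (V \<omega>) (light (V \<omega>) (e k) r) * emeasure (V \<omega>) (light (V \<omega>) (e' k) r) < ennreal (b i)"
          by (auto simp: eventually_sequentially)
        have "\<omega> \<in> E i k" if "k \<ge> n" for k
        proof -
          have "emeasure (V \<omega>) (light_approx (V \<omega>) (e k) r m) * emeasure (V \<omega>) (light_approx (V \<omega>) (e' k) r m) \<le> ennreal (b i)" for m
          proof -
            have "emeasure (V \<omega>) (light_approx (V \<omega>) (e k) r m) * emeasure (V \<omega>) (light_approx (V \<omega>) (e' k) r m)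
              \<le> emeasure (V \<omega>) (light (V \<omega>) (e k) r) * emeasure (V \<omega>) (light (V \<omega>) (e' k) r)"
              by (intro mult_mono emeasure_light_approx_le elim) auto
            also have "\<dots> \<le> ennreal (b i)" using n[OF that] by simp
            finally show ?thesis .
          qed
          moreover have "\<exists>m. emeasure (D \<omega>) (light_approx (V \<omega>) (e k) r m \<times> light_approx (V \<omega>) (e' k) r m) \<in> {0<..}"
          proof (rule ccontr)
            assume "\<not> ?thesis"
            then have "emeasure (D \<omega>) (light (V \<omega>) (e k) r \<times> light (V \<omega>) (e' k) r) = 0"
              unfolding emeasure_times_light[OF sD elim(1)] by (auto simp: zero_less_iff_neq_zero)
            then show False using neg by auto
          qed
          ultimately show ?thesis using elim(3) by (auto simp: E_def)
        qed
        then show ?thesis by auto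
      qed
      then show False using elim(4) by blast
    qed
  qed
qed

text \<open>For a locally finite \<open>v\<close> the set of non-atoms is the intersection of the
  sets \<open>light v (eps k) r\<close>, hence measurable, so the value 0 is not the default value
  of a non-measurable set.\<close>

definition atomic :: "real measure \<Rightarrow> bool" where
  "atomic v \<longleftrightarrow> (\<forall>r::nat. emeasure v {x \<in> {0..<2 ^ r}. emeasure v {x} = 0} = 0)"

definition eps :: "nat \<Rightarrow> ennreal" where
  "eps k = ennreal (inverse (real (Suc k)))"

lemma eps_pos [simp]: "0 < eps k"
  by (simp add: eps_def)

lemma eps_tendsto: "eps \<longlonglongrightarrow> 0"
  using tendsto_ennrealI[OF LIMSEQ_inverse_real_of_nat] unfolding eps_def by simp

lemma light_tendsto_0:
  assumes v: "locally_finite v" "atomic v"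
  shows "(\<lambda>k. emeasure v (light v (eps k) r)) \<longlonglongrightarrow> 0"
proof -
  have s: "sets v = sets half_line" using v by (simp add: locally_finite_def)
  have dec: "decseq (\<lambda>k. light v (eps k) r)"
  proof (rule decseq_SucI, rule subsetI)
    fix k x assume "x \<in> light v (eps (Suc k)) r"
    moreover have "eps (Suc k) \<le> eps k" unfolding eps_def by (intro ennreal_leI le_imp_inverse_le) auto
    ultimately show "x \<in> light v (eps k) r" by (auto simp: light_def intro: less_le_trans)
  qed
  have INT: "(\<Inter>k. light v (eps k) r) = {x \<in> {0..<2 ^ r}. emeasure v {x} = 0}"
  proof (intro equalityI subsetI)
    fix x assume x: "x \<in> (\<Inter>k. light v (eps k) r)"
    then have "emeasure v {x} \<le> eps k" for k by (auto simp: light_def intro: less_imp_le)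
    then have "emeasure v {x} \<le> 0" by (intro LIMSEQ_le_const[OF eps_tendsto]) auto
    then show "x \<in> {x \<in> {0..<2 ^ r}. emeasure v {x} = 0}" using x by (auto simp: light_def)
  next
    fix x assume "x \<in> {x \<in> {0..<2 ^ r}. emeasure v {x} = 0}"
    then show "x \<in> (\<Inter>k. light v (eps k) r)" by (auto simp: light_def eps_pos)
  qed
  have fin: "emeasure v (light v (eps k) r) \<noteq> \<infinity>" for k
  proof -
    have "emeasure v (light v (eps k) r) \<le> emeasure v {0..<2 ^ r}"
      by (rule emeasure_mono) (auto simp: light_def s sets_half_line)
    then show ?thesis using v by (auto simp: locally_finite_def top_unique dest: spec[of _ r])
  qed
  have "range (\<lambda>k. light v (eps k) r) \<subseteq> sets v" using v by (auto simp: s)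
  from Lim_emeasure_decseq[OF this dec fin] show ?thesis
    unfolding INT using v by (simp add: atomic_def)
qed

lemma emeasure_mult_tendsto_0:
  fixes f :: "nat \<Rightarrow> ennreal"
  assumes "f \<longlonglongrightarrow> 0" "c < \<infinity>" shows "(\<lambda>k. f k * c) \<longlonglongrightarrow> 0"
  using tendsto_mult_ennreal[OF assms(1) tendsto_const[of c]] assms(2) by simp

text \<open>The set of non-atoms of \<open>V\<close> is random, so it cannot be inserted into the
  Poisson law directly. Instead strips over points of mass less than \<open>eps k\<close> are used:
  their conditional mean tends to 0 because \<open>V\<close> is atomic, and so some strip is empty.
  The same is done for the second coordinate.\<close>

lemma cond_poisson_AE_support:
  fixes D :: "'w \<Rightarrow> (real \<times> real) measure"
  assumes M: "prob_space M" and D: "cond_poisson_square M half_line V D"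
    and V: "AE \<omega> in M. locally_finite (V \<omega>)" "AE \<omega> in M. atomic (V \<omega>)"
  shows "AE \<omega> in M. \<forall>x y. emeasure (D \<omega>) {(x, y)} \<noteq> 0 \<longrightarrow> emeasure (V \<omega>) {x} \<noteq> 0 \<and> emeasure (V \<omega>) {y} \<noteq> 0"
proof -
  have Dm: "D \<in> M \<rightarrow>\<^sub>M measure_algebra (half_line \<Otimes>\<^sub>M half_line)"
    using D by (auto simp: cond_poisson_square_def regular_cond_distr_def)
  have "AE \<omega> in M. \<exists>k. emeasure (D \<omega>) (light (V \<omega>) (eps k) r \<times> light (V \<omega>) top r) = 0" for r
  proof (rule cond_poisson_AE_light_zero[OF M D V(1)])
    show "AE \<omega> in M. (\<lambda>k. emeasure (V \<omega>) (light (V \<omega>) (eps k) r) * emeasure (V \<omega>) (light (V \<omega>) top r)) \<longlonglongrightarrow> 0"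
      using V by eventually_elim (auto intro!: emeasure_mult_tendsto_0 light_tendsto_0 simp: light_top locally_finite_def)
  qed
  moreover have "AE \<omega> in M. \<exists>k. emeasure (D \<omega>) (light (V \<omega>) top r \<times> light (V \<omega>) (eps k) r) = 0" for r
  proof (rule cond_poisson_AE_light_zero[OF M D V(1)])
    show "AE \<omega> in M. (\<lambda>k. emeasure (V \<omega>) (light (V \<omega>) top r) * emeasure (V \<omega>) (light (V \<omega>) (eps k) r)) \<longlonglongrightarrow> 0"
      using V by eventually_elim (subst mult.commute, auto intro!: emeasure_mult_tendsto_0 light_tendsto_0 simp: light_top locally_finite_def)
  qed
  ultimately have "AE \<omega> in M. (\<forall>r. \<exists>k. emeasure (D \<omega>) (light (V \<omega>) (eps k) r \<times> light (V \<omega>) top r) = 0) \<and>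
     (\<forall>r. \<exists>k. emeasure (D \<omega>) (light (V \<omega>) top r \<times> light (V \<omega>) (eps k) r) = 0)"
    by (simp add: AE_all_countable)
  with V(1) AE_space show ?thesis
  proof eventually_elim
    case (elim \<omega>)
    have sD: "sets (D \<omega>) = sets (half_line \<Otimes>\<^sub>M half_line)"
      using measurable_space[OF Dm elim(2)] by simp
    show ?case
    proof (intro allI impI)
      fix x y assume nz: "emeasure (D \<omega>) {(x, y)} \<noteq> 0"
      then have "{(x, y)} \<in> sets (half_line \<Otimes>\<^sub>M half_line)"
        using emeasure_notin_sets[of "{(x, y)}" "D \<omega>"] sD by auto
      then have "(x, y) \<in> {0..} \<times> {0..}"
        using sets.sets_into_space[of "{(x, y)}" "half_line \<Otimes>\<^sub>M half_line"] by (simp add: space_pair_measure)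
      then have xy: "x \<ge> 0" "y \<ge> 0" by auto
      obtain r :: nat where "max x y < 2 ^ r" using ex_real_less_power2 by blast
      then have r: "x \<in> {0..<2 ^ r}" "y \<in> {0..<2 ^ r}" using xy by auto
      have notin: "emeasure (D \<omega>) (light (V \<omega>) a r \<times> light (V \<omega>) b r) = 0 \<Longrightarrow> \<not> (x \<in> light (V \<omega>) a r \<and> y \<in> light (V \<omega>) b r)" for a b
      proof
        assume 0: "emeasure (D \<omega>) (light (V \<omega>) a r \<times> light (V \<omega>) b r) = 0" and "x \<in> light (V \<omega>) a r \<and> y \<in> light (V \<omega>) b r"
        then have "emeasure (D \<omega>) {(x, y)} \<le> emeasure (D \<omega>) (light (V \<omega>) a r \<times> light (V \<omega>) b r)"
          using elim(1) by (intro emeasure_mono) (auto simp: sD)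
        then show False using 0 nz by simp
      qed
      obtain k where "emeasure (D \<omega>) (light (V \<omega>) (eps k) r \<times> light (V \<omega>) top r) = 0" using elim(3) by blast
      from notin[OF this] have 1: "x \<notin> light (V \<omega>) (eps k) r" using r by (auto simp: light_top[OF elim(1)])
      obtain l where "emeasure (D \<omega>) (light (V \<omega>) top r \<times> light (V \<omega>) (eps l) r) = 0" using elim(3) by blast
      from notin[OF this] have 2: "y \<notin> light (V \<omega>) (eps l) r" using r by (auto simp: light_top[OF elim(1)])
      show "emeasure (V \<omega>) {x} \<noteq> 0 \<and> emeasure (V \<omega>) {y} \<noteq> 0"
        using 1 2 r by (auto simp: light_def eps_pos)
    qed
  qed
qed

text \<open>The conditional mean of the light square is the square of the light mass, so the Poisson
  tail at three times a bound of it applies. The bound on the mass is kept as a premise inside the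
  almost sure event, for all \<open>C\<close> at once, since it is a property of \<open>V\<close>
  that is established separately.\<close>

lemma cond_poisson_AE_light_bound:
  fixes D :: "'w \<Rightarrow> (real \<times> real) measure"
  assumes M: "prob_space M" and D: "cond_poisson_square M half_line V D"
    and V: "AE \<omega> in M. locally_finite (V \<omega>)"
  shows "AE \<omega> in M. \<forall>C::nat. \<forall>\<^sub>F r in sequentially. emeasure (V \<omega>) (light (V \<omega>) 1 r) \<le> of_nat (C * 2 ^ r) \<longrightarrow>
     emeasure (D \<omega>) (light (V \<omega>) 1 r \<times> light (V \<omega>) 1 r) \<le> of_nat (3 * (Suc C)\<^sup>2 * 4 ^ r)"
proof -
  interpret prob_space M by fact
  have Dm: "D \<in> M \<rightarrow>\<^sub>M measure_algebra (half_line \<Otimes>\<^sub>M half_line)"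
    using D by (auto simp: cond_poisson_square_def regular_cond_distr_def)
  have "AE \<omega> in M. \<forall>\<^sub>F r in sequentially. emeasure (V \<omega>) (light (V \<omega>) 1 r) \<le> of_nat (C * 2 ^ r) \<longrightarrow>
     emeasure (D \<omega>) (light (V \<omega>) 1 r \<times> light (V \<omega>) 1 r) \<le> of_nat (3 * (Suc C)\<^sup>2 * 4 ^ r)" for C :: nat
  proof -
    \<comment> \<open>With \<open>Suc C\<close> in place of \<open>C\<close> the parameter is at
      least \<open>4 ^ r\<close> even for \<open>C = 0\<close>, so the tails
      \<open>exp (- b r)\<close> are summable.\<close>
    define b where "b r = real ((Suc C)\<^sup>2 * 4 ^ r)" for r :: nat
    have b: "b r \<ge> 4 ^ r" for r
    proof -
      have "1 * 4 ^ r \<le> (Suc C)\<^sup>2 * 4 ^ r" by (intro mult_right_mono) auto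
      then show ?thesis unfolding b_def by (metis mult_1 of_nat_le_iff of_nat_numeral of_nat_power)
    qed
    then have b0: "b r > 0" for r by (smt (verit) zero_less_power)
    define E where "E r = {\<omega> \<in> space M. (\<forall>m. emeasure (V \<omega>) (light_approx (V \<omega>) 1 r m) * emeasure (V \<omega>) (light_approx (V \<omega>) 1 r m) \<le> ennreal (b r)) \<and>
     (\<exists>m. emeasure (D \<omega>) (light_approx (V \<omega>) 1 r m \<times> light_approx (V \<omega>) 1 r m) \<in> {ennreal (3 * b r)..})}" for r
    have up: "\<And>x y z::ennreal. x \<in> {z..} \<Longrightarrow> x \<le> y \<Longrightarrow> y \<in> {z..}" by auto
    have E: "E r \<in> events" "prob (E r) \<le> exp (- b r)" for r
      unfolding E_def using cond_poisson_light[where b = "b r" and e = 1 and r = r and e' = 1, OF M D V _ up poisson_bound_tail] b0[of r] by auto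
    have "prob (E r) \<le> (1 / 2) ^ r * 1" for r
    proof -
      have "(2::real) ^ r \<le> b r" using b[of r] power_mono[of "2::real" 4 r] by linarith
      then have "exp (- b r) \<le> exp (- (1 * 2 ^ r))" by simp
      also have "\<dots> \<le> (1 / 2) ^ r * 1" using exp_minus_mult_power2_le[of 1 r] by simp
      finally show ?thesis using E(2)[of r] by linarith
    qed
    from AE_eventually_notin[OF E(1) this]
    have "AE \<omega> in M. \<forall>\<^sub>F r in sequentially. \<omega> \<notin> E r" .
    with V AE_space show ?thesis
    proof eventually_elim
      case (elim \<omega>)
      have sD: "sets (D \<omega>) = sets (half_line \<Otimes>\<^sub>M half_line)"
        using measurable_space[OF Dm elim(2)] by simp
      show ?case using elim(3)
      proof eventually_elim
        case e: (elim r)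
        show ?case
        proof
          assume le: "emeasure (V \<omega>) (light (V \<omega>) 1 r) \<le> of_nat (C * 2 ^ r)"
          have "emeasure (V \<omega>) (light_approx (V \<omega>) 1 r m) * emeasure (V \<omega>) (light_approx (V \<omega>) 1 r m) \<le> ennreal (b r)" for m
          proof -
            have "emeasure (V \<omega>) (light_approx (V \<omega>) 1 r m) * emeasure (V \<omega>) (light_approx (V \<omega>) 1 r m)
              \<le> of_nat (C * 2 ^ r) * of_nat (C * 2 ^ r)"
              using emeasure_light_approx_le[OF elim(1), of 1 r m] le by (intro mult_mono) (auto intro: order_trans)
            also have "\<dots> = of_nat (C\<^sup>2 * 4 ^ r)"
              unfolding of_nat_mult[symmetric] by (simp add: power2_eq_square power_mult_distrib[symmetric] ac_simps)
            also have "\<dots> \<le> of_nat ((Suc C)\<^sup>2 * 4 ^ r)" by (intro of_nat_mono mult_right_mono power_mono) auto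
            also have "\<dots> = ennreal (b r)" unfolding b_def by (simp only: ennreal_of_nat_eq_real_of_nat)
            finally show ?thesis .
          qed
          with e elim(2) have "emeasure (D \<omega>) (light_approx (V \<omega>) 1 r m \<times> light_approx (V \<omega>) 1 r m) \<le> ennreal (3 * b r)" for m
            by (force simp: E_def not_le intro: less_imp_le)
          then have "emeasure (D \<omega>) (light (V \<omega>) 1 r \<times> light (V \<omega>) 1 r) \<le> ennreal (3 * b r)"
            unfolding emeasure_times_light[OF sD elim(1)] by (rule SUP_least)
          also have "ennreal (3 * b r) = of_nat (3 * (Suc C)\<^sup>2 * 4 ^ r)"
            unfolding b_def ennreal_of_nat_eq_real_of_nat by (simp add: mult.assoc)
          finally show "emeasure (D \<omega>) (light (V \<omega>) 1 r \<times> light (V \<omega>) 1 r) \<le> of_nat (3 * (Suc C)\<^sup>2 * 4 ^ r)" .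
        qed
      qed
    qed
  qed
  then show ?thesis by (simp add: AE_all_countable)
qed

text \<open>The mean of a product of cells is finite but random, with no deterministic bound. It
  lies below some natural number \<open>b\<close>, and each of the countably many \<open>b\<close>
  contributes one null set.\<close>

lemma cond_poisson_AE_nat:
  fixes D :: "'w \<Rightarrow> (real \<times> real) measure"
  assumes M: "prob_space M" and D: "cond_poisson_square M half_line V D"
    and V: "AE \<omega> in M. locally_finite (V \<omega>)"
  shows "AE \<omega> in M. \<forall>m i j. emeasure (D \<omega>) (cell m i \<times> cell m j) \<in> range of_nat"
proof -
  interpret prob_space M by fact
  have Q: "- range of_nat \<in> sets (borel :: ennreal measure)"
  proof (rule borel_comp, rule sets.countable)
    show "countable (range of_nat :: ennreal set)" by (rule countable_image) simp
  qed simp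
  have "AE \<omega> in M. \<not> (emeasure (V \<omega>) (cell m i) * emeasure (V \<omega>) (cell m j) \<le> ennreal (real b) \<and>
     emeasure (D \<omega>) (cell m i \<times> cell m j) \<in> - range of_nat)" for m i j and b :: nat
  proof -
    let ?E = "{\<omega> \<in> space M. emeasure (V \<omega>) (cell m i) * emeasure (V \<omega>) (cell m j) \<le> ennreal (real b) \<and>
     emeasure (D \<omega>) (cell m i \<times> cell m j) \<in> - range of_nat}"
    have m: "{\<omega> \<in> space M. () = x} \<in> sets (sigma_gen M half_line V)" for x
      using sets.top[of "sigma_gen M half_line V"] by simp
    have "prob ?E \<le> 0"
      by (rule cond_poisson_rect_bound(1)[where g = "\<lambda>_. ()" and J = "{()}" and ?R1.0 = "\<lambda>_. cell m i" and ?R2.0 = "\<lambda>_. cell m j"])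
        (use M D V Q m poisson_bound_not_nat in auto)
    moreover have "?E \<in> events"
      by (rule cond_poisson_rect_bound(2)[where g = "\<lambda>_. ()" and J = "{()}" and ?R1.0 = "\<lambda>_. cell m i" and ?R2.0 = "\<lambda>_. cell m j" and f = 0])
        (use M D V Q m poisson_bound_not_nat in auto)
    ultimately have "AE \<omega> in M. \<omega> \<notin> ?E" by (simp add: prob_eq_0 measure_le_0_iff)
    with AE_space show ?thesis by eventually_elim auto
  qed
  then have "AE \<omega> in M. \<forall>m i j. \<forall>b::nat. \<not> (emeasure (V \<omega>) (cell m i) * emeasure (V \<omega>) (cell m j) \<le> ennreal (real b) \<and>
     emeasure (D \<omega>) (cell m i \<times> cell m j) \<in> - range of_nat)"
    unfolding AE_all_countable by blast
  with V show ?thesis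
  proof eventually_elim
    case (elim \<omega>)
    have fin: "emeasure (V \<omega>) (cell m j) < \<infinity>" for m j by (rule locally_finite_bounded[OF elim(1)]) auto
    show ?case
    proof (intro allI)
      fix m i j
      have "emeasure (V \<omega>) (cell m i) * emeasure (V \<omega>) (cell m j) < \<infinity>"
        using fin by (simp add: ennreal_mult_less_top)
      then obtain b :: nat where "emeasure (V \<omega>) (cell m i) * emeasure (V \<omega>) (cell m j) < of_nat b"
        using ennreal_Ex_less_of_nat by auto
      then have "emeasure (V \<omega>) (cell m i) * emeasure (V \<omega>) (cell m j) \<le> ennreal (real b)"
        by (simp add: ennreal_of_nat_eq_real_of_nat)
      then show "emeasure (D \<omega>) (cell m i \<times> cell m j) \<in> range of_nat" using elim(2) by blast
    qed
  qed
qed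

text \<open>At least geometric growth of \<open>n r\<close> makes the Chernoff bounds summable. That
  sufficiently many rectangles are eligible concerns \<open>V\<close> alone and stays a
  premise.\<close>

lemma cond_poisson_AE_hits:
  fixes D :: "'w \<Rightarrow> (real \<times> real) measure" and I :: "nat \<Rightarrow> 'i set" and n :: "nat \<Rightarrow> nat"
  assumes M: "prob_space M" and D: "cond_poisson_square M half_line V D"
    and V: "AE \<omega> in M. locally_finite (V \<omega>)"
    and I: "\<And>r. finite (I r)" and R: "\<And>r i. R1 r i \<in> sets half_line" "\<And>r i. R2 r i \<in> sets half_line"
    and bnd: "\<And>r i. bounded (R1 r i)" "\<And>r i. bounded (R2 r i)"
    and dj: "\<And>r. disjoint_family_on (\<lambda>i. R1 r i \<times> R2 r i) (I r)"
    and c: "c > 0" and a: "a > 0" and n: "\<And>r. real (n r) \<ge> a * 2 ^ r"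
  shows "AE \<omega> in M. \<forall>\<^sub>F r in sequentially. real (n r) \<le> card {i \<in> I r. emeasure (V \<omega>) (R1 r i) * emeasure (V \<omega>) (R2 r i) \<ge> ennreal c} \<longrightarrow>
     real (card {i \<in> I r. emeasure (D \<omega>) (R1 r i \<times> R2 r i) \<noteq> 0}) > (1 - exp (- c)) / 2 * n r"
proof -
  interpret prob_space M by fact
  define E where "E r = {\<omega> \<in> space M. real (n r) \<le> card {i \<in> I r. emeasure (V \<omega>) (R1 r i) * emeasure (V \<omega>) (R2 r i) \<ge> ennreal c} \<and>
     real (card {i \<in> I r. emeasure (D \<omega>) (R1 r i \<times> R2 r i) \<noteq> 0}) \<le> (1 - exp (- c)) / 2 * n r}" for r
  define p where "p = (1 - exp (- c)) / 10"
  have p: "p > 0" using c by (simp add: p_def)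
  have E: "E r \<in> events" "prob (E r) \<le> exp (- (1 - exp (- c)) / 10 * n r)" for r
    unfolding E_def using cond_poisson_hits[where ?R1.0 = "R1 r" and ?R2.0 = "R2 r" and c = c and n = "n r", OF M D V I R bnd dj] c by auto
  have E': "prob (E r) \<le> exp (- p * n r)" for r
  proof -
    have "- (1 - exp (- c)) / 10 * n r = - p * n r" by (simp only: p_def minus_divide_left)
    with E(2)[of r] show ?thesis by metis
  qed
  have "prob (E r) \<le> (1 / 2) ^ r * inverse (p * a)" for r
  proof -
    have "exp (- p * n r) \<le> exp (- (p * a * 2 ^ r))"
      using n[of r] p by (simp add: mult.assoc)
    also have "\<dots> \<le> (1 / 2) ^ r * inverse (p * a)" by (rule exp_minus_mult_power2_le) (use p a in simp)
    finally show ?thesis using E'[of r] by linarith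
  qed
  from AE_eventually_notin[OF E(1) this] AE_space
  show ?thesis
  proof eventually_elim
    case (elim \<omega>)
    from elim(1) show ?case by eventually_elim (use elim(2) in \<open>auto simp: E_def not_le\<close>)
  qed
qed

section \<open>Simple point configurations of jump_measure\<close>

lemma card_le_emeasure:
  assumes B: "B \<in> sets N" "emeasure N B < \<infinity>"
    and A: "disjoint_family_on A X" "\<And>x. x \<in> X \<Longrightarrow> A x \<in> sets N \<and> A x \<subseteq> B \<and> 1 \<le> emeasure N (A x)"
  shows "finite X" "of_nat (card X) \<le> emeasure N B"
proof -
  have le: "of_nat (card Y) \<le> emeasure N B" if Y: "finite Y" "Y \<subseteq> X" for Y
  proof -
    have "of_nat (card Y) = (\<Sum>x\<in>Y. 1 :: ennreal)" by simp
    also have "\<dots> \<le> (\<Sum>x\<in>Y. emeasure N (A x))" using A Y by (intro sum_mono) auto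
    also have "\<dots> = emeasure N (\<Union>x\<in>Y. A x)"
      using A Y disjoint_family_on_mono[OF Y(2) A(1)] by (intro sum_emeasure) auto
    also have "\<dots> \<le> emeasure N B" using A B Y by (intro emeasure_mono) auto
    finally show ?thesis .
  qed
  show f: "finite X"
  proof (rule ccontr)
    assume inf: "infinite X"
    obtain n :: nat where n: "emeasure N B < of_nat n" using B(2) ennreal_Ex_less_of_nat by auto
    obtain Y where Y: "finite Y" "Y \<subseteq> X" "card Y = n" using infinite_arbitrarily_large[OF inf, of n] by blast
    then show False using le[of Y] n by auto
  qed
  show "of_nat (card X) \<le> emeasure N B" using le[OF f] by simp
qed

text \<open>A decreasing sequence of natural numbers is eventually constant, so by continuity from
  above the intersection has exactly the mass of some member. This is how counts in cells determine
  counts at points.\<close>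

lemma emeasure_INT_nat:
  assumes C: "range C \<subseteq> sets N" "decseq C" and nat: "\<And>n. emeasure N (C n) \<in> range of_nat"
  shows "\<exists>n. emeasure N (\<Inter>i. C i) = emeasure N (C n)"
proof -
  obtain f where f: "\<And>n. emeasure N (C n) = of_nat (f n)" using nat unfolding image_iff by metis
  obtain n where n: "\<And>m. f n \<le> f m" using ex_has_least_nat[of "\<lambda>_. True" undefined f] by auto
  have fin: "emeasure N (C i) \<noteq> \<infinity>" for i unfolding f by simp
  have "f m = f n" if "m \<ge> n" for m
  proof -
    have "emeasure N (C m) \<le> emeasure N (C n)"
      using C that by (intro emeasure_mono decseqD[of C]) auto
    then show ?thesis using n[of m] unfolding f by simp
  qed
  then have "\<forall>\<^sub>F m in sequentially. emeasure N (C m) = emeasure N (C n)"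
    unfolding f eventually_sequentially by metis
  then have "(\<lambda>m. emeasure N (C m)) \<longlonglongrightarrow> emeasure N (C n)" by (rule tendsto_eventually)
  moreover have "(\<lambda>m. emeasure N (C m)) \<longlonglongrightarrow> emeasure N (\<Inter>i. C i)"
    using Lim_emeasure_decseq[OF C fin] .
  ultimately show ?thesis using LIMSEQ_unique by blast
qed

text \<open>A charged cell has a charged child, which yields an infinite branch. The masses along it
  are nonzero natural numbers, so its intersection keeps positive mass; for arbitrary measures it
  could be null.\<close>

lemma tree_descent:
  fixes C :: "nat \<Rightarrow> 'i \<Rightarrow> 'a set"
  assumes C: "\<And>m j. C m j \<in> sets N" and ch: "\<And>m j. C m j = (\<Union>k\<in>ch j. C (Suc m) k)" "\<And>j. finite (ch j)"
    and nat: "\<And>m j. emeasure N (C m j) \<in> range of_nat" and nz: "emeasure N (C m j) \<noteq> 0"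
  shows "\<exists>f. f 0 = j \<and> (\<forall>n. f (Suc n) \<in> ch (f n)) \<and> emeasure N (\<Inter>n. C (m + n) (f n)) \<noteq> 0"
proof -
  have "\<exists>f. f 0 = j \<and> (\<forall>n. emeasure N (C (m + n) (f n)) \<noteq> 0 \<and> f (Suc n) \<in> ch (f n))"
  proof -
    have "\<exists>f. \<forall>n. (emeasure N (C (m + n) (f n)) \<noteq> 0 \<and> (n = 0 \<longrightarrow> f n = j)) \<and> f (Suc n) \<in> ch (f n)"
    proof (rule dependent_nat_choice)
      show "\<exists>x. emeasure N (C (m + 0) x) \<noteq> 0 \<and> (0 = (0::nat) \<longrightarrow> x = j)" using nz by auto
      fix x n assume x: "emeasure N (C (m + n) x) \<noteq> 0 \<and> (n = 0 \<longrightarrow> x = j)"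
      have "\<exists>y\<in>ch x. emeasure N (C (m + Suc n) y) \<noteq> 0"
      proof (rule ccontr)
        assume "\<not> ?thesis"
        then have "\<And>y. y \<in> ch x \<Longrightarrow> C (Suc (m + n)) y \<in> null_sets N" using C by auto
        then have "(\<Union>y\<in>ch x. C (Suc (m + n)) y) \<in> null_sets N"
          using ch(2) by (intro null_sets_UN') (auto intro: countable_finite)
        then show False using x ch(1)[of "m + n" x] by auto
      qed
      then show "\<exists>y. (emeasure N (C (m + Suc n) y) \<noteq> 0 \<and> (Suc n = 0 \<longrightarrow> y = j)) \<and> y \<in> ch x" by auto
    qed
    then show ?thesis by blast
  qed
  then obtain f where f: "f 0 = j" "\<And>n. emeasure N (C (m + n) (f n)) \<noteq> 0" "\<And>n. f (Suc n) \<in> ch (f n)" by blast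
  have "decseq (\<lambda>n. C (m + n) (f n))"
  proof (rule decseq_SucI)
    fix n show "C (m + Suc n) (f (Suc n)) \<subseteq> C (m + n) (f n)" using ch(1)[of "m + n" "f n"] f(3)[of n] by auto
  qed
  then have "\<exists>i. emeasure N (\<Inter>n. C (m + n) (f n)) = emeasure N (C (m + i) (f i))"
    by (intro emeasure_INT_nat nat) (use C in auto)
  then have "emeasure N (\<Inter>n. C (m + n) (f n)) \<noteq> 0" using f(2) by auto
  then show ?thesis using f by blast
qed

lemma INT_cells_subset:
  assumes "x \<in> (\<Inter>n. cell (m + n) (f n))" shows "(\<Inter>n. cell (m + n) (f n)) = {x}"
proof -
  have x0: "x \<ge> 0" using assms by (auto simp: mem_cell)
  have fx: "f n = nat \<lfloor>x * 2 ^ (m + n)\<rfloor>" for n using assms by (auto simp: mem_cell)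
  have "y = x" if "y \<in> (\<Inter>n. cell (m + n) (f n))" for y
  proof -
    have "y \<in> cell k (nat \<lfloor>x * 2 ^ k\<rfloor>)" for k
    proof -
      have "y \<in> cell (m + k) (nat \<lfloor>x * 2 ^ (m + k)\<rfloor>)" using that by (auto simp: fx)
      then show ?thesis using decseqD[OF decseq_cell_index[OF x0], of k "m + k"] by auto
    qed
    then show ?thesis using INT_cell_index[OF x0] by blast
  qed
  then show ?thesis using assms by blast
qed

section \<open>Jumps sorted by sign and dyadic size\<close>

abbreviation nonzero_reals :: "real measure" where
  "nonzero_reals \<equiv> restrict_space borel (- {0})"

lemma sets_nonzero_reals: "A \<in> sets nonzero_reals \<longleftrightarrow> A \<in> sets borel \<and> 0 \<notin> A"
  by (auto simp: sets_restrict_space_iff)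

text \<open>The sign \<open>s\<close> is 1 or -1, so that \<open>W\<^sub>+\<close> and \<open>W\<^sub>-\<close> are treated simultaneously.\<close>

definition up :: "real \<Rightarrow> int \<Rightarrow> real set" where
  "up s k = {w. 2 powi k < s * w}"

definition bin :: "real \<Rightarrow> int \<Rightarrow> real set" where
  "bin s k = {w. 2 powi k < s * w \<and> s * w \<le> 2 powi (k + 1)}"

abbreviation signs :: "real set" where
  "signs \<equiv> {1, - 1}"

lemma sets_up [measurable, simp]: "up s k \<in> sets nonzero_reals"
  unfolding sets_nonzero_reals by (auto simp: up_def not_less)

lemma sets_bin [measurable, simp]: "bin s k \<in> sets nonzero_reals"
  unfolding sets_nonzero_reals by (auto simp: bin_def not_less)

lemma bin_subset_up: "k \<le> l \<Longrightarrow> bin s l \<subseteq> up s k"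
  using power_int_increasing[of k l "2::real"] by (auto simp: bin_def up_def)

lemma ex_power2_between:
  assumes "(x::real) > 0" shows "\<exists>k::int. 2 powi k < x \<and> x \<le> 2 powi (k + 1)"
proof -
  define k where "k = \<lceil>log 2 x\<rceil> - 1"
  have k: "of_int k < log 2 x" "log 2 x \<le> of_int (k + 1)" unfolding k_def by linarith+
  have p: "2 powr (of_int l) = (2::real) powi l" for l :: int by (simp add: powr_real_of_int')
  have "2 powr (of_int k) < 2 powr (log 2 x)" "2 powr (log 2 x) \<le> 2 powr (of_int (k + 1))"
    using k by (auto simp del: powr_log_cancel)
  then have "2 powi k < 2 powr (log 2 x)" "2 powr (log 2 x) \<le> 2 powi (k + 1)" unfolding p .
  then show ?thesis using assms by auto
qed

lemma ex_bin:
  assumes "w \<noteq> 0" shows "\<exists>s\<in>signs. \<exists>k. w \<in> bin s k"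
proof (cases "w > 0")
  case True
  then show ?thesis using ex_power2_between[of w] by (auto simp: bin_def)
next
  case False
  then have "- w > 0" using assms by simp
  then show ?thesis using ex_power2_between[of "- w"] by (auto simp: bin_def)
qed

lemma UN_bin: "(\<Union>(s, k)\<in>signs \<times> UNIV. bin s k) = - {0}"
  using ex_bin by (auto simp: sets_nonzero_reals[THEN iffD1, OF sets_bin])

lemma bin_disjoint_s: "bin 1 k \<inter> bin (- 1) l = {}"
  by (auto simp: bin_def) (smt (verit) zero_less_power_int)

lemma bin_disjoint_lt:
  assumes "k < l" shows "bin s k \<inter> bin s l = {}"
  using power_int_increasing[of "k + 1" l "2::real"] assms by (auto simp: bin_def)

lemma bin_disjoint:
  assumes "s \<in> signs" "t \<in> signs" "(s, k) \<noteq> (t, l)" shows "bin s k \<inter> bin t l = {}"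
  using assms bin_disjoint_s[of k l] bin_disjoint_s[of l k] bin_disjoint_lt[of k l s] bin_disjoint_lt[of l k s]
  by (cases k l rule: linorder_cases) auto

lemma UN_bin_up:
  assumes "s \<in> signs" shows "up s k = (\<Union>l\<in>{k..}. bin s l)"
proof (intro equalityI subsetI)
  fix w assume w: "w \<in> up s k"
  have "(0::real) < 2 powi k" by simp
  then have "s * w > 0" using w unfolding up_def mem_Collect_eq by linarith
  then obtain l where l: "2 powi l < s * w" "s * w \<le> 2 powi (l + 1)" using ex_power2_between by blast
  have "k < l + 1"
  proof (rule ccontr)
    assume "\<not> ?thesis"
    then have "2 powi (l + 1) \<le> (2::real) powi k" by (intro power_int_increasing) auto
    then show False using w l by (simp add: up_def)
  qed
  then show "w \<in> (\<Union>l\<in>{k..}. bin s l)" using l by (auto simp: bin_def)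
qed (use bin_subset_up in blast)

text \<open>The last clause rules out two jumps at the same location, whose weights could cancel.\<close>

definition simple_points :: "(real \<times> real) measure \<Rightarrow> bool" where
  "simple_points N \<longleftrightarrow> sets N = sets (half_line \<Otimes>\<^sub>M nonzero_reals) \<and>
     (\<forall>m j k. \<forall>s\<in>signs. emeasure N (cell m j \<times> bin s k) \<in> range of_nat) \<and>
     (\<forall>r k. \<exists>m. \<forall>j<2 ^ (r + m). emeasure N (cell m j \<times> (up 1 k \<union> up (- 1) k)) \<le> 1)"

lemma simple_points_times [simp]:
  assumes "simple_points N" "A \<in> sets half_line" "B \<in> sets nonzero_reals"
  shows "A \<times> B \<in> sets N"
  using assms by (auto simp: simple_points_def)

lemma singleton_half_line [simp]: "{x} \<in> sets half_line \<longleftrightarrow> 0 \<le> x"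
  by (auto simp: sets_half_line)

lemma simple_points_singleton_nat:
  assumes N: "simple_points N" and x: "x \<ge> 0" and s: "s \<in> signs"
  shows "emeasure N ({x} \<times> bin s k) \<in> range of_nat"
proof -
  let ?C = "\<lambda>m. cell m (nat \<lfloor>x * 2 ^ m\<rfloor>) \<times> bin s k"
  have nat: "emeasure N (?C m) \<in> range of_nat" for m
    using N s by (auto simp: simple_points_def)
  have "(\<Inter>m. ?C m) = (\<Inter>m. cell m (nat \<lfloor>x * 2 ^ m\<rfloor>)) \<times> bin s k" by auto
  then have "(\<Inter>m. ?C m) = {x} \<times> bin s k" unfolding INT_cell_index[OF x] .
  moreover have "decseq ?C" using decseq_cell_index[OF x] by (fastforce simp: decseq_def)
  moreover have "range ?C \<subseteq> sets N" using N by auto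
  ultimately obtain n where "emeasure N ({x} \<times> bin s k) = emeasure N (?C n)"
    using emeasure_INT_nat[where C = ?C and N = N] nat by auto
  then show ?thesis using nat[of n] by simp
qed

text \<open>The descent refines the location only; the jump size stays in its bin.\<close>

lemma simple_points_hit:
  assumes N: "simple_points N" and s: "s \<in> signs" and nz: "emeasure N (cell m j \<times> bin s k) \<noteq> 0"
  shows "\<exists>x\<in>cell m j. emeasure N ({x} \<times> bin s k) \<noteq> 0"
proof -
  have "\<exists>f. f 0 = j \<and> (\<forall>n. f (Suc n) \<in> {2 * f n, 2 * f n + 1}) \<and> emeasure N (\<Inter>n. cell (m + n) (f n) \<times> bin s k) \<noteq> 0"
  proof (rule tree_descent[of "\<lambda>m j. cell m j \<times> bin s k"])
    show "cell m j \<times> bin s k = (\<Union>k'\<in>{2 * j, 2 * j + 1}. cell (Suc m) k' \<times> bin s k)" for m j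
      using cell_Suc[of m j] by auto
  qed (use N s nz in \<open>auto simp: simple_points_def\<close>)
  then obtain f where f: "f 0 = j" "emeasure N (\<Inter>n. cell (m + n) (f n) \<times> bin s k) \<noteq> 0" by blast
  have eq: "(\<Inter>n. cell (m + n) (f n) \<times> bin s k) = (\<Inter>n. cell (m + n) (f n)) \<times> bin s k" by auto
  then obtain x where x: "x \<in> (\<Inter>n. cell (m + n) (f n))" using f(2) by (metis emeasure_empty ex_in_conv Times_empty)
  have "x \<in> cell m j" using x f(1) by (auto dest!: spec[of _ 0])
  moreover have "emeasure N ({x} \<times> bin s k) \<noteq> 0" using f(2) unfolding eq INT_cells_subset[OF x] .
  ultimately show ?thesis by blast
qed

lemma UN_up: "(\<Union>n::nat. up 1 (- int n) \<union> up (- 1) (- int n)) = - {0}"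
proof (intro equalityI subsetI)
  fix w :: real assume "w \<in> - {0}"
  then obtain s k where sk: "s \<in> signs" "w \<in> bin s k" using ex_bin by blast
  have "- int (nat \<bar>k\<bar>) \<le> k" by simp
  then have "w \<in> up s (- int (nat \<bar>k\<bar>))" using bin_subset_up sk by blast
  then show "w \<in> (\<Union>n::nat. up 1 (- int n) \<union> up (- 1) (- int n))" using sk by blast
qed (auto simp: sets_nonzero_reals[THEN iffD1, OF sets_up])

text \<open>For jumps larger than a given power of 2 some level of cells isolates them, and
  \<open>x\<close> lies in one such cell. Letting the size threshold tend to 0 exhausts all jumps at
  \<open>x\<close>.\<close>

lemma simple_points_singleton_le_1:
  assumes N: "simple_points N" and x: "x \<ge> 0"
  shows "emeasure N ({x} \<times> - {0}) \<le> 1"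
proof -
  let ?A = "\<lambda>n::nat. {x} \<times> (up 1 (- int n) \<union> up (- 1) (- int n))"
  obtain r :: nat where r: "x < 2 ^ r" using ex_real_less_power2 by blast
  have le: "emeasure N (?A n) \<le> 1" for n
  proof -
    obtain m where m: "\<And>j. j < 2 ^ (r + m) \<Longrightarrow> emeasure N (cell m j \<times> (up 1 (- int n) \<union> up (- 1) (- int n))) \<le> 1"
      using N unfolding simple_points_def by blast
    have "x \<in> {0..<2 ^ r}" using x r by simp
    then obtain j where j: "j < 2 ^ (r + m)" "x \<in> cell m j" using UN_cell[where r=r and m=m] by blast
    have "emeasure N (?A n) \<le> emeasure N (cell m j \<times> (up 1 (- int n) \<union> up (- 1) (- int n)))"
      using N j by (intro emeasure_mono) auto
    then show ?thesis using m[OF j(1)] by simp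
  qed
  have up: "incseq ?A"
  proof (rule incseq_SucI)
    fix n
    have "up s (- int n) \<subseteq> up s (- int (Suc n))" for s
      using power_int_increasing[of "- int (Suc n)" "- int n" "2::real"] by (auto simp: up_def)
    then show "?A n \<subseteq> ?A (Suc n)" by blast
  qed
  have "range ?A \<subseteq> sets N" using N x by (auto intro!: simple_points_times)
  from SUP_emeasure_incseq[OF this up] have "(SUP n. emeasure N (?A n)) = emeasure N (\<Union>n. ?A n)" .
  moreover have "(\<Union>n. ?A n) = {x} \<times> - {0}" unfolding UN_up[symmetric] by blast
  moreover have "(SUP n. emeasure N (?A n)) \<le> 1" by (rule SUP_least) (rule le)
  ultimately show ?thesis by simp
qed

text \<open>The mass of the fibre in the bin is a nonzero natural number and the whole fibre has
  mass at most 1, so the fibre has mass 1 and is concentrated in the bin. The integral is therefore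
  an average over the bin and inherits its bounds, the strict one only in weak form.\<close>

lemma simple_points_weight:
  assumes N: "simple_points N" and x: "x \<ge> 0" and s: "s \<in> signs" and nz: "emeasure N ({x} \<times> bin s k) \<noteq> 0"
  defines "w \<equiv> (LINT z:({x} \<times> - {0})|N. snd z)"
  shows "2 powi k \<le> s * w" "s * w \<le> 2 powi (k + 1)"
proof -
  let ?T = "{x} \<times> bin s k" and ?U = "{x} \<times> - {0::real}"
  have T: "?T \<in> sets N" using N x by simp
  have U: "?U \<in> sets N" using N x by (intro simple_points_times) (auto simp: sets_nonzero_reals)
  have sub: "?T \<subseteq> ?U" using sets_nonzero_reals[THEN iffD1, OF sets_bin, of s k] by auto
  obtain n :: nat where n: "emeasure N ?T = of_nat n" using simple_points_singleton_nat[OF N x s, of k] by auto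
  have le: "emeasure N ?U \<le> 1" by (rule simple_points_singleton_le_1[OF N x])
  have "emeasure N ?T \<le> 1" using emeasure_mono[OF sub U] le by (rule order_trans)
  then have "n \<le> 1" unfolding n by (metis of_nat_1 of_nat_le_iff)
  moreover have "n \<noteq> 0" using nz n by auto
  ultimately have "n = 1" by simp
  then have n1: "emeasure N ?T = 1" using n by simp
  have "1 \<le> emeasure N ?U" using emeasure_mono[OF sub U] n1 by simp
  then have U1: "emeasure N ?U = 1" using le by (rule antisym[rotated])
  have "emeasure N (?U - ?T) = 0" using emeasure_Diff[OF _ U T sub] n1 U1 by simp
  then have "?U - ?T \<in> null_sets N" using U T by auto
  then have AE1: "AE z in N. z \<notin> ?U - ?T" by (rule AE_not_in)
  have [measurable]: "snd \<in> borel_measurable N"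
  proof -
    have "snd \<in> half_line \<Otimes>\<^sub>M nonzero_reals \<rightarrow>\<^sub>M nonzero_reals" by measurable
    then have "snd \<in> half_line \<Otimes>\<^sub>M nonzero_reals \<rightarrow>\<^sub>M borel" by (simp add: measurable_restrict_space2_iff)
    then show ?thesis using N by (subst measurable_cong_sets[OF _ refl]) (auto simp: simple_points_def)
  qed
  have m: "measure N ?T = 1" using n1 by (simp add: measure_def)
  have iT: "integrable N (indicator ?T :: _ \<Rightarrow> real)" using T n1 by (intro integrable_real_indicator) auto
  have sw: "s * w = (\<integral>z. indicator ?T z * (s * snd z) \<partial>N)"
  proof -
    have "s * w = (\<integral>z. s * (indicator ?U z * snd z) \<partial>N)"
      by (simp add: w_def set_lebesgue_integral_def)
    also have "\<dots> = (\<integral>z. indicator ?T z * (s * snd z) \<partial>N)"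
      using T U sub AE1 by (intro integral_cong_AE) (auto simp: indicator_def)
    finally show ?thesis .
  qed
  have pw: "0 < (2::real) powi k" "0 < (2::real) powi (k + 1)" by auto
  have i2: "integrable N (\<lambda>z. indicator ?T z * (s * snd z))"
  proof (rule Bochner_Integration.integrable_bound)
    show "integrable N (\<lambda>z. indicator ?T z * (2::real) powi (k + 1))" using iT by simp
    show "AE z in N. norm (indicator ?T z * (s * snd z)) \<le> norm (indicator ?T z * (2::real) powi (k + 1))"
    proof (rule AE_I2)
      fix z
      show "norm (indicator ?T z * (s * snd z)) \<le> norm (indicator ?T z * (2::real) powi (k + 1))"
      proof (cases "z \<in> ?T")
        case True
        then have "2 powi k < s * snd z" "s * snd z \<le> 2 powi (k + 1)" by (auto simp: bin_def)
        then have "\<bar>s * snd z\<bar> \<le> 2 powi (k + 1)" using pw(1) by linarith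
        then show ?thesis using True pw by simp
      qed simp
    qed
  qed (use T in simp)
  have "(\<integral>z. indicator ?T z * 2 powi k \<partial>N) \<le> (\<integral>z. indicator ?T z * (s * snd z) \<partial>N)"
    by (rule integral_mono[OF _ i2]) (use iT in \<open>auto simp: bin_def split: split_indicator\<close>)
  then show "2 powi k \<le> s * w" unfolding sw using T m by simp
  have "(\<integral>z. indicator ?T z * (s * snd z) \<partial>N) \<le> (\<integral>z. indicator ?T z * 2 powi (k + 1) \<partial>N)"
    by (rule integral_mono[OF i2]) (use iT in \<open>auto simp: bin_def split: split_indicator\<close>)
  then show "s * w \<le> 2 powi (k + 1)" unfolding sw using T m by simp
qed

lemma simple_points_weight_0:
  assumes N: "simple_points N" and x: "x \<ge> 0" and z: "\<And>s k. s \<in> signs \<Longrightarrow> emeasure N ({x} \<times> bin s k) = 0"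
  shows "(LINT z:({x} \<times> - {0})|N. snd z) = 0"
proof -
  have "(\<Union>(s, k)\<in>signs \<times> UNIV. {x} \<times> bin s k) \<in> null_sets N"
  proof (rule null_sets_UN')
    show "(case i of (s, k) \<Rightarrow> {x} \<times> bin s k) \<in> null_sets N" if "i \<in> signs \<times> UNIV" for i
      using that z N x by auto
  qed (auto intro: countable_finite)
  moreover have "(\<Union>(s, k)\<in>signs \<times> UNIV. {x} \<times> bin s k) = {x} \<times> (\<Union>(s, k)\<in>signs \<times> UNIV. bin s k)" by auto
  ultimately have "{x} \<times> - {0} \<in> null_sets N" unfolding UN_bin by simp
  then have "AE z in N. z \<notin> {x} \<times> - {0}" by (rule AE_not_in)
  then have "AE z in N. indicator ({x} \<times> - {0}) z *\<^sub>R snd z = 0"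
    by eventually_elim (simp add: indicator_def)
  then have "(\<integral>z. indicator ({x} \<times> - {0}) z *\<^sub>R snd z \<partial>N) = 0"
    by (rule integral_eq_zero_AE)
  then show ?thesis by (simp add: set_lebesgue_integral_def)
qed

section \<open>The Jordan parts as purely atomic measures\<close>

lemma sets_pos_part [simp]: "sets (pos_part \<nu>) = sets half_line"
  by (simp add: pos_part_def)

lemma emeasure_pos_part:
  assumes "B \<in> sets half_line"
  shows "emeasure (pos_part \<nu>) B = (\<integral>\<^sup>+x. ennreal (\<nu> {x}) * indicator B x \<partial>count_space {0..})"
proof -
  have "B \<subseteq> {0..}" using assms by (simp add: sets_half_line)
  moreover have "(\<lambda>\<theta>. \<theta>) \<in> density (count_space {0..}) (\<lambda>\<theta>. ennreal (\<nu> {\<theta>})) \<rightarrow>\<^sub>M half_line"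
    by (auto simp: measurable_def)
  ultimately show ?thesis
    unfolding pos_part_def using assms by (subst emeasure_distr) (auto simp: emeasure_density Int_absorb2)
qed

lemma emeasure_pos_part_singleton:
  assumes "x \<ge> 0" shows "emeasure (pos_part \<nu>) {x} = ennreal (\<nu> {x})"
proof -
  have "emeasure (pos_part \<nu>) {x} = (\<integral>\<^sup>+y. ennreal (\<nu> {y}) * indicator {x} y \<partial>count_space {0..})"
    using assms by (intro emeasure_pos_part) simp
  also have "\<dots> = (\<integral>\<^sup>+y. ennreal (\<nu> {x}) * indicator {x} y \<partial>count_space {0..})"
    by (intro nn_integral_cong) (auto simp: indicator_def)
  also have "\<dots> = ennreal (\<nu> {x})"
    using assms by (subst nn_integral_cmult_indicator) auto
  finally show ?thesis .
qed

lemma atomic_pos_part: "atomic (pos_part \<nu>)"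
  unfolding atomic_def
proof
  fix r
  let ?B = "{x \<in> {0..<2 ^ r}. emeasure (pos_part \<nu>) {x} = 0}"
  show "emeasure (pos_part \<nu>) ?B = 0"
  proof (cases "?B \<in> sets half_line")
    case True
    have "emeasure (pos_part \<nu>) ?B = (\<integral>\<^sup>+x. 0 \<partial>count_space {0::real..})"
      unfolding emeasure_pos_part[OF True]
      by (intro nn_integral_cong) (auto simp: indicator_def emeasure_pos_part_singleton)
    then show ?thesis by simp
  next
    case False
    then show ?thesis by (intro emeasure_notin_sets) simp
  qed
qed

text \<open>Only the values on singletons are tied to the jumps: the atoms, both Jordan parts and
  the signed graph depend on the signed measure through them alone.\<close>

definition realizes :: "(real \<times> real) measure \<Rightarrow> (real set \<Rightarrow> real) \<Rightarrow> bool" where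
  "realizes N \<nu> \<longleftrightarrow> simple_points N \<and> (\<forall>x\<ge>0. \<nu> {x} = (LINT z:({x} \<times> - {0})|N. snd z))"

definition spart :: "real \<Rightarrow> (real set \<Rightarrow> real) \<Rightarrow> real measure" where
  "spart s \<nu> = pos_part (\<lambda>B. s * \<nu> B)"

lemma spart_simps:
  "spart 1 \<nu> = pos_part \<nu>" "spart (- 1) \<nu> = neg_part \<nu>"
  by (auto simp: spart_def neg_part_def pos_part_def)

lemma sets_spart [simp]: "sets (spart s \<nu>) = sets half_line"
  by (simp add: spart_def)

lemma emeasure_spart_singleton: "x \<ge> 0 \<Longrightarrow> emeasure (spart s \<nu>) {x} = ennreal (s * \<nu> {x})"
  by (simp add: spart_def emeasure_pos_part_singleton)

lemma realizes_weight:
  assumes "realizes N \<nu>" "x \<ge> 0" "s \<in> signs" "emeasure N ({x} \<times> bin s k) \<noteq> 0"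
  shows "2 powi k \<le> s * \<nu> {x}" "s * \<nu> {x} \<le> 2 powi (k + 1)"
  using simple_points_weight[of N x s k] assms by (auto simp: realizes_def)

lemma realizes_ex_sign:
  assumes N: "realizes N \<nu>" and x: "x \<ge> 0" and nz: "\<nu> {x} \<noteq> 0"
  shows "\<exists>s\<in>signs. \<exists>k. emeasure N ({x} \<times> bin s k) \<noteq> 0"
  using simple_points_weight_0[of N x] assms by (auto simp: realizes_def)

lemma realizes_ex_bin:
  assumes N: "realizes N \<nu>" and x: "x \<ge> 0" and s: "s \<in> signs" and pos: "s * \<nu> {x} > 0"
  shows "\<exists>k. emeasure N ({x} \<times> bin s k) \<noteq> 0"
proof -
  obtain t k where t: "t \<in> signs" "emeasure N ({x} \<times> bin t k) \<noteq> 0"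
    using realizes_ex_sign[OF N x] pos by force
  have "0 < (2::real) powi k" by simp
  also have "\<dots> \<le> t * \<nu> {x}" using realizes_weight(1)[OF N x t] .
  finally have "t = s" using pos s t(1) by auto
  then show ?thesis using t by auto
qed

lemma realizes_hit_ge_1:
  assumes N: "simple_points N" and x: "x \<ge> 0" and s: "s \<in> signs" and nz: "emeasure N ({x} \<times> bin s k) \<noteq> 0"
    and B: "B \<in> sets nonzero_reals" "bin s k \<subseteq> B"
  shows "emeasure N ({x} \<times> B) \<ge> 1"
proof -
  obtain n :: nat where n: "emeasure N ({x} \<times> bin s k) = of_nat n" using simple_points_singleton_nat[OF N x s, of k] by auto
  then have "n \<ge> 1" using nz by (cases n) auto
  then have "1 \<le> emeasure N ({x} \<times> bin s k)" unfolding n by (metis of_nat_1 of_nat_mono)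
  also have "\<dots> \<le> emeasure N ({x} \<times> B)" using N x B by (intro emeasure_mono) auto
  finally show ?thesis .
qed

lemma card_points_le:
  assumes N: "simple_points N" and B: "B \<in> sets nonzero_reals"
    and fin: "emeasure N ({0..<2 ^ r} \<times> B) < \<infinity>"
    and X: "X \<subseteq> {0..<2 ^ r}" "\<And>x. x \<in> X \<Longrightarrow> emeasure N ({x} \<times> B) \<ge> 1"
  shows "finite X" "of_nat (card X) \<le> emeasure N ({0..<2 ^ r} \<times> B)"
proof -
  have s: "{0..<2 ^ r} \<times> B \<in> sets N" using N B by (intro simple_points_times) (auto simp: sets_half_line)
  have A: "disjoint_family_on (\<lambda>x. {x} \<times> B) X" by (auto simp: disjoint_family_on_def)
  have "{x} \<times> B \<in> sets N \<and> {x} \<times> B \<subseteq> {0..<2 ^ r} \<times> B \<and> 1 \<le> emeasure N ({x} \<times> B)" if "x \<in> X" for x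
    using X that N B by auto
  then show "finite X" "of_nat (card X) \<le> emeasure N ({0..<2 ^ r} \<times> B)"
    using card_le_emeasure[OF s fin A] by blast+
qed

text \<open>Dominates the mass that the jumps of size at most 1 contribute: those in the bin with exponent \<open>- 1 - l\<close> have
  size at most \<open>2\<^sup>-\<^sup>l\<close>.\<close>

definition light_weight :: "real \<Rightarrow> (real \<times> real) measure \<Rightarrow> nat \<Rightarrow> ennreal" where
  "light_weight s N r = (\<Sum>l. ennreal ((1 / 2) ^ l) * emeasure N ({0..<2 ^ r} \<times> bin s (- 1 - int l)))"

lemma power2_minus_nat: "(2::real) powi (- int l) = (1 / 2) ^ l"
  by (simp add: power_int_minus power_one_over inverse_eq_divide)

text \<open>A positive weight below 1 comes from a jump in a bin with negative exponent
  \<open>k = - 1 - l\<close> and is at most \<open>2 powi (k + 1) = (1 / 2) ^ l\<close>. The number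
  of such locations is bounded by the count of the bin.\<close>

lemma nn_integral_light_le:
  assumes N: "realizes N \<nu>" and s: "s \<in> signs"
    and fin: "\<And>k. emeasure N ({0..<2 ^ r} \<times> bin s k) < \<infinity>"
    and X: "X \<subseteq> {0..<2 ^ r}" "\<And>x. x \<in> X \<Longrightarrow> s * \<nu> {x} < 1"
  shows "(\<integral>\<^sup>+x. ennreal (s * \<nu> {x}) * indicator X x \<partial>count_space {0..}) \<le> light_weight s N r"
proof -
  have sp: "simple_points N" using N by (simp add: realizes_def)
  define F where "F l = {x \<in> {0..<2 ^ r}. emeasure N ({x} \<times> bin s (- 1 - int l)) \<noteq> 0}" for l
  have F1: "emeasure N ({x} \<times> bin s (- 1 - int l)) \<ge> 1" if "x \<in> F l" for x l
    using that by (intro realizes_hit_ge_1[OF sp _ s, of x "- 1 - int l"]) (auto simp: F_def)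
  have "F l \<subseteq> {0..<2 ^ r}" for l by (auto simp: F_def)
  note F = card_points_le[OF sp sets_bin fin this F1]
  have pt: "ennreal (s * \<nu> {x}) * indicator X x \<le> (\<Sum>l. ennreal ((1 / 2) ^ l) * indicator (F l) x)" for x
  proof (cases "x \<in> X \<and> s * \<nu> {x} > 0")
    case True
    then have x: "x \<ge> 0" "x \<in> {0..<2 ^ r}" "s * \<nu> {x} < 1" using X by auto
    obtain k where k: "emeasure N ({x} \<times> bin s k) \<noteq> 0" using realizes_ex_bin[OF N x(1) s] True by auto
    note w = realizes_weight[OF N x(1) s k]
    have "k < 0"
    proof (rule ccontr)
      assume "\<not> k < 0"
      then have "(2::real) powi 0 \<le> 2 powi k" by (intro power_int_increasing) auto
      then show False using w x by simp
    qed
    define l where "l = nat (- k - 1)"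
    have kl: "k = - 1 - int l" using \<open>k < 0\<close> by (simp add: l_def)
    then have "k + 1 = - int l" by simp
    then have "s * \<nu> {x} \<le> (1 / 2) ^ l" using w(2) by (simp only: power2_minus_nat)
    then have "ennreal (s * \<nu> {x}) * indicator X x \<le> ennreal ((1 / 2) ^ l) * indicator (F l) x"
      using True k x by (auto simp: F_def kl indicator_def intro: ennreal_leI)
    also have "\<dots> = (\<Sum>i\<in>{l}. ennreal ((1 / 2) ^ i) * indicator (F i) x)" by (subst sum.insert) simp_all
    also have "\<dots> \<le> (\<Sum>i. ennreal ((1 / 2) ^ i) * indicator (F i) x)" by (rule sum_le_suminf) auto
    finally show ?thesis .
  next
    case False
    then have "ennreal (s * \<nu> {x}) * indicator X x = 0" by (auto simp: indicator_def ennreal_neg)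
    then show ?thesis by (simp only: zero_le)
  qed
  have "(\<integral>\<^sup>+x. ennreal (s * \<nu> {x}) * indicator X x \<partial>count_space {0..}) \<le> (\<integral>\<^sup>+x. (\<Sum>l. ennreal ((1 / 2) ^ l) * indicator (F l) x) \<partial>count_space {0..})"
    using pt by (intro nn_integral_mono) auto
  also have "\<dots> = (\<Sum>l. \<integral>\<^sup>+x. ennreal ((1 / 2) ^ l) * indicator (F l) x \<partial>count_space {0..})"
    by (rule nn_integral_suminf) auto
  also have "\<dots> = (\<Sum>l. ennreal ((1 / 2) ^ l) * of_nat (card (F l)))"
  proof (intro suminf_cong)
    fix l
    have "F l \<subseteq> {0..}" by (auto simp: F_def)
    then show "(\<integral>\<^sup>+x. ennreal ((1 / 2) ^ l) * indicator (F l) x \<partial>count_space {0..}) = ennreal ((1 / 2) ^ l) * of_nat (card (F l))"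
      using F(1)[of l] by (subst nn_integral_cmult_indicator) auto
  qed
  also have "\<dots> \<le> light_weight s N r"
    unfolding light_weight_def using F(2) by (intro suminf_le mult_left_mono) auto
  finally show ?thesis .
qed

lemma heavy_points:
  assumes N: "realizes N \<nu>" and s: "s \<in> signs" and fin: "emeasure N ({0..<2 ^ r} \<times> up s (- 1)) < \<infinity>"
  defines "H \<equiv> {x \<in> {0..<2 ^ r}. s * \<nu> {x} \<ge> 1}"
  shows "finite H" "of_nat (card H) \<le> emeasure N ({0..<2 ^ r} \<times> up s (- 1))"
proof -
  have sp: "simple_points N" using N by (simp add: realizes_def)
  have "emeasure N ({x} \<times> up s (- 1)) \<ge> 1" if "x \<in> H" for x
  proof -
    have x: "x \<ge> 0" "s * \<nu> {x} \<ge> 1" using that by (auto simp: H_def)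
    obtain k where k: "emeasure N ({x} \<times> bin s k) \<noteq> 0" using realizes_ex_bin[OF N x(1) s] x(2) by auto
    note w = realizes_weight[OF N x(1) s k]
    \<comment> \<open>The bins are closed on the right, so a weight equal to 1 belongs to the bin
      with exponent \<open>- 1\<close>; the set \<open>up s 0\<close> would miss it.\<close>
    have "k \<ge> - 1"
    proof (rule ccontr)
      assume "\<not> ?thesis"
      then have "(2::real) powi (k + 1) \<le> 2 powi (- 1)" by (intro power_int_increasing) auto
      then show False using w x by (simp add: power_int_minus)
    qed
    then have "bin s k \<subseteq> up s (- 1)" by (rule bin_subset_up)
    with k show ?thesis by (intro realizes_hit_ge_1[OF sp x(1) s, of k]) auto
  qed
  moreover have "H \<subseteq> {0..<2 ^ r}" by (auto simp: H_def)
  ultimately show "finite H" "of_nat (card H) \<le> emeasure N ({0..<2 ^ r} \<times> up s (- 1))"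
    using card_points_le[OF sp sets_up fin, of H] by blast+
qed

text \<open>Light points contribute at most \<open>light_weight\<close>, which is finite; heavy
  points are finitely many in every bounded interval.\<close>

lemma locally_finite_spart:
  assumes N: "realizes N \<nu>" and s: "s \<in> signs"
    and fin: "\<And>r k. emeasure N ({0..<2 ^ r} \<times> up s k) < \<infinity>" "\<And>r. light_weight s N r < \<infinity>"
  shows "locally_finite (spart s \<nu>)"
  unfolding locally_finite_def
proof (intro conjI allI)
  fix r
  have sp: "simple_points N" using N by (simp add: realizes_def)
  have fb: "emeasure N ({0..<2 ^ r} \<times> bin s k) < \<infinity>" for k
  proof -
    have "emeasure N ({0..<2 ^ r} \<times> bin s k) \<le> emeasure N ({0..<2 ^ r} \<times> up s k)"
      using sp bin_subset_up[of k k s] by (intro emeasure_mono simple_points_times) (auto simp: sets_half_line)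
    then show ?thesis using fin(1) by (rule le_less_trans)
  qed
  define H where "H = {x \<in> {0..<2 ^ r}. s * \<nu> {x} \<ge> 1}"
  define X where "X = {x \<in> {0..<2 ^ r}. s * \<nu> {x} < 1}"
  have fH: "finite H" unfolding H_def by (rule heavy_points(1)[OF N s fin(1)])
  have "emeasure (spart s \<nu>) {0..<2 ^ r} = (\<integral>\<^sup>+x. ennreal (s * \<nu> {x}) * indicator {0..<2 ^ r} x \<partial>count_space {0..})"
    unfolding spart_def by (rule emeasure_pos_part) (auto simp: sets_half_line)
  also have "\<dots> = (\<integral>\<^sup>+x. ennreal (s * \<nu> {x}) * indicator X x + ennreal (s * \<nu> {x}) * indicator H x \<partial>count_space {0..})"
    by (intro nn_integral_cong) (auto simp: H_def X_def indicator_def)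
  also have "\<dots> = (\<integral>\<^sup>+x. ennreal (s * \<nu> {x}) * indicator X x \<partial>count_space {0..}) + (\<integral>\<^sup>+x. ennreal (s * \<nu> {x}) * indicator H x \<partial>count_space {0..})"
    by (rule nn_integral_add) auto
  also have "\<dots> < \<infinity>"
  proof -
    have "(\<integral>\<^sup>+x. ennreal (s * \<nu> {x}) * indicator X x \<partial>count_space {0..}) \<le> light_weight s N r"
      by (intro nn_integral_light_le[OF N s fb]) (auto simp: X_def)
    also have "\<dots> < \<infinity>" by (rule fin)
    finally have 1: "(\<integral>\<^sup>+x. ennreal (s * \<nu> {x}) * indicator X x \<partial>count_space {0..}) < \<infinity>" .
    have "{a \<in> {0..}. ennreal (s * \<nu> {a}) * indicator H a \<noteq> 0} \<subseteq> H" by (auto simp: indicator_def split: if_splits)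
    then have fs: "finite {a \<in> {0..}. ennreal (s * \<nu> {a}) * indicator H a \<noteq> 0}" using fH by (rule finite_subset)
    have "(\<integral>\<^sup>+x. ennreal (s * \<nu> {x}) * indicator H x \<partial>count_space {0..}) = (\<Sum>a|a \<in> {0..} \<and> 0 < ennreal (s * \<nu> {a}) * indicator H a. ennreal (s * \<nu> {a}) * indicator H a)"
      using fs by (intro nn_integral_count_space) (simp add: zero_less_iff_neq_zero)
    also have "\<dots> < \<infinity>"
      using fs by (simp add: zero_less_iff_neq_zero ennreal_mult_less_top indicator_def)
    finally show ?thesis using 1 by simp
  qed
  finally show "emeasure (spart s \<nu>) {0..<2 ^ r} < \<infinity>" .
qed simp

lemma light_spart_le:
  assumes N: "realizes N \<nu>" and s: "s \<in> signs" and v: "locally_finite (spart s \<nu>)"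
    and fin: "\<And>k. emeasure N ({0..<2 ^ r} \<times> bin s k) < \<infinity>"
  shows "emeasure (spart s \<nu>) (light (spart s \<nu>) 1 r) \<le> light_weight s N r"
proof -
  have "emeasure (spart s \<nu>) (light (spart s \<nu>) 1 r) = (\<integral>\<^sup>+x. ennreal (s * \<nu> {x}) * indicator (light (spart s \<nu>) 1 r) x \<partial>count_space {0..})"
    using sets_light[OF v] unfolding spart_def by (rule emeasure_pos_part)
  also have "\<dots> \<le> light_weight s N r"
    by (rule nn_integral_light_le[OF N s fin]) (auto simp: light_def emeasure_spart_singleton)
  finally show ?thesis .
qed

text \<open>A nonzero count over \<open>up s k\<close> charges one of its bins, the descent finds a
  location for it, and the weight there already exceeds or equals the bound.\<close>

lemma spart_cell_ge:
  assumes N: "realizes N \<nu>" and s: "s \<in> signs" and nz: "emeasure N (cell m j \<times> up s k) \<noteq> 0"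
  shows "emeasure (spart s \<nu>) (cell m j) \<ge> ennreal (2 powi k)"
proof -
  have sp: "simple_points N" using N by (simp add: realizes_def)
  have "\<exists>l\<ge>k. emeasure N (cell m j \<times> bin s l) \<noteq> 0"
  proof (rule ccontr)
    assume "\<not> ?thesis"
    then have "(\<Union>l\<in>{k..}. cell m j \<times> bin s l) \<in> null_sets N"
      using sp by (intro null_sets_UN') auto
    moreover have "(\<Union>l\<in>{k..}. cell m j \<times> bin s l) = cell m j \<times> up s k"
      unfolding UN_bin_up[OF s] by blast
    ultimately show False using nz by auto
  qed
  then obtain l where l: "l \<ge> k" "emeasure N (cell m j \<times> bin s l) \<noteq> 0" by blast
  obtain x where x: "x \<in> cell m j" "emeasure N ({x} \<times> bin s l) \<noteq> 0"
    using simple_points_hit[OF sp s l(2)] by blast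
  have x0: "x \<ge> 0" using x(1) by (simp add: mem_cell)
  have "(2::real) powi k \<le> 2 powi l" using l(1) by (intro power_int_increasing) auto
  also have "\<dots> \<le> s * \<nu> {x}" by (rule realizes_weight(1)[OF N x0 s x(2)])
  finally have "ennreal (2 powi k) \<le> emeasure (spart s \<nu>) {x}"
    by (simp add: emeasure_spart_singleton x0 ennreal_leI)
  also have "\<dots> \<le> emeasure (spart s \<nu>) (cell m j)" using x(1) by (intro emeasure_mono) auto
  finally show ?thesis .
qed

lemma card_atoms_le:
  assumes N: "realizes N \<nu>" and fin: "emeasure N ({0..<2 ^ r} \<times> - {0}) < \<infinity>"
  defines "X \<equiv> {x \<in> {0..<2 ^ r}. \<nu> {x} \<noteq> 0}"
  shows "finite X" "of_nat (card X) \<le> emeasure N ({0..<2 ^ r} \<times> - {0})"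
proof -
  have sp: "simple_points N" using N by (simp add: realizes_def)
  have m: "- {0} \<in> sets nonzero_reals" by (auto simp: sets_nonzero_reals)
  have "emeasure N ({x} \<times> - {0}) \<ge> 1" if "x \<in> X" for x
  proof -
    have x: "x \<ge> 0" "\<nu> {x} \<noteq> 0" using that by (auto simp: X_def)
    obtain s k where k: "s \<in> signs" "emeasure N ({x} \<times> bin s k) \<noteq> 0" using realizes_ex_sign[OF N x] by auto
    have "bin s k \<subseteq> - {0}" using sets_nonzero_reals[THEN iffD1, OF sets_bin, of s k] by auto
    with k show ?thesis by (intro realizes_hit_ge_1[OF sp x(1) k m]) auto
  qed
  moreover have "X \<subseteq> {0..<2 ^ r}" by (auto simp: X_def)
  ultimately show "finite X" "of_nat (card X) \<le> emeasure N ({0..<2 ^ r} \<times> - {0})"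
    using card_points_le[OF sp m fin, of X] by blast+
qed

section \<open>The Poisson process of jump_measure\<close>

lemma poisson_process_prob:
  assumes X: "poisson_process M \<mu> X" and m: "{N \<in> space (measure_algebra \<mu>). Q N} \<in> sets (measure_algebra \<mu>)"
  defines "P \<equiv> distr M (measure_algebra \<mu>) X"
  shows "measure M {\<omega> \<in> space M. Q (X \<omega>)} = measure P {N \<in> space P. Q N}" "{\<omega> \<in> space M. Q (X \<omega>)} \<in> sets M"
proof -
  have Xm: "X \<in> M \<rightarrow>\<^sub>M measure_algebra \<mu>" using X by (simp add: poisson_process_def)
  have eq: "X -` {N \<in> space (measure_algebra \<mu>). Q N} \<inter> space M = {\<omega> \<in> space M. Q (X \<omega>)}"
    using measurable_space[OF Xm] by auto
  show "measure M {\<omega> \<in> space M. Q (X \<omega>)} = measure P {N \<in> space P. Q N}"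
    unfolding P_def space_distr measure_distr[OF Xm m] eq ..
  show "{\<omega> \<in> space M. Q (X \<omega>)} \<in> sets M" using measurable_sets[OF Xm m] unfolding eq .
qed

lemma poisson_process_law: "poisson_process M \<mu> X \<Longrightarrow> poisson_law \<mu> (distr M (measure_algebra \<mu>) X)"
  by (simp add: poisson_process_def)

lemma sets_lebesgue_half_line [simp]: "sets lebesgue_half_line = sets half_line"
  by (auto simp: lebesgue_half_line_def half_line_def sets_restrict_space)

lemma emeasure_lebesgue_half_line:
  assumes "0 \<le> a" "a \<le> b" shows "emeasure lebesgue_half_line {a..<b} = ennreal (b - a)"
  unfolding lebesgue_half_line_def using assms by (subst emeasure_restrict_space) auto

text \<open>The integrability comes from \<open>crsm\<close> and is stronger near 0 than that of
  \<open>levy_measure\<close>: it makes the dyadic sums of small jumps converge and bounds the mass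
  away from 0.\<close>

definition jump_measure :: "real measure \<Rightarrow> bool" where
  "jump_measure \<rho> \<longleftrightarrow> sets \<rho> = sets nonzero_reals \<and> (\<integral>\<^sup>+ w. ennreal (min 1 \<bar>w\<bar>) \<partial>\<rho>) < \<infinity>"

lemma measurable_min_jump_measure:
  "sets \<rho> = sets nonzero_reals \<Longrightarrow> (\<lambda>w. ennreal (min 1 \<bar>w\<bar>)) \<in> borel_measurable \<rho>"
  by (subst measurable_cong_sets[of \<rho> nonzero_reals]) (auto intro: measurable_restrict_space1)

lemma up_finite:
  assumes r: "jump_measure \<rho>" and s: "s \<in> signs" shows "emeasure \<rho> (up s k) < \<infinity>"
proof -
  have sets: "sets \<rho> = sets nonzero_reals" using r by (simp add: jump_measure_def)
  define a where "a = min 1 ((2::real) powi k)"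
  have a: "a > 0" by (simp add: a_def)
  have "ennreal a * emeasure \<rho> (up s k) = (\<integral>\<^sup>+w. ennreal a * indicator (up s k) w \<partial>\<rho>)"
    by (subst nn_integral_cmult_indicator) (auto simp: sets)
  also have "\<dots> \<le> (\<integral>\<^sup>+w. ennreal (min 1 \<bar>w\<bar>) \<partial>\<rho>)"
  proof (intro nn_integral_mono)
    fix w
    have "a \<le> min 1 \<bar>w\<bar>" if "w \<in> up s k" using that s by (auto simp: a_def up_def)
    then show "ennreal a * indicator (up s k) w \<le> ennreal (min 1 \<bar>w\<bar>)"
      by (auto simp: indicator_def intro: ennreal_leI)
  qed
  also have "\<dots> < \<infinity>" using r by (simp add: jump_measure_def)
  finally show ?thesis using a by (auto simp: ennreal_mult_less_top)
qed

lemma jump_measure_sigma_finite: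
  assumes r: "jump_measure \<rho>" shows "sigma_finite_measure \<rho>"
proof
  have sets: "sets \<rho> = sets nonzero_reals" using r by (simp add: jump_measure_def)
  have sp: "space \<rho> = - {0}" using sets_eq_imp_space_eq[OF sets] by (simp add: space_restrict_space)
  let ?A = "(\<lambda>n::nat. up 1 (- int n) \<union> up (- 1) (- int n)) ` UNIV"
  show "\<exists>A. countable A \<and> A \<subseteq> sets \<rho> \<and> \<Union> A = space \<rho> \<and> (\<forall>a\<in>A. emeasure \<rho> a \<noteq> \<infinity>)"
  proof (intro exI[of _ ?A] conjI ballI)
    show "\<Union> ?A = space \<rho>" using UN_up sp by simp
    fix a assume "a \<in> ?A"
    then obtain n :: nat where a: "a = up 1 (- int n) \<union> up (- 1) (- int n)" by auto
    have "emeasure \<rho> a \<le> emeasure \<rho> (up 1 (- int n)) + emeasure \<rho> (up (- 1) (- int n))"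
      unfolding a by (intro emeasure_subadditive) (auto simp: sets)
    also have "\<dots> < \<infinity>" using up_finite[OF r] by simp
    finally show "emeasure \<rho> a \<noteq> \<infinity>" by simp
  qed (auto simp: sets)
qed

lemma emeasure_intensity:
  assumes r: "jump_measure \<rho>" and A: "A \<in> sets half_line" and B: "B \<in> sets nonzero_reals"
  shows "emeasure (lebesgue_half_line \<Otimes>\<^sub>M \<rho>) (A \<times> B) = emeasure lebesgue_half_line A * emeasure \<rho> B"
proof -
  interpret sigma_finite_measure \<rho> by (rule jump_measure_sigma_finite[OF r])
  show ?thesis using A B r by (intro emeasure_pair_measure_Times) (auto simp: jump_measure_def)
qed

lemma emeasure_lebesgue_cell: "emeasure lebesgue_half_line (cell m j) = ennreal (1 / 2 ^ m)"
  unfolding cell_def by (subst emeasure_lebesgue_half_line) (auto simp: divide_right_mono field_simps)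

section \<open>Almost sure counts of the Poisson process of jumps\<close>

locale poisson_jumps = prob_space M for M :: "'w measure" +
  fixes \<rho> :: "real measure" and X :: "'w \<Rightarrow> (real \<times> real) measure"
  assumes r: "jump_measure \<rho>" and X: "poisson_process M (lebesgue_half_line \<Otimes>\<^sub>M \<rho>) X"
begin

lemma AE_range_nat_points:
  assumes B: "B \<in> sets (lebesgue_half_line \<Otimes>\<^sub>M \<rho>)" "emeasure (lebesgue_half_line \<Otimes>\<^sub>M \<rho>) B < \<infinity>"
  shows "AE \<omega> in M. emeasure (X \<omega>) B \<in> range of_nat"
proof -
  let ?L = "measure_algebra (lebesgue_half_line \<Otimes>\<^sub>M \<rho>)"
  have Xm: "X \<in> M \<rightarrow>\<^sub>M ?L" using X by (simp add: poisson_process_def)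
  have "AE N in distr M ?L X. \<exists>k::nat. emeasure N B = of_nat k"
    by (rule poisson_law_AE_nat[OF poisson_process_law[OF X] B])
  moreover have "{N \<in> space ?L. \<exists>k::nat. emeasure N B = of_nat k} \<in> sets ?L"
    using measurable_emeasure_measure_algebra[OF B(1)] by measurable
  ultimately have "AE \<omega> in M. \<exists>k::nat. emeasure (X \<omega>) B = of_nat k" by (subst (asm) AE_distr_iff[OF Xm]) auto
  then show ?thesis by eventually_elim auto
qed

lemma AE_points_finite:
  assumes A: "A \<in> sets nonzero_reals" "emeasure \<rho> A < \<infinity>"
  shows "AE \<omega> in M. \<forall>r. emeasure (X \<omega>) ({0..<2 ^ r} \<times> A) < \<infinity>"
proof -
  have s: "{0..<2 ^ r} \<times> A \<in> sets (lebesgue_half_line \<Otimes>\<^sub>M \<rho>)" for r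
    using A r by (intro pair_measureI) (auto simp: sets_half_line jump_measure_def)
  have "emeasure (lebesgue_half_line \<Otimes>\<^sub>M \<rho>) ({0..<2 ^ r} \<times> A) < \<infinity>" for r
    using A r by (subst emeasure_intensity) (auto simp: sets_half_line emeasure_lebesgue_half_line ennreal_mult_less_top)
  from AE_range_nat_points[OF s this] have nat: "AE \<omega> in M. \<forall>r. emeasure (X \<omega>) ({0..<2 ^ r} \<times> A) \<in> range of_nat"
    by (simp only: AE_all_countable simp_thms)
  have fin: "(x :: ennreal) < \<infinity>" if "x \<in> range of_nat" for x using that by (auto simp: less_top[symmetric])
  from nat show ?thesis
  proof eventually_elim
    case (elim \<omega>)
    then show ?case using fin by blast
  qed
qed

lemma AE_points_hits:
  assumes A: "A \<in> sets nonzero_reals" "emeasure \<rho> A < \<infinity>" and c: "c > 0" "ennreal (c * 2 ^ m) \<le> emeasure \<rho> A"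
  shows "AE \<omega> in M. \<forall>\<^sub>F r in sequentially. real (card {j \<in> {..<2 ^ (r + m)}. emeasure (X \<omega>) (cell m j \<times> A) \<noteq> 0}) > (1 - exp (- c)) / 2 * 2 ^ (r + m)"
proof -
  let ?\<mu> = "lebesgue_half_line \<Otimes>\<^sub>M \<rho>" and ?L = "measure_algebra (lebesgue_half_line \<Otimes>\<^sub>M \<rho>)"
  have s: "cell m j \<times> A \<in> sets ?\<mu>" for j
    using A r by (intro pair_measureI) (auto simp: jump_measure_def)
  have e: "emeasure ?\<mu> (cell m j \<times> A) = ennreal (1 / 2 ^ m) * emeasure \<rho> A" for j
    using A by (subst emeasure_intensity[OF r]) (auto simp: emeasure_lebesgue_cell)
  have fin: "emeasure ?\<mu> (cell m j \<times> A) < \<infinity>" for j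
    unfolding e using A by (simp add: ennreal_mult_less_top)
  have ge: "measure ?\<mu> (cell m j \<times> A) \<ge> c" for j
  proof -
    have "ennreal c = ennreal (1 / 2 ^ m) * ennreal (c * 2 ^ m)" using c by (subst ennreal_mult[symmetric]) auto
    also have "\<dots> \<le> emeasure ?\<mu> (cell m j \<times> A)" unfolding e using c by (intro mult_left_mono) auto
    also have "\<dots> = ennreal (measure ?\<mu> (cell m j \<times> A))" using fin[of j] by (intro emeasure_eq_ennreal_measure) auto
    finally show ?thesis using c by (simp add: ennreal_le_iff)
  qed
  define I where "I r = {..<(2::nat) ^ (r + m)}" for r
  define Q where "Q r N \<longleftrightarrow> real (card {j \<in> I r. emeasure N (cell m j \<times> A) \<noteq> 0}) \<le> (1 - exp (- c)) / 2 * card (I r)" for r and N :: "(real \<times> real) measure"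
  have Qm: "{N \<in> space ?L. Q r N} \<in> sets ?L" for r
  proof -
    have [measurable]: "(\<lambda>N. card {j \<in> I r. emeasure N (cell m j \<times> A) \<noteq> 0}) \<in> ?L \<rightarrow>\<^sub>M count_space UNIV"
    proof (rule measurable_card_Collect)
      fix j
      show "{N \<in> space ?L. emeasure N (cell m j \<times> A) \<noteq> 0} \<in> sets ?L"
        using measurable_emeasure_measure_algebra[OF s[of j]] by measurable
    qed (simp add: I_def)
    show ?thesis unfolding Q_def by measurable
  qed
  define p where "p = (1 - exp (- c)) / 10"
  have p: "p > 0" using c by (simp add: p_def)
  define E where "E r = {\<omega> \<in> space M. Q r (X \<omega>)}" for r
  have EM: "E r \<in> events" for r unfolding E_def by (rule poisson_process_prob(2)[OF X Qm])
  have Ep: "prob (E r) \<le> exp (- (p * 2 ^ r))" for r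
  proof -
    have "prob (E r) \<le> exp (- (1 - exp (- c)) / 10 * card (I r))"
      unfolding E_def poisson_process_prob(1)[OF X Qm] unfolding Q_def
    proof (rule poisson_law_hits[OF poisson_process_law[OF X] _ s fin _ ge])
      show "disjoint_family_on (\<lambda>j. cell m j \<times> A) (I r)"
        using disjoint_cell[of _ _ m] unfolding disjoint_family_on_def by blast
    qed (use c in \<open>auto simp: I_def\<close>)
    also have "- (1 - exp (- c)) / 10 * card (I r) = - (p * 2 ^ (r + m))"
      by (simp add: p_def I_def field_simps)
    also have "exp \<dots> \<le> exp (- (p * 2 ^ r))" using p by (simp add: power_add)
    finally show ?thesis .
  qed
  have "prob (E r) \<le> (1 / 2) ^ r * inverse p" for r
    using Ep[of r] exp_minus_mult_power2_le[OF p, of r] by linarith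
  from AE_eventually_notin[OF EM this] AE_space
  show ?thesis
  proof eventually_elim
    case (elim \<omega>)
    from elim(1) show ?case by eventually_elim (use elim(2) in \<open>auto simp: E_def Q_def I_def not_le\<close>)
  qed
qed

text \<open>The slack \<open>l + 1\<close> makes the exceptional probabilities summable over \<open>l\<close>, while it is harmless against the
  weights \<open>2\<^sup>-\<^sup>l\<close> of the bins.\<close>

lemma AE_points_upper:
  fixes A :: "nat \<Rightarrow> real set"
  assumes A: "\<And>l. A l \<in> sets nonzero_reals" "\<And>l. emeasure \<rho> (A l) < \<infinity>"
  shows "AE \<omega> in M. \<forall>\<^sub>F r in sequentially. \<forall>l. emeasure (X \<omega>) ({0..<2 ^ r} \<times> A l) \<le> ennreal (2 ^ r * (2 * measure \<rho> (A l) + (real l + 1)))"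
proof -
  let ?\<mu> = "lebesgue_half_line \<Otimes>\<^sub>M \<rho>" and ?L = "measure_algebra (lebesgue_half_line \<Otimes>\<^sub>M \<rho>)"
  let ?R = "\<lambda>r l. {0..<2 ^ r} \<times> A l"
  have s: "?R r l \<in> sets ?\<mu>" for r l
    using A r by (intro pair_measureI) (auto simp: sets_half_line jump_measure_def)
  have e: "emeasure ?\<mu> (?R r l) = ennreal (2 ^ r) * emeasure \<rho> (A l)" for r l
    using A by (subst emeasure_intensity[OF r]) (auto simp: sets_half_line emeasure_lebesgue_half_line)
  have fin: "emeasure ?\<mu> (?R r l) < \<infinity>" for r l
    unfolding e using A by (simp add: ennreal_mult_less_top)
  have me: "measure ?\<mu> (?R r l) = 2 ^ r * measure \<rho> (A l)" for r l
    unfolding measure_def e by (simp add: enn2real_mult)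
  define F where "F r l = {\<omega> \<in> space M. ennreal (2 * measure ?\<mu> (?R r l) + 2 ^ r * (real l + 1)) \<le> emeasure (X \<omega>) (?R r l)}" for r l
  have Qm: "{N \<in> space ?L. ennreal (2 * measure ?\<mu> (?R r l) + 2 ^ r * (real l + 1)) \<le> emeasure N (?R r l)} \<in> sets ?L" for r l
    using measurable_emeasure_measure_algebra[OF s[of r l]] by measurable
  have FM: "F r l \<in> events" for r l unfolding F_def by (rule poisson_process_prob(2)[OF X Qm])
  have Fp: "prob (F r l) \<le> exp (- (2 ^ r)) * exp (- 1) ^ l" for r l
  proof -
    have "prob (F r l) \<le> exp (- (2 ^ r * (real l + 1)))"
      unfolding F_def poisson_process_prob(1)[OF X Qm]
      by (rule poisson_law_tail[OF poisson_process_law[OF X] s fin])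
    also have "\<dots> \<le> exp (- (2 ^ r) + real l * - 1)"
    proof -
      have "real l * 1 \<le> real l * 2 ^ r" by (intro mult_left_mono) auto
      then show ?thesis by (simp add: algebra_simps)
    qed
    also have "\<dots> = exp (- (2 ^ r)) * exp (- 1) ^ l" unfolding exp_add exp_of_nat_mult ..
    finally show ?thesis .
  qed
  define E where "E r = (\<Union>l. F r l)" for r
  have EM: "E r \<in> events" for r unfolding E_def using FM by auto
  \<comment> \<open>The geometric series over \<open>l\<close> produced by the slack
    \<open>l + 1\<close>.\<close>
  define K where "K = 1 / (1 - exp (- 1) :: real)"
  have Ep: "prob (E r) \<le> exp (- (2 ^ r)) * K" for r
  proof -
    have sg: "(\<lambda>l. exp (- (2 ^ r)) * exp (- 1) ^ l) sums (exp (- (2 ^ r)) * K)" unfolding K_def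
      by (intro sums_mult geometric_sums) simp
    have sF: "summable (\<lambda>l. prob (F r l))"
      by (rule summable_comparison_test'[OF sums_summable[OF sg]]) (use Fp in auto)
    have "prob (E r) \<le> (\<Sum>l. prob (F r l))"
      unfolding E_def by (rule finite_measure_subadditive_countably[OF _ sF]) (use FM in auto)
    also have "\<dots> \<le> exp (- (2 ^ r)) * K"
      using suminf_le[OF Fp sF sums_summable[OF sg]] sums_unique[OF sg] by simp
    finally show ?thesis .
  qed
  have K: "K \<ge> 0" by (simp add: K_def)
  have "prob (E r) \<le> (1 / 2) ^ r * K" for r
  proof -
    have "exp (- (2 ^ r)) * K \<le> (1 / 2) ^ r * K"
      using exp_minus_mult_power2_le[of 1 r] K by (intro mult_right_mono) auto
    then show ?thesis using Ep[of r] by linarith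
  qed
  from AE_eventually_notin[OF EM this] AE_space
  show ?thesis
  proof eventually_elim
    case w: (elim \<omega>)
    from w(1) show ?case
    proof eventually_elim
      case (elim r)
      show ?case
      proof
        fix l
        have "\<omega> \<notin> F r l" using elim by (auto simp: E_def)
        then have "emeasure (X \<omega>) (?R r l) \<le> ennreal (2 * measure ?\<mu> (?R r l) + 2 ^ r * (real l + 1))"
          using w(2) by (auto simp: F_def)
        also have "2 * measure ?\<mu> (?R r l) + 2 ^ r * (real l + 1) = 2 ^ r * (2 * measure \<rho> (A l) + (real l + 1))"
          unfolding me by (simp add: algebra_simps)
        finally show "emeasure (X \<omega>) (?R r l) \<le> ennreal (2 ^ r * (2 * measure \<rho> (A l) + (real l + 1)))" .
      qed
    qed
  qed
qed

text \<open>Above a size threshold a cell of level \<open>m\<close> holds two points with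
  probability at most \<open>(a / 2 ^ m)\<^sup>2\<close>. The union bound over
  \<open>2 ^ (n + m)\<close> cells leaves a multiple of \<open>(1 / 2) ^ m\<close>, so almost surely
  some level is free of such cells. One level for each interval and threshold is all that
  \<open>simple_points\<close> demands.\<close>

lemma AE_simple_points:
  shows "AE \<omega> in M. simple_points (X \<omega>)"
proof -
  let ?\<mu> = "lebesgue_half_line \<Otimes>\<^sub>M \<rho>" and ?L = "measure_algebra (lebesgue_half_line \<Otimes>\<^sub>M \<rho>)"
  have setsr: "sets \<rho> = sets nonzero_reals" using r by (simp add: jump_measure_def)
  have Xm: "X \<in> M \<rightarrow>\<^sub>M ?L" using X by (simp add: poisson_process_def)
  have sets\<mu>: "sets ?\<mu> = sets (half_line \<Otimes>\<^sub>M nonzero_reals)"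
    using setsr by (intro sets_pair_measure_cong) auto
  have s: "cell m j \<times> A \<in> sets ?\<mu>" if "A \<in> sets nonzero_reals" for m j A
    using that setsr by (intro pair_measureI) auto
  have e: "emeasure ?\<mu> (cell m j \<times> A) = ennreal (1 / 2 ^ m) * emeasure \<rho> A" if "A \<in> sets nonzero_reals" for m j A
    using that by (subst emeasure_intensity[OF r]) (auto simp: emeasure_lebesgue_cell)
  have "AE \<omega> in M. \<forall>m j k. \<forall>s\<in>signs. emeasure (X \<omega>) (cell m j \<times> bin s k) \<in> range of_nat"
  proof -
    have "AE \<omega> in M. emeasure (X \<omega>) (cell m j \<times> bin s k) \<in> range of_nat" if "s \<in> signs" for m j k s
    proof (rule AE_range_nat_points[OF s])
      have "emeasure \<rho> (bin s k) \<le> emeasure \<rho> (up s k)"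
        using bin_subset_up[of k k s] by (intro emeasure_mono) (auto simp: setsr)
      also have "\<dots> < \<infinity>" by (rule up_finite[OF r that])
      finally show "emeasure ?\<mu> (cell m j \<times> bin s k) < \<infinity>"
        by (subst e) (auto simp: ennreal_mult_less_top)
    qed simp
    then show ?thesis by (simp add: AE_all_countable)
  qed
  moreover have "AE \<omega> in M. \<forall>r k. \<exists>m. \<forall>j<2 ^ (r + m). emeasure (X \<omega>) (cell m j \<times> (up 1 k \<union> up (- 1) k)) \<le> 1"
  proof -
    have "AE \<omega> in M. \<exists>m. \<forall>j<2 ^ (n + m). emeasure (X \<omega>) (cell m j \<times> (up 1 k \<union> up (- 1) k)) \<le> 1" for n k
    proof -
      let ?A = "up 1 k \<union> up (- 1) k"
      have A: "?A \<in> sets nonzero_reals" by simp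
      have "emeasure \<rho> ?A \<le> emeasure \<rho> (up 1 k) + emeasure \<rho> (up (- 1) k)"
        by (intro emeasure_subadditive) (auto simp: setsr)
      also have "\<dots> < \<infinity>" using up_finite[OF r] by simp
      finally have Af: "emeasure \<rho> ?A < \<infinity>" .
      define a where "a = measure \<rho> ?A"
      have fin: "emeasure ?\<mu> (cell m j \<times> ?A) < \<infinity>" for m j
        unfolding e[OF A] using Af by (simp add: ennreal_mult_less_top)
      have me: "measure ?\<mu> (cell m j \<times> ?A) = a / 2 ^ m" for m j
        unfolding measure_def e[OF A] a_def by (simp add: enn2real_mult)
      define F where "F m j = {\<omega> \<in> space M. emeasure (X \<omega>) (cell m j \<times> ?A) \<noteq> 0 \<and> emeasure (X \<omega>) (cell m j \<times> ?A) \<noteq> 1}" for m j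
      have Qm: "{N \<in> space ?L. emeasure N (cell m j \<times> ?A) \<noteq> 0 \<and> emeasure N (cell m j \<times> ?A) \<noteq> 1} \<in> sets ?L" for m j
        using measurable_emeasure_measure_algebra[OF s[OF A, of m j]] by measurable
      have FM: "F m j \<in> events" for m j unfolding F_def by (rule poisson_process_prob(2)[OF X Qm])
      have Fp: "prob (F m j) \<le> (a / 2 ^ m)\<^sup>2" for m j
        unfolding F_def poisson_process_prob(1)[OF X Qm]
        using poisson_law_ge2[OF poisson_process_law[OF X] s[OF A] fin] unfolding me .
      define E where "E m = (\<Union>j<2 ^ (n + m). F m j)" for m
      have EM: "E m \<in> events" for m unfolding E_def using FM by auto
      have Ep: "prob (E m) \<le> 2 ^ n * a\<^sup>2 * (1 / 2) ^ m" for m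
      proof -
        have "prob (E m) \<le> (\<Sum>j<2 ^ (n + m). prob (F m j))"
          unfolding E_def by (intro finite_measure_subadditive_finite) (use FM in auto)
        also have "\<dots> \<le> (\<Sum>j<(2::nat) ^ (n + m). (a / 2 ^ m)\<^sup>2)" by (intro sum_mono Fp)
        also have "\<dots> = 2 ^ n * a\<^sup>2 * (1 / 2) ^ m"
          by (simp add: power_add power_divide power2_eq_square field_simps power_one_over)
        finally show ?thesis .
      qed
      have "(\<Inter>m. E m) \<in> events" using EM by (intro sets.countable_INT') auto
      moreover have "prob (\<Inter>m. E m) = 0"
      proof -
        have "(\<lambda>m. 2 ^ n * a\<^sup>2 * (1 / 2) ^ m) \<longlonglongrightarrow> 2 ^ n * a\<^sup>2 * 0"
          by (intro tendsto_mult_left LIMSEQ_power_zero) simp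
        moreover have "prob (\<Inter>m. E m) \<le> 2 ^ n * a\<^sup>2 * (1 / 2) ^ m" for m
          using finite_measure_mono[of "\<Inter>m. E m" "E m"] EM[of m] Ep[of m] by (fastforce intro: order_trans)
        ultimately have "prob (\<Inter>m. E m) \<le> 2 ^ n * a\<^sup>2 * 0" by (intro LIMSEQ_le_const) auto
        then show ?thesis by (simp add: measure_le_0_iff)
      qed
      ultimately have "AE \<omega> in M. \<omega> \<notin> (\<Inter>m. E m)" by (simp add: prob_eq_0)
      with AE_space show ?thesis
      proof eventually_elim
        case (elim \<omega>)
        then obtain m where "\<omega> \<notin> E m" by auto
        then have "emeasure (X \<omega>) (cell m j \<times> ?A) \<le> 1" if "j < 2 ^ (n + m)" for j
        proof -
          have "\<omega> \<notin> F m j" using \<open>\<omega> \<notin> E m\<close> that by (auto simp: E_def)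
          then have "emeasure (X \<omega>) (cell m j \<times> ?A) = 0 \<or> emeasure (X \<omega>) (cell m j \<times> ?A) = 1"
            using elim by (simp add: F_def)
          then show ?thesis by auto
        qed
        then show ?case by blast
      qed
    qed
    then show ?thesis by (simp only: AE_all_countable simp_thms)
  qed
  ultimately show ?thesis using AE_space
  proof eventually_elim
    case (elim \<omega>)
    have "sets (X \<omega>) = sets (half_line \<Otimes>\<^sub>M nonzero_reals)"
      using measurable_space[OF Xm elim(3)] sets\<mu> by simp
    then show ?case unfolding simple_points_def using elim by blast
  qed
qed

end

section \<open>Growth of the signed random measure\<close>

lemma bin_finite: "jump_measure \<rho> \<Longrightarrow> s \<in> signs \<Longrightarrow> emeasure \<rho> (bin s k) < \<infinity>"
  using emeasure_mono[OF bin_subset_up[of k k s], of \<rho>] up_finite[of \<rho> s k] by (auto simp: jump_measure_def intro: le_less_trans)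

lemma of_nat_less_infinity: "(of_nat n :: ennreal) < \<infinity>"
  by (simp add: less_top[symmetric])

lemma eventually_mult_power2_ge:
  assumes "(a::real) > 0" shows "\<forall>\<^sub>F r in sequentially. a * 2 ^ r \<ge> b"
proof -
  obtain n :: nat where n: "b / a < 2 ^ n" using ex_real_less_power2 by blast
  have "a * 2 ^ r \<ge> b" if "r \<ge> n" for r
  proof -
    have "(2::real) ^ n \<le> 2 ^ r" using that by (intro power_increasing) auto
    then have "b / a \<le> 2 ^ r" using n by linarith
    then show ?thesis using assms by (simp add: divide_le_eq mult.commute)
  qed
  then show ?thesis by (auto simp: eventually_sequentially)
qed

lemma nat_ceiling_le_of_nat: "x \<le> real k \<Longrightarrow> nat \<lceil>x\<rceil> \<le> k"
  by (simp add: nat_le_iff ceiling_le_iff)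

text \<open>A jump in the bin with exponent \<open>- 1 - l\<close> satisfies
  \<open>(1 / 2) ^ l < 2 * \<bar>w\<bar>\<close>, and the bins are disjoint. Every partial sum is
  thus at most twice the integral of \<open>min 1 \<bar>w\<bar>\<close>.\<close>

lemma light_bins_summable:
  assumes r: "jump_measure \<rho>" and s: "s \<in> signs"
  shows "summable (\<lambda>l. (1 / 2) ^ l * measure \<rho> (bin s (- 1 - int l)))"
proof -
  have sets: "sets \<rho> = sets nonzero_reals" using r by (simp add: jump_measure_def)
  let ?b = "\<lambda>l. bin s (- 1 - int l)"
  have "(\<Sum>l<n. (1 / 2) ^ l * measure \<rho> (?b l)) \<le> enn2real (2 * (\<integral>\<^sup>+w. ennreal (min 1 \<bar>w\<bar>) \<partial>\<rho>))" for n
  proof -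
    have "ennreal (\<Sum>l<n. (1 / 2) ^ l * measure \<rho> (?b l)) = (\<Sum>l<n. ennreal ((1 / 2) ^ l) * emeasure \<rho> (?b l))"
      using bin_finite[OF r s] by (subst sum_ennreal[symmetric]) (auto simp: ennreal_mult emeasure_eq_ennreal_measure less_top intro!: sum.cong)
    also have "\<dots> = (\<Sum>l<n. \<integral>\<^sup>+w. ennreal ((1 / 2) ^ l) * indicator (?b l) w \<partial>\<rho>)"
      by (intro sum.cong refl nn_integral_cmult_indicator[symmetric]) (simp add: sets)
    also have "\<dots> = (\<integral>\<^sup>+w. (\<Sum>l<n. ennreal ((1 / 2) ^ l) * indicator (?b l) w) \<partial>\<rho>)"
      by (rule nn_integral_sum[symmetric])
        (intro borel_measurable_times_ennreal borel_measurable_const borel_measurable_indicator, simp add: sets)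
    also have "\<dots> \<le> (\<integral>\<^sup>+w. 2 * ennreal (min 1 \<bar>w\<bar>) \<partial>\<rho>)"
    proof (intro nn_integral_mono)
      fix w
      show "(\<Sum>l<n. ennreal ((1 / 2) ^ l) * indicator (?b l) w) \<le> 2 * ennreal (min 1 \<bar>w\<bar>)"
      proof (cases "\<exists>l<n. w \<in> ?b l")
        case True
        then obtain l where l: "l < n" "w \<in> ?b l" by auto
        have "w \<notin> ?b i" if "i \<noteq> l" for i
          using bin_disjoint[OF s s, of "- 1 - int i" "- 1 - int l"] that l by auto
        then have "(\<Sum>i<n. ennreal ((1 / 2) ^ i) * indicator (?b i) w) = (\<Sum>i\<in>{l}. ennreal ((1 / 2) ^ i) * indicator (?b i) w)"
          using l by (intro sum.mono_neutral_right) auto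
        also have "\<dots> = ennreal ((1 / 2) ^ l)" using l by simp
        also have "\<dots> \<le> ennreal (2 * min 1 \<bar>w\<bar>)"
        proof (rule ennreal_leI)
          have "2 powi (- 1 - int l) < s * w" using l by (simp add: bin_def)
          moreover have "(2::real) powi (- 1 - int l) = (1 / 2) ^ Suc l"
            using power2_minus_nat[of "Suc l"] by simp
          moreover have "s * w \<le> \<bar>w\<bar>" using s by auto
          ultimately have "(1 / 2) ^ l \<le> 2 * \<bar>w\<bar>" by simp
          moreover have "(1 / 2) ^ l \<le> (2::real)" by (rule order_trans[of _ 1]) (simp_all add: power_le_one)
          ultimately show "(1 / 2) ^ l \<le> 2 * min 1 \<bar>w\<bar>" by (simp add: min_def)
        qed
        also have "\<dots> = 2 * ennreal (min 1 \<bar>w\<bar>)" by (simp add: ennreal_mult)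
        finally show ?thesis .
      next
        case False
        then have "(\<Sum>l<n. ennreal ((1 / 2) ^ l) * indicator (?b l) w) = 0" by (intro sum.neutral) auto
        then show ?thesis by (simp only: zero_le)
      qed
    qed
    also have "\<dots> = 2 * (\<integral>\<^sup>+w. ennreal (min 1 \<bar>w\<bar>) \<partial>\<rho>)"
      using measurable_min_jump_measure[OF sets] by (rule nn_integral_cmult)
    finally have le: "ennreal (\<Sum>l<n. (1 / 2) ^ l * measure \<rho> (?b l)) \<le> 2 * (\<integral>\<^sup>+w. ennreal (min 1 \<bar>w\<bar>) \<partial>\<rho>)" .
    have "2 * (\<integral>\<^sup>+w. ennreal (min 1 \<bar>w\<bar>) \<partial>\<rho>) < top" using r by (simp add: jump_measure_def ennreal_mult_less_top)
    from enn2real_mono[OF le this] show ?thesis by (simp add: sum_nonneg)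
  qed
  then show ?thesis by (intro summableI_nonneg_bounded) auto
qed

text \<open>\<open>AE_points_upper\<close> bounds the counts of all bins simultaneously. Against the
  weights \<open>(1 / 2) ^ l\<close> both the masses of the bins and the slack \<open>l + 1\<close>
  are summable, and the sum, rounded up, is a deterministic constant.\<close>

lemma (in poisson_jumps) AE_light_weight:
  assumes s: "s \<in> signs"
  shows "\<exists>C::nat. AE \<omega> in M. \<forall>\<^sub>F r in sequentially. light_weight s (X \<omega>) r \<le> of_nat (C * 2 ^ r)"
proof -
  let ?b = "\<lambda>l. bin s (- 1 - int l)"
  define g where "g l = (1 / 2) ^ l * (2 * measure \<rho> (?b l) + (real l + 1))" for l
  have g0: "g l \<ge> 0" for l by (simp add: g_def)
  have sg: "summable g"
  proof -
    have 1: "summable (\<lambda>l. (1 / 2) ^ l * real (Suc l))"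
    proof (rule summable_comparison_test')
      \<comment> \<open>Bernoulli gives \<open>l + 1 <= 4 * (3 / 2) ^ l\<close>, and the ratio is
        \<open>3 / 4 = 1 / 2 * (3 / 2)\<close>.\<close>
      show "summable (\<lambda>l. (3 / 4 :: real) ^ l * 4)" by (intro summable_mult2 summable_geometric) simp
      fix l
      have "1 + real l * (1 / 2) \<le> (1 + 1 / 2) ^ l" using Bernoulli_inequality[of "1 / 2" l] by simp
      then have "real (Suc l) \<le> 4 * (3 / 2) ^ l" by simp
      then have "(1 / 2) ^ l * real (Suc l) \<le> (1 / 2) ^ l * (4 * (3 / 2) ^ l)" by (intro mult_left_mono) auto
      also have "\<dots> = (1 / 2 * (3 / 2)) ^ l * 4" by (simp only: power_mult_distrib ac_simps)
      finally show "norm ((1 / 2) ^ l * real (Suc l)) \<le> (3 / 4) ^ l * 4" by simp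
    qed
    have "g = (\<lambda>l. 2 * ((1 / 2) ^ l * measure \<rho> (?b l)) + (1 / 2) ^ l * real (Suc l))"
      by (auto simp: g_def algebra_simps)
    then show ?thesis using summable_add[OF summable_mult[OF light_bins_summable[OF r s], of 2] 1] by simp
  qed
  obtain C :: nat where C: "suminf g \<le> real C" using real_arch_simple by blast
  have "AE \<omega> in M. \<forall>\<^sub>F r in sequentially. \<forall>l. emeasure (X \<omega>) ({0..<2 ^ r} \<times> ?b l) \<le> ennreal (2 ^ r * (2 * measure \<rho> (?b l) + (real l + 1)))"
    by (intro AE_points_upper bin_finite[OF r s]) simp
  then have "AE \<omega> in M. \<forall>\<^sub>F r in sequentially. light_weight s (X \<omega>) r \<le> of_nat (C * 2 ^ r)"
  proof eventually_elim
    case (elim \<omega>)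
    then show ?case
    proof eventually_elim
      case (elim r)
      have "light_weight s (X \<omega>) r \<le> (\<Sum>l. ennreal ((1 / 2) ^ l) * ennreal (2 ^ r * (2 * measure \<rho> (?b l) + (real l + 1))))"
        unfolding light_weight_def using elim by (intro suminf_le mult_left_mono) auto
      also have "\<dots> = (\<Sum>l. ennreal (2 ^ r * g l))"
      proof (intro suminf_cong)
        fix l
        show "ennreal ((1 / 2) ^ l) * ennreal (2 ^ r * (2 * measure \<rho> (?b l) + (real l + 1))) = ennreal (2 ^ r * g l)"
          unfolding g_def by (subst ennreal_mult[symmetric]) (auto simp: ac_simps)
      qed
      also have "\<dots> = ennreal (2 ^ r * suminf g)"
        using g0 sg by (subst suminf_ennreal2) (auto simp: suminf_mult)
      also have "\<dots> \<le> ennreal (real (C * 2 ^ r))"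
        using C by (intro ennreal_leI) (simp add: mult.commute mult_right_mono)
      also have "\<dots> = of_nat (C * 2 ^ r)" by (simp only: ennreal_of_nat_eq_real_of_nat)
      finally show ?case .
    qed
  qed
  then show ?thesis by blast
qed

lemma light_weight_mono:
  assumes "simple_points N" "r \<le> q" shows "light_weight s N r \<le> light_weight s N q"
proof -
  have le: "(2::real) ^ r \<le> 2 ^ q" using assms(2) by (intro power_increasing) auto
  have "{0..<2 ^ r :: real} \<times> B \<subseteq> {0..<2 ^ q} \<times> B" for B :: "real set"
    by (auto intro: less_le_trans[OF _ le])
  then show ?thesis unfolding light_weight_def using assms(1)
    by (intro suminf_le mult_left_mono emeasure_mono simple_points_times) (auto simp: sets_half_line)
qed

locale poisson_signed_measure = poisson_jumps M \<rho> X for M :: "'w measure" and \<rho> X +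
  fixes W :: "'w \<Rightarrow> real set \<Rightarrow> real"
  assumes N: "AE \<omega> in M. realizes (X \<omega>) (W \<omega>)"

text \<open>The bound on the light weight holds for large \<open>r\<close> only; monotonicity in
  \<open>r\<close> carries finiteness back to every \<open>r\<close>.\<close>

lemma (in poisson_signed_measure) AE_spart_locally_finite:
  assumes s: "s \<in> signs"
  shows "AE \<omega> in M. locally_finite (spart s (W \<omega>))"
proof -
  obtain C where "AE \<omega> in M. \<forall>\<^sub>F r in sequentially. light_weight s (X \<omega>) r \<le> of_nat (C * 2 ^ r)"
    using AE_light_weight[OF s] by blast
  moreover have "AE \<omega> in M. \<forall>r. emeasure (X \<omega>) ({0..<2 ^ r} \<times> up s k) < \<infinity>" for k
    by (intro AE_points_finite up_finite[OF r s]) simp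
  then have "AE \<omega> in M. \<forall>k r. emeasure (X \<omega>) ({0..<2 ^ r} \<times> up s k) < \<infinity>"
    by (simp add: AE_all_countable)
  ultimately show ?thesis using N
  proof eventually_elim
    case (elim \<omega>)
    show ?case
    proof (rule locally_finite_spart[OF elim(3) s])
      fix r
      obtain q where q: "r \<le> q" "light_weight s (X \<omega>) q \<le> of_nat (C * 2 ^ q)"
        using elim(1) unfolding eventually_sequentially by (meson max.cobounded1 max.cobounded2)
      have "light_weight s (X \<omega>) r \<le> light_weight s (X \<omega>) q"
        using elim(3) q(1) by (intro light_weight_mono) (auto simp: realizes_def)
      also have "\<dots> \<le> of_nat (C * 2 ^ q)" by (rule q)
      also have "\<dots> < \<infinity>" by (rule of_nat_less_infinity)
      finally show "light_weight s (X \<omega>) r < \<infinity>" .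
    qed (use elim in auto)
  qed
qed

lemma (in poisson_jumps) AE_points_upper_const:
  assumes A: "A \<in> sets nonzero_reals" "emeasure \<rho> A < \<infinity>"
  shows "\<exists>C::nat. AE \<omega> in M. \<forall>\<^sub>F r in sequentially. emeasure (X \<omega>) ({0..<2 ^ r} \<times> A) \<le> of_nat (C * 2 ^ r)"
proof -
  obtain C :: nat where C: "2 * measure \<rho> A + 1 \<le> real C" using real_arch_simple by blast
  have "AE \<omega> in M. \<forall>\<^sub>F r in sequentially. \<forall>l. emeasure (X \<omega>) ({0..<2 ^ r} \<times> A) \<le> ennreal (2 ^ r * (2 * measure \<rho> A + (real l + 1)))"
    by (intro AE_points_upper[of "\<lambda>_. A"] A)
  then have "AE \<omega> in M. \<forall>\<^sub>F r in sequentially. emeasure (X \<omega>) ({0..<2 ^ r} \<times> A) \<le> of_nat (C * 2 ^ r)"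
  proof eventually_elim
    case (elim \<omega>)
    then show ?case
    proof eventually_elim
      case (elim r)
      have "emeasure (X \<omega>) ({0..<2 ^ r} \<times> A) \<le> ennreal (2 ^ r * (2 * measure \<rho> A + 1))"
        using elim[rule_format, of 0] by simp
      also have "\<dots> \<le> ennreal (real (C * 2 ^ r))"
        using C by (intro ennreal_leI) (simp add: mult.commute mult_right_mono)
      also have "\<dots> = of_nat (C * 2 ^ r)" by (simp only: ennreal_of_nat_eq_real_of_nat)
      finally show ?case .
    qed
  qed
  then show ?thesis by blast
qed

text \<open>The two inputs for the upper bound on edges under infinite activity: the points of
  \<open>D\<close> between light points are of order \<open>4 ^ r\<close>, the heavy points of order
  \<open>2 ^ r\<close>.\<close>

lemma (in poisson_signed_measure) AE_light_heavy_bounds: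
  assumes s: "s \<in> signs"
    and D: "cond_poisson_square M half_line (\<lambda>\<omega>. spart s (W \<omega>)) D"
  shows "\<exists>C::nat. AE \<omega> in M. \<forall>\<^sub>F r in sequentially.
     emeasure (D \<omega>) (light (spart s (W \<omega>)) 1 r \<times> light (spart s (W \<omega>)) 1 r) \<le> of_nat (C * 4 ^ r) \<and>
     finite {x \<in> {0..<2 ^ r}. s * W \<omega> {x} \<ge> 1} \<and> card {x \<in> {0..<2 ^ r}. s * W \<omega> {x} \<ge> 1} \<le> C * 2 ^ r"
proof -
  obtain C1 where C1: "AE \<omega> in M. \<forall>\<^sub>F r in sequentially. light_weight s (X \<omega>) r \<le> of_nat (C1 * 2 ^ r)"
    using AE_light_weight[OF s] by blast
  obtain C2 where C2: "AE \<omega> in M. \<forall>\<^sub>F r in sequentially. emeasure (X \<omega>) ({0..<2 ^ r} \<times> up s (- 1)) \<le> of_nat (C2 * 2 ^ r)"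
    using AE_points_upper_const[OF sets_up up_finite[OF r s]] by blast
  note lf = AE_spart_locally_finite[OF s]
  define C where "C = 3 * (Suc C1)\<^sup>2 + C2"
  have "AE \<omega> in M. \<forall>r. emeasure (X \<omega>) ({0..<2 ^ r} \<times> bin s k) < \<infinity>" for k
    by (intro AE_points_finite bin_finite[OF r s]) simp
  then have fb: "AE \<omega> in M. \<forall>k r. emeasure (X \<omega>) ({0..<2 ^ r} \<times> bin s k) < \<infinity>"
    by (simp add: AE_all_countable)
  have "AE \<omega> in M. \<forall>\<^sub>F r in sequentially.
     emeasure (D \<omega>) (light (spart s (W \<omega>)) 1 r \<times> light (spart s (W \<omega>)) 1 r) \<le> of_nat (C * 4 ^ r) \<and>
     finite {x \<in> {0..<2 ^ r}. s * W \<omega> {x} \<ge> 1} \<and> card {x \<in> {0..<2 ^ r}. s * W \<omega> {x} \<ge> 1} \<le> C * 2 ^ r"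
    using C1 C2 lf fb N cond_poisson_AE_light_bound[OF prob_space_axioms D lf]
  proof eventually_elim
    case (elim \<omega>)
    have "\<forall>\<^sub>F r in sequentially. emeasure (spart s (W \<omega>)) (light (spart s (W \<omega>)) 1 r) \<le> of_nat (C1 * 2 ^ r) \<longrightarrow>
     emeasure (D \<omega>) (light (spart s (W \<omega>)) 1 r \<times> light (spart s (W \<omega>)) 1 r) \<le> of_nat (3 * (Suc C1)\<^sup>2 * 4 ^ r)"
      using elim(6) by blast
    with elim(1,2) show ?case
    proof eventually_elim
      case e: (elim r)
      have "emeasure (spart s (W \<omega>)) (light (spart s (W \<omega>)) 1 r) \<le> light_weight s (X \<omega>) r"
        using elim by (intro light_spart_le s) auto
      then have "emeasure (D \<omega>) (light (spart s (W \<omega>)) 1 r \<times> light (spart s (W \<omega>)) 1 r) \<le> of_nat (3 * (Suc C1)\<^sup>2 * 4 ^ r)"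
        using e by (auto intro: order_trans)
      also have "\<dots> \<le> of_nat (C * 4 ^ r)" unfolding C_def by (intro of_nat_mono mult_right_mono) auto
      finally have 1: "emeasure (D \<omega>) (light (spart s (W \<omega>)) 1 r \<times> light (spart s (W \<omega>)) 1 r) \<le> of_nat (C * 4 ^ r)" .
      have "emeasure (X \<omega>) ({0..<2 ^ r} \<times> up s (- 1)) < \<infinity>" using e(2) by (rule le_less_trans) (rule of_nat_less_infinity)
      note h = heavy_points[OF elim(5) s this]
      have "of_nat (card {x \<in> {0..<2 ^ r}. s * W \<omega> {x} \<ge> 1}) \<le> (of_nat (C2 * 2 ^ r) :: ennreal)"
        using h(2) e(2) by (rule order_trans)
      then have "card {x \<in> {0..<2 ^ r}. s * W \<omega> {x} \<ge> 1} \<le> C2 * 2 ^ r" by (simp only: of_nat_le_iff)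
      also have "\<dots> \<le> C * 2 ^ r" unfolding C_def by (intro mult_right_mono) auto
      finally show ?case using 1 h(1) by simp
    qed
  qed
  then show ?thesis by blast
qed

lemma card_less_pairs:
  fixes J :: "nat set" assumes "finite J"
  shows "2 * card {(i, j) \<in> J \<times> J. i < j} + card J = (card J)\<^sup>2"
proof -
  let ?L = "{(i, j) \<in> J \<times> J. i < j}" and ?G = "{(i, j) \<in> J \<times> J. j < i}" and ?E = "(\<lambda>i. (i, i)) ` J"
  have fin: "finite ?L" "finite ?G" "finite ?E" by (rule finite_subset[of _ "J \<times> J"]; use assms in auto)+
  have "?G = prod.swap ` ?L" by (force simp: image_iff)
  then have "card ?G = card ?L" by (simp add: card_image inj_on_def prod_eq_iff)
  moreover have "card ?E = card J" by (simp add: card_image inj_on_def)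
  moreover have "card (J \<times> J) = card ?L + card ?G + card ?E"
  proof -
    have "J \<times> J = (?L \<union> ?G) \<union> ?E" by (auto simp: not_less_iff_gr_or_eq)
    then have "card (J \<times> J) = card ((?L \<union> ?G) \<union> ?E)" by (rule arg_cong)
    also have "\<dots> = card (?L \<union> ?G) + card ?E" using fin by (intro card_Un_disjoint) auto
    also have "card (?L \<union> ?G) = card ?L + card ?G" using fin by (intro card_Un_disjoint) auto
    finally show ?thesis .
  qed
  ultimately show ?thesis by (simp add: power2_eq_square card_cartesian_product)
qed

text \<open>A positive proportion of the unit cells contains a jump larger than
  \<open>2 powi k\<close>. The product of two such cells has conditional mean at least
  \<open>c2 = 2 powi k * 2 powi k\<close>, so a positive proportion of the pairs is hit. Requiring
  \<open>i < j\<close> places the points above the diagonal, where edges are counted once.\<close>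

lemma (in poisson_signed_measure) AE_edge_hits:
  assumes s: "s \<in> signs"
    and D: "cond_poisson_square M half_line (\<lambda>\<omega>. spart s (W \<omega>)) D"
    and pos: "emeasure \<rho> (up s k) \<noteq> 0"
  shows "\<exists>h>0. AE \<omega> in M. \<forall>\<^sub>F r in sequentially.
     real (card {(i, j) \<in> {..<2 ^ r} \<times> {..<2 ^ r}. i < j \<and> emeasure (D \<omega>) (cell 0 i \<times> cell 0 j) \<noteq> 0}) \<ge> h * 4 ^ r"
proof -
  note lf = AE_spart_locally_finite[OF s]
  note uf = up_finite[OF r s, of k]
  define c where "c = measure \<rho> (up s k)"
  have ec: "emeasure \<rho> (up s k) = ennreal c" unfolding c_def using uf by (intro emeasure_eq_ennreal_measure) auto
  have c: "c > 0" using pos ec by (metis c_def ennreal_0 measure_nonneg order_le_less)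
  define h1 where "h1 = (1 - exp (- c)) / 2"
  have h1: "h1 > 0" using c by (simp add: h1_def)
  have hits: "AE \<omega> in M. \<forall>\<^sub>F r in sequentially. real (card {j \<in> {..<2 ^ (r + 0)}. emeasure (X \<omega>) (cell 0 j \<times> up s k) \<noteq> 0}) > (1 - exp (- c)) / 2 * 2 ^ (r + 0)"
    by (rule AE_points_hits[OF sets_up uf c]) (simp add: ec)
  define c2 where "c2 = (2::real) powi k * 2 powi k"
  have c2: "c2 > 0" by (simp add: c2_def)
  define n where "n r = nat \<lceil>h1\<^sup>2 / 4 * 4 ^ r\<rceil>" for r :: nat
  define I where "I r = {(i, j) \<in> {..<(2::nat) ^ r} \<times> {..<2 ^ r}. i < j}" for r :: nat
  have fI: "finite (I r)" for r by (rule finite_subset[of _ "{..<2 ^ r} \<times> {..<2 ^ r}"]) (auto simp: I_def)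
  have nge: "real (n r) \<ge> h1\<^sup>2 / 4 * 4 ^ r" for r unfolding n_def by linarith
  have "AE \<omega> in M. \<forall>\<^sub>F r in sequentially. real (n r) \<le> card {p \<in> I r. emeasure (spart s (W \<omega>)) (cell 0 (fst p)) * emeasure (spart s (W \<omega>)) (cell 0 (snd p)) \<ge> ennreal c2} \<longrightarrow>
     real (card {p \<in> I r. emeasure (D \<omega>) (cell 0 (fst p) \<times> cell 0 (snd p)) \<noteq> 0}) > (1 - exp (- c2)) / 2 * n r"
  proof (rule cond_poisson_AE_hits[OF prob_space_axioms D lf fI])
    show "disjoint_family_on (\<lambda>p. cell 0 (fst p) \<times> cell 0 (snd p)) (I r)" for r
      unfolding disjoint_family_on_def
    proof (intro ballI impI)
      fix p q :: "nat \<times> nat" assume "p \<noteq> q"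
      then have "fst p \<noteq> fst q \<or> snd p \<noteq> snd q" by (simp add: prod_eq_iff)
      then show "(cell 0 (fst p) \<times> cell 0 (snd p)) \<inter> (cell 0 (fst q) \<times> cell 0 (snd q)) = {}"
        using disjoint_cell[of "fst p" "fst q" 0] disjoint_cell[of "snd p" "snd q" 0] by blast
    qed
    show "h1\<^sup>2 / 4 * 2 ^ r \<le> real (n r)" for r
    proof -
      have "(2::real) ^ r \<le> 4 ^ r" by (rule power_mono) auto
      then have "h1\<^sup>2 / 4 * 2 ^ r \<le> h1\<^sup>2 / 4 * 4 ^ r" by (intro mult_left_mono) auto
      then show ?thesis using nge[of r] by linarith
    qed
  qed (use c2 h1 in auto)
  with hits N have "AE \<omega> in M. \<forall>\<^sub>F r in sequentially.
     real (card {(i, j) \<in> {..<2 ^ r} \<times> {..<2 ^ r}. i < j \<and> emeasure (D \<omega>) (cell 0 i \<times> cell 0 j) \<noteq> 0}) \<ge> (1 - exp (- c2)) / 2 * (h1\<^sup>2 / 4) * 4 ^ r"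
  proof eventually_elim
    case (elim \<omega>)
    have "\<forall>\<^sub>F r in sequentially. h1 * 2 ^ r \<ge> 2" using h1 by (rule eventually_mult_power2_ge)
    with elim(1,3) show ?case
    proof eventually_elim
      case e: (elim r)
      define J where "J = {j \<in> {..<(2::nat) ^ r}. emeasure (X \<omega>) (cell 0 j \<times> up s k) \<noteq> 0}"
      have fJ: "finite J" by (simp add: J_def)
      have J: "real (card J) > h1 * 2 ^ r" using e(1) by (simp add: J_def h1_def)
      then have J2: "real (card J) \<ge> 2" using e(3) by linarith
      have "h1\<^sup>2 / 4 * 4 ^ r \<le> (real (card J))\<^sup>2 / 4"
      proof -
        have "(h1 * 2 ^ r)\<^sup>2 \<le> (real (card J))\<^sup>2"
          by (rule power_mono[OF less_imp_le[OF J]]) (use h1 in simp)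
        moreover have "((2::real) ^ r)\<^sup>2 = 4 ^ r"
          by (simp add: power2_eq_square power_mult_distrib[symmetric])
        ultimately show ?thesis by (simp add: power_mult_distrib)
      qed
      \<comment> \<open>For \<open>N >= 2\<close> the number of pairs \<open>N * (N - 1) / 2\<close>
        is at least \<open>N\<^sup>2 / 4\<close>, whence the requirement that
        \<open>h1 * 2 ^ r\<close> reach 2.\<close>
      also have "\<dots> \<le> real (card {(i, j) \<in> J \<times> J. i < j})"
      proof -
        have "2 * real (card {(i, j) \<in> J \<times> J. i < j}) + real (card J) = (real (card J))\<^sup>2"
          using arg_cong[OF card_less_pairs[OF fJ], of real] by (simp only: of_nat_add of_nat_mult of_nat_numeral of_nat_power)
        moreover have "2 * real (card J) \<le> (real (card J))\<^sup>2" using J2 unfolding power2_eq_square by (intro mult_right_mono) auto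
        ultimately show ?thesis by linarith
      qed
      also have "card {(i, j) \<in> J \<times> J. i < j} \<le> card {p \<in> I r. emeasure (spart s (W \<omega>)) (cell 0 (fst p)) * emeasure (spart s (W \<omega>)) (cell 0 (snd p)) \<ge> ennreal c2}"
      proof (rule card_mono)
        have Jv: "ennreal (2 powi k) \<le> emeasure (spart s (W \<omega>)) (cell 0 j)" if "j \<in> J" for j
          using that elim(2) s by (intro spart_cell_ge[of "X \<omega>"]) (auto simp: J_def)
        have "ennreal c2 \<le> emeasure (spart s (W \<omega>)) (cell 0 i) * emeasure (spart s (W \<omega>)) (cell 0 j)" if "i \<in> J" "j \<in> J" for i j
          using mult_mono[OF Jv[OF that(1)] Jv[OF that(2)]] by (simp add: c2_def ennreal_mult)
        then show "{(i, j) \<in> J \<times> J. i < j} \<subseteq> {p \<in> I r. emeasure (spart s (W \<omega>)) (cell 0 (fst p)) * emeasure (spart s (W \<omega>)) (cell 0 (snd p)) \<ge> ennreal c2}"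
          by (auto simp: I_def J_def)
      qed (use fI in auto)
      finally have "real (n r) \<le> card {p \<in> I r. emeasure (spart s (W \<omega>)) (cell 0 (fst p)) * emeasure (spart s (W \<omega>)) (cell 0 (snd p)) \<ge> ennreal c2}"
        unfolding n_def of_nat_le_iff by (rule nat_ceiling_le_of_nat)
      then have "(1 - exp (- c2)) / 2 * n r < real (card {p \<in> I r. emeasure (D \<omega>) (cell 0 (fst p) \<times> cell 0 (snd p)) \<noteq> 0})"
        using e(2) by blast
      moreover have "(1 - exp (- c2)) / 2 * (h1\<^sup>2 / 4 * 4 ^ r) \<le> (1 - exp (- c2)) / 2 * n r"
        using nge[of r] c2 by (intro mult_left_mono) auto
      moreover have "{p \<in> I r. emeasure (D \<omega>) (cell 0 (fst p) \<times> cell 0 (snd p)) \<noteq> 0} = {(i, j) \<in> {..<2 ^ r} \<times> {..<2 ^ r}. i < j \<and> emeasure (D \<omega>) (cell 0 i \<times> cell 0 j) \<noteq> 0}"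
        by (auto simp: I_def)
      ultimately show ?case by (simp add: mult.assoc)
    qed
  qed
  moreover have "(1 - exp (- c2)) / 2 * (h1\<^sup>2 / 4) > 0" using c2 h1 by simp
  ultimately show ?thesis by blast
qed

text \<open>A cell of length \<open>1 / 2 ^ m\<close> has mean count at least 1, so at least a
  quarter of the cells carries mass \<open>2 powi k\<close>. The mass of the whole interval then
  grows without bound, and the strip over such a cell eventually has conditional mean at least 1,
  however small \<open>2 powi k\<close> is. The proportion of hit strips does not depend on
  \<open>m\<close>, which makes the nodes outgrow any multiple of the length.\<close>

lemma (in poisson_signed_measure) AE_node_hits:
  assumes s: "s \<in> signs"
    and D: "cond_poisson_square M half_line (\<lambda>\<omega>. spart s (W \<omega>)) D"
    and large: "emeasure \<rho> (up s k) \<ge> ennreal (2 ^ m)"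
  shows "AE \<omega> in M. \<forall>\<^sub>F r in sequentially.
     real (card {i \<in> {..<2 ^ (r + m)}. emeasure (D \<omega>) (cell m i \<times> {0..<2 ^ r}) \<noteq> 0}) \<ge> 2 ^ (r + m) / 16"
proof -
  note lf = AE_spart_locally_finite[OF s]
  note uf = up_finite[OF r s, of k]
  \<comment> \<open>Half the hit probability at mean 1. It enters twice, once for the jumps and once
    for \<open>D\<close>, and \<open>q > 1 / 4\<close> gives the factor
    \<open>1 / 16\<close>.\<close>
  define q where "q = (1 - exp (- 1)) / (2::real)"
  have q: "q > 1 / 4"
  proof -
    have "exp (1::real) \<ge> 5 / 2" using exp_lower_Taylor_quadratic[of 1] by simp
    then show ?thesis by (simp add: q_def exp_minus field_simps)
  qed
  have hits: "AE \<omega> in M. \<forall>\<^sub>F r in sequentially. real (card {j \<in> {..<2 ^ (r + m)}. emeasure (X \<omega>) (cell m j \<times> up s k) \<noteq> 0}) > (1 - exp (- 1)) / 2 * 2 ^ (r + m)"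
    by (rule AE_points_hits[OF sets_up uf]) (use large in auto)
  define n where "n r = nat \<lceil>2 ^ (r + m) / 4 :: real\<rceil>" for r :: nat
  have nge: "real (n r) \<ge> 2 ^ (r + m) / 4" for r unfolding n_def by linarith
  have "AE \<omega> in M. \<forall>\<^sub>F r in sequentially. real (n r) \<le> card {i \<in> {..<2 ^ (r + m)}. emeasure (spart s (W \<omega>)) (cell m i) * emeasure (spart s (W \<omega>)) {0..<2 ^ r} \<ge> ennreal 1} \<longrightarrow>
     real (card {i \<in> {..<2 ^ (r + m)}. emeasure (D \<omega>) (cell m i \<times> {0..<2 ^ r}) \<noteq> 0}) > (1 - exp (- 1)) / 2 * n r"
  proof (rule cond_poisson_AE_hits[OF prob_space_axioms D lf, where a = "2 ^ m / 4"])
    show "disjoint_family_on (\<lambda>i. cell m i \<times> {0..<2 ^ r}) {..<2 ^ (r + m)}" for r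
      using disjoint_cell[of _ _ m] unfolding disjoint_family_on_def by blast
    show "2 ^ m / 4 * 2 ^ r \<le> real (n r)" for r
      using nge[of r] by (simp add: power_add mult.commute)
    show "{0..<2 ^ r} \<in> sets half_line" for r by (auto simp: sets_half_line)
  qed auto
  with hits N show ?thesis
  proof eventually_elim
    case (elim \<omega>)
    have "\<forall>\<^sub>F r in sequentially. (2 powi k * 2 powi k * 2 ^ m / 4) * 2 ^ r \<ge> (1::real)"
      by (rule eventually_mult_power2_ge) simp
    with elim(1,3) show ?case
    proof eventually_elim
      case e: (elim r)
      define J where "J = {j \<in> {..<(2::nat) ^ (r + m)}. emeasure (X \<omega>) (cell m j \<times> up s k) \<noteq> 0}"
      let ?V = "spart s (W \<omega>)"
      have fJ: "finite J" by (simp add: J_def)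
      have J: "real (card J) \<ge> 2 ^ (r + m) / 4"
      proof -
        have "1 / 4 * 2 ^ (r + m) \<le> q * 2 ^ (r + m)" using q by (intro mult_right_mono) auto
        moreover have "q * 2 ^ (r + m) < real (card J)" using e(1) unfolding q_def J_def .
        ultimately show ?thesis by linarith
      qed
      have Jv: "ennreal (2 powi k) \<le> emeasure ?V (cell m j)" if "j \<in> J" for j
        using that elim(2) s by (intro spart_cell_ge[of "X \<omega>"]) (auto simp: J_def)
      have "ennreal (2 powi k * (2 ^ (r + m) / 4)) \<le> ennreal (2 powi k * real (card J))"
        using J by (intro ennreal_leI mult_left_mono) auto
      also have "\<dots> = (\<Sum>j\<in>J. ennreal (2 powi k))" by (simp add: ennreal_mult ennreal_of_nat_eq_real_of_nat mult.commute)
      also have "\<dots> \<le> (\<Sum>j\<in>J. emeasure ?V (cell m j))" by (intro sum_mono Jv)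
      also have "\<dots> = emeasure ?V (\<Union>j\<in>J. cell m j)"
        using fJ disjoint_cell[of _ _ m] by (intro sum_emeasure) (auto simp: disjoint_family_on_def)
      also have "\<dots> \<le> emeasure ?V {0..<2 ^ r}"
        using cell_subset[of _ r m] by (intro emeasure_mono) (auto simp: J_def sets_half_line)
      finally have V0: "ennreal (2 powi k * (2 ^ (r + m) / 4)) \<le> emeasure ?V {0..<2 ^ r}" .
      have "J \<subseteq> {i \<in> {..<2 ^ (r + m)}. emeasure ?V (cell m i) * emeasure ?V {0..<2 ^ r} \<ge> ennreal 1}"
      proof
        fix j assume j: "j \<in> J"
        have "ennreal 1 \<le> ennreal (2 powi k * (2 powi k * (2 ^ (r + m) / 4)))"
          using e(3) by (intro ennreal_leI) (simp add: power_add ac_simps)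
        also have "\<dots> = ennreal (2 powi k) * ennreal (2 powi k * (2 ^ (r + m) / 4))"
          by (rule ennreal_mult) auto
        also have "\<dots> \<le> emeasure ?V (cell m j) * emeasure ?V {0..<2 ^ r}"
          using Jv[OF j] V0 by (rule mult_mono) auto
        finally show "j \<in> {i \<in> {..<2 ^ (r + m)}. emeasure ?V (cell m i) * emeasure ?V {0..<2 ^ r} \<ge> ennreal 1}"
          using j by (simp add: J_def)
      qed
      then have "card J \<le> card {i \<in> {..<2 ^ (r + m)}. emeasure ?V (cell m i) * emeasure ?V {0..<2 ^ r} \<ge> ennreal 1}"
        by (intro card_mono) auto
      moreover have "n r \<le> card J" using J unfolding n_def by (rule nat_ceiling_le_of_nat)
      ultimately have "real (n r) \<le> card {i \<in> {..<2 ^ (r + m)}. emeasure ?V (cell m i) * emeasure ?V {0..<2 ^ r} \<ge> ennreal 1}"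
        by linarith
      then have "real (card {i \<in> {..<2 ^ (r + m)}. emeasure (D \<omega>) (cell m i \<times> {0..<2 ^ r}) \<noteq> 0}) > q * n r"
        using e(2) unfolding q_def by blast
      moreover have "q * n r \<ge> 1 / 4 * (2 ^ (r + m) / 4)" using nge[of r] q by (intro mult_mono) auto
      ultimately show ?case by simp
    qed
  qed
qed

lemma (in poisson_signed_measure) AE_card_atoms:
  assumes fin: "emeasure \<rho> (- {0}) < \<infinity>"
  shows "\<exists>C::nat. AE \<omega> in M. \<forall>\<^sub>F r in sequentially.
     finite {x \<in> {0..<2 ^ r}. W \<omega> {x} \<noteq> 0} \<and> card {x \<in> {0..<2 ^ r}. W \<omega> {x} \<noteq> 0} \<le> C * 2 ^ r"
proof -
  have m: "- {0} \<in> sets nonzero_reals" by (auto simp: sets_nonzero_reals)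
  obtain C where C: "AE \<omega> in M. \<forall>\<^sub>F r in sequentially. emeasure (X \<omega>) ({0..<2 ^ r} \<times> - {0}) \<le> of_nat (C * 2 ^ r)"
    using AE_points_upper_const[OF m fin] by blast
  have "AE \<omega> in M. \<forall>\<^sub>F r in sequentially.
     finite {x \<in> {0..<2 ^ r}. W \<omega> {x} \<noteq> 0} \<and> card {x \<in> {0..<2 ^ r}. W \<omega> {x} \<noteq> 0} \<le> C * 2 ^ r"
    using C N
  proof eventually_elim
    case (elim \<omega>)
    from elim(1) show ?case
    proof eventually_elim
      case e: (elim r)
      have "emeasure (X \<omega>) ({0..<2 ^ r} \<times> - {0}) < \<infinity>" using e by (rule le_less_trans) (rule of_nat_less_infinity)
      note h = card_atoms_le[OF elim(2) this]
      have "of_nat (card {x \<in> {0..<2 ^ r}. W \<omega> {x} \<noteq> 0}) \<le> (of_nat (C * 2 ^ r) :: ennreal)"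
        using h(2) e by (rule order_trans)
      then show ?case using h(1) by (simp only: of_nat_le_iff)
    qed
  qed
  then show ?thesis by blast
qed

text \<open>The degenerate case of finite activity: the counts have mean 0, so
  \<open>poisson_law_nonzero\<close> gives probability 0 to a jump in any of the countably many
  dyadic intervals.\<close>

lemma (in poisson_signed_measure) AE_no_atoms:
  assumes z: "emeasure \<rho> (- {0}) = 0"
  shows "AE \<omega> in M. \<forall>x\<ge>0. W \<omega> {x} = 0"
proof -
  let ?\<mu> = "lebesgue_half_line \<Otimes>\<^sub>M \<rho>" and ?L = "measure_algebra (lebesgue_half_line \<Otimes>\<^sub>M \<rho>)"
  have m: "- {0} \<in> sets nonzero_reals" by (auto simp: sets_nonzero_reals)
  have "AE \<omega> in M. emeasure (X \<omega>) ({0..<2 ^ q} \<times> - {0}) = 0" for q :: nat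
  proof -
    let ?B = "{0..<2 ^ q} \<times> - {0::real}"
    have s: "?B \<in> sets ?\<mu>" using r m by (intro pair_measureI) (auto simp: sets_half_line jump_measure_def)
    have e: "emeasure ?\<mu> ?B = 0" using m z by (subst emeasure_intensity[OF r]) (auto simp: sets_half_line)
    have Qm: "{N \<in> space ?L. emeasure N ?B \<noteq> 0} \<in> sets ?L"
      using measurable_emeasure_measure_algebra[OF s] by measurable
    have "prob {\<omega> \<in> space M. emeasure (X \<omega>) ?B \<noteq> 0} = 1 - exp (- measure ?\<mu> ?B)"
      unfolding poisson_process_prob(1)[OF X Qm] using e by (intro poisson_law_nonzero[OF poisson_process_law[OF X] s]) simp
    then have "prob {\<omega> \<in> space M. emeasure (X \<omega>) ?B \<noteq> 0} = 0" using e by (simp add: measure_def)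
    then have "AE \<omega> in M. \<omega> \<notin> {\<omega> \<in> space M. emeasure (X \<omega>) ?B \<noteq> 0}"
      using poisson_process_prob(2)[OF X Qm] by (simp add: prob_eq_0)
    with AE_space show ?thesis by eventually_elim auto
  qed
  then have "AE \<omega> in M. \<forall>q::nat. emeasure (X \<omega>) ({0..<2 ^ q} \<times> - {0}) = 0"
    by (simp add: AE_all_countable)
  then show ?thesis using N
  proof eventually_elim
    case (elim \<omega>)
    show ?case
    proof (intro allI impI)
      fix x :: real assume x: "x \<ge> 0"
      obtain q :: nat where q: "x < 2 ^ q" using ex_real_less_power2 by blast
      have f: "emeasure (X \<omega>) ({0..<2 ^ q} \<times> - {0}) < \<infinity>" using elim(1) by simp
      have "of_nat (card {x \<in> {0..<2 ^ q}. W \<omega> {x} \<noteq> 0}) \<le> (0 :: ennreal)"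
        using card_atoms_le(2)[OF elim(2) f] elim(1) by simp
      then have "{x \<in> {0..<2 ^ q}. W \<omega> {x} \<noteq> 0} = {}"
        using card_atoms_le(1)[OF elim(2) f] by simp
      then show "W \<omega> {x} = 0" using x q by auto
    qed
  qed
qed

section \<open>The signed graph\<close>

definition lattice_points :: "(real \<times> real) measure \<Rightarrow> bool" where
  "lattice_points R \<longleftrightarrow> sets R = sets (half_line \<Otimes>\<^sub>M half_line) \<and>
     (\<forall>m i j. emeasure R (cell m i \<times> cell m j) \<in> range of_nat)"

definition pts :: "(real \<times> real) measure \<Rightarrow> (real \<times> real) set" where
  "pts R = {p. emeasure R {p} \<noteq> 0}"

lemma singleton_half_plane: "x \<ge> 0 \<Longrightarrow> y \<ge> 0 \<Longrightarrow> {(x, y)} \<in> sets (half_line \<Otimes>\<^sub>M half_line)"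
  using pair_measureI[of "{x}" half_line "{y}" half_line] by simp

lemma pts_nonneg:
  assumes R: "lattice_points R" and p: "(x, y) \<in> pts R" shows "x \<ge> 0" "y \<ge> 0"
proof -
  have "{(x, y)} \<in> sets (half_line \<Otimes>\<^sub>M half_line)"
    using emeasure_notin_sets[of "{(x, y)}" R] R p by (auto simp: lattice_points_def pts_def)
  then have "(x, y) \<in> {0..} \<times> {0..}"
    using sets.sets_into_space[of "{(x, y)}" "half_line \<Otimes>\<^sub>M half_line"] by (simp add: space_pair_measure)
  then show "x \<ge> 0" "y \<ge> 0" by auto
qed

lemma lattice_points_singleton_nat:
  assumes R: "lattice_points R" and xy: "x \<ge> 0" "y \<ge> 0"
  shows "emeasure R {(x, y)} \<in> range of_nat"
proof -
  let ?c = "\<lambda>x m. cell m (nat \<lfloor>x * 2 ^ m\<rfloor>)"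
  let ?C = "\<lambda>m. ?c x m \<times> ?c y m"
  have nat: "emeasure R (?C m) \<in> range of_nat" for m using R by (simp add: lattice_points_def)
  have dec: "decseq ?C"
    using decseq_cell_index[OF xy(1)] decseq_cell_index[OF xy(2)] by (fastforce simp: decseq_def)
  have "(\<Inter>m. ?C m) = (\<Inter>m. ?c x m) \<times> (\<Inter>m. ?c y m)" by auto
  then have "(\<Inter>m. ?C m) = {(x, y)}" unfolding INT_cell_index[OF xy(1)] INT_cell_index[OF xy(2)] by simp
  moreover have "\<exists>n. emeasure R (\<Inter>m. ?C m) = emeasure R (?C n)"
    by (rule emeasure_INT_nat[OF _ dec nat]) (use R in \<open>auto simp: lattice_points_def\<close>)
  ultimately show ?thesis using nat by auto
qed

lemma pts_ge_1:
  assumes R: "lattice_points R" and p: "p \<in> pts R" shows "emeasure R {p} \<ge> 1"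
proof -
  obtain x y where xy: "p = (x, y)" by (cases p)
  obtain n :: nat where n: "emeasure R {p} = of_nat n"
    using lattice_points_singleton_nat[OF R pts_nonneg[OF R p[unfolded xy]]] unfolding xy by auto
  then have "n \<ge> 1" using p by (cases n) (auto simp: pts_def)
  then show ?thesis unfolding n by (metis of_nat_1 of_nat_mono)
qed

lemma card_pts_le:
  assumes R: "lattice_points R" and A: "A \<in> sets (half_line \<Otimes>\<^sub>M half_line)" "emeasure R A < \<infinity>"
  shows "finite (pts R \<inter> A)" "of_nat (card (pts R \<inter> A)) \<le> emeasure R A"
proof -
  have sR: "sets R = sets (half_line \<Otimes>\<^sub>M half_line)" using R by (simp add: lattice_points_def)
  have "{p} \<in> sets R \<and> {p} \<subseteq> A \<and> 1 \<le> emeasure R {p}" if "p \<in> pts R \<inter> A" for p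
    using pts_nonneg[OF R, of "fst p" "snd p"] that singleton_half_plane[of "fst p" "snd p"] sR pts_ge_1[OF R, of p] by auto
  moreover have "disjoint_family_on (\<lambda>p. {p}) (pts R \<inter> A)" by (auto simp: disjoint_family_on_def)
  moreover have "A \<in> sets R" using A(1) sR by simp
  ultimately show "finite (pts R \<inter> A)" "of_nat (card (pts R \<inter> A)) \<le> emeasure R A"
    using card_le_emeasure[of A R "\<lambda>p. {p}" "pts R \<inter> A"] A(2) by blast+
qed

lemma lattice_points_finite:
  assumes R: "lattice_points R"
  shows "emeasure R ({0..<2 ^ r} \<times> {0..<2 ^ r}) < \<infinity>"
proof -
  have sR: "sets R = sets (half_line \<Otimes>\<^sub>M half_line)" using R by (simp add: lattice_points_def)
  have "{0..<2 ^ r} \<times> {0..<2 ^ r} = (\<Union>(i, j)\<in>{..<2 ^ (r + 0)} \<times> {..<2 ^ (r + 0)}. cell 0 i \<times> cell 0 j)"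
    unfolding UN_cell[where r=r and m=0, symmetric] by blast
  also have "emeasure R \<dots> \<le> (\<Sum>(i, j)\<in>{..<2 ^ (r + 0)} \<times> {..<2 ^ (r + 0)}. emeasure R (cell 0 i \<times> cell 0 j))"
    unfolding case_prod_beta by (intro emeasure_subadditive_finite) (auto simp: sR)
  also have "\<dots> < \<infinity>"
  proof -
    have "emeasure R (cell 0 i \<times> cell 0 j) < \<infinity>" for i j
    proof -
      obtain n :: nat where "emeasure R (cell 0 i \<times> cell 0 j) = of_nat n" using R unfolding lattice_points_def by (metis imageE)
      then show ?thesis by (simp add: of_nat_less_infinity[simplified])
    qed
    then show ?thesis by (auto simp: case_prod_beta)
  qed
  finally show ?thesis .
qed

lemma finite_pts_bounded:
  assumes R: "lattice_points R" shows "finite (pts R \<inter> {0..a} \<times> {0..a})"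
proof -
  obtain r :: nat where r: "a < 2 ^ r" using ex_real_less_power2 by blast
  have "finite (pts R \<inter> {0..<2 ^ r} \<times> {0..<2 ^ r})"
    by (rule card_pts_le(1)[OF R _ lattice_points_finite[OF R]]) (intro pair_measureI; auto simp: sets_half_line)
  then show ?thesis by (rule rev_finite_subset) (use r in auto)
qed

text \<open>The descent in the plane: each product of cells splits into four, and the branch shrinks
  to a single point in both coordinates.\<close>

lemma lattice_points_hit:
  assumes R: "lattice_points R" and nz: "emeasure R (cell m i \<times> cell m j) \<noteq> 0"
  shows "\<exists>p\<in>pts R. p \<in> cell m i \<times> cell m j"
proof -
  let ?C = "\<lambda>m (p :: nat \<times> nat). cell m (fst p) \<times> cell m (snd p)"
  let ?ch = "\<lambda>p :: nat \<times> nat. {2 * fst p, 2 * fst p + 1} \<times> {2 * snd p, 2 * snd p + 1}"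
  have "\<exists>f. f 0 = (i, j) \<and> (\<forall>n. f (Suc n) \<in> ?ch (f n)) \<and> emeasure R (\<Inter>n. ?C (m + n) (f n)) \<noteq> 0"
  proof (rule tree_descent[of ?C])
    show "?C m p = (\<Union>q\<in>?ch p. ?C (Suc m) q)" for m p
      using cell_Suc[of m "fst p"] cell_Suc[of m "snd p"] by auto
  qed (use R nz in \<open>auto simp: lattice_points_def\<close>)
  then obtain f where f: "f 0 = (i, j)" "emeasure R (\<Inter>n. ?C (m + n) (f n)) \<noteq> 0" by blast
  have eq: "(\<Inter>n. ?C (m + n) (f n)) = (\<Inter>n. cell (m + n) (fst (f n))) \<times> (\<Inter>n. cell (m + n) (snd (f n)))" by auto
  have "(\<Inter>n. ?C (m + n) (f n)) \<noteq> {}" using f(2) by (metis emeasure_empty)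
  then obtain x y where xy: "x \<in> (\<Inter>n. cell (m + n) (fst (f n)))" "y \<in> (\<Inter>n. cell (m + n) (snd (f n)))"
    unfolding eq by blast
  have "(\<Inter>n. ?C (m + n) (f n)) = {(x, y)}" unfolding eq INT_cells_subset[OF xy(1)] INT_cells_subset[OF xy(2)] by simp
  then have "(x, y) \<in> pts R" using f(2) by (simp add: pts_def)
  moreover have "(x, y) \<in> cell m i \<times> cell m j" using xy f(1) by (auto dest!: spec[of _ 0])
  ultimately show ?thesis by blast
qed

lemma lattice_points_hit_row:
  assumes R: "lattice_points R" and nz: "emeasure R (cell m i \<times> {0..<2 ^ r}) \<noteq> 0"
  shows "\<exists>p\<in>pts R. p \<in> cell m i \<times> {0..<2 ^ r}"
proof -
  have sR: "sets R = sets (half_line \<Otimes>\<^sub>M half_line)" using R by (simp add: lattice_points_def)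
  have eq: "cell m i \<times> {0..<2 ^ r} = (\<Union>j<2 ^ (r + m). cell m i \<times> cell m j)"
    unfolding UN_cell[where r=r and m=m, symmetric] by blast
  have "\<exists>j<2 ^ (r + m). emeasure R (cell m i \<times> cell m j) \<noteq> 0"
  proof (rule ccontr)
    assume "\<not> ?thesis"
    then have "(\<Union>j<2 ^ (r + m). cell m i \<times> cell m j) \<in> null_sets R"
      by (intro null_sets_UN') (auto simp: sR)
    then show False using nz eq by auto
  qed
  then obtain j where j: "j < 2 ^ (r + m)" "emeasure R (cell m i \<times> cell m j) \<noteq> 0" by blast
  then obtain p where "p \<in> pts R" "p \<in> cell m i \<times> cell m j" using lattice_points_hit[OF R] by blast
  then show ?thesis using cell_subset[OF j(1)] by blast
qed

lemma card_le_by_cells: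
  assumes "finite B" and inj: "\<And>i j b. i \<in> A \<Longrightarrow> j \<in> A \<Longrightarrow> b \<in> c i \<Longrightarrow> b \<in> c j \<Longrightarrow> i = j"
    and ex: "\<And>i. i \<in> A \<Longrightarrow> \<exists>b\<in>B. b \<in> c i"
  shows "card A \<le> card B"
proof -
  obtain f where f: "\<And>i. i \<in> A \<Longrightarrow> f i \<in> B \<and> f i \<in> c i" using ex by metis
  have "inj_on f A" using f inj by (auto intro!: inj_onI) metis
  then show ?thesis using f assms(1) by (intro card_inj_on_le[of f]) auto
qed

text \<open>Symmetrised, because the graph sees only \<open>n_ij + n_ji\<close>.\<close>

definition edges :: "(real \<times> real) measure \<Rightarrow> (real \<times> real) set" where
  "edges R = pts R \<union> prod.swap ` pts R"

lemma mem_edges: "(x, y) \<in> edges R \<longleftrightarrow> (x, y) \<in> pts R \<or> (y, x) \<in> pts R"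
  by (force simp: edges_def image_iff)

lemma card_edges_light_le:
  assumes R: "lattice_points R" and L: "L \<in> sets half_line" and le: "emeasure R (L \<times> L) \<le> of_nat n"
  shows "finite (edges R \<inter> L \<times> L)" "card (edges R \<inter> L \<times> L) \<le> 2 * n"
proof -
  have "emeasure R (L \<times> L) < \<infinity>" using le by (rule le_less_trans) (rule of_nat_less_infinity)
  note c = card_pts_le[OF R pair_measureI[OF L L] this]
  have eq: "edges R \<inter> L \<times> L = (pts R \<inter> L \<times> L) \<union> prod.swap ` (pts R \<inter> L \<times> L)"
    by (force simp: edges_def image_iff)
  show "finite (edges R \<inter> L \<times> L)" unfolding eq using c(1) by simp
  have "of_nat (card (pts R \<inter> L \<times> L)) \<le> (of_nat n :: ennreal)" using c(2) le by (rule order_trans)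
  then have n: "card (pts R \<inter> L \<times> L) \<le> n" by (simp only: of_nat_le_iff)
  have "card (edges R \<inter> L \<times> L) \<le> card (pts R \<inter> L \<times> L) + card (prod.swap ` (pts R \<inter> L \<times> L))"
    unfolding eq by (rule card_Un_le)
  also have "\<dots> \<le> 2 * n" using n card_image_le[OF c(1), of prod.swap] by linarith
  finally show "card (edges R \<inter> L \<times> L) \<le> 2 * n" .
qed

section \<open>The signed graph of one realisation\<close>

locale signed_points =
  fixes \<nu> :: "real set \<Rightarrow> real" and P Q :: "(real \<times> real) measure"
  assumes P: "lattice_points P" and Q: "lattice_points Q"
    and supp_P: "\<And>x y. (x, y) \<in> pts P \<Longrightarrow> \<nu> {x} > 0 \<and> \<nu> {y} > 0"
    and supp_Q: "\<And>x y. (x, y) \<in> pts Q \<Longrightarrow> \<nu> {x} < 0 \<and> \<nu> {y} < 0"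
begin

abbreviation \<zeta> :: "(real \<times> real) set \<Rightarrow> real" where
  "\<zeta> \<equiv> signed_graph \<nu> (signed_diff P Q)"

definition E :: "(real \<times> real) set" where
  "E = edges P \<union> edges Q"

definition nodes :: "real \<Rightarrow> real set" where
  "nodes \<alpha> = {x \<in> {0..\<alpha>}. \<exists>y\<in>{0..\<alpha>}. (x, y) \<in> E}"

definition upper_edges :: "real \<Rightarrow> (real \<times> real) set" where
  "upper_edges \<alpha> = E \<inter> {(x, y). 0 \<le> x \<and> x \<le> y \<and> y \<le> \<alpha>}"

lemma edges_P: "(x, y) \<in> edges P \<Longrightarrow> \<nu> {x} > 0 \<and> \<nu> {y} > 0 \<and> x \<ge> 0 \<and> y \<ge> 0"
  unfolding mem_edges using supp_P pts_nonneg[OF P] by blast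

lemma edges_Q: "(x, y) \<in> edges Q \<Longrightarrow> \<nu> {x} < 0 \<and> \<nu> {y} < 0 \<and> x \<ge> 0 \<and> y \<ge> 0"
  unfolding mem_edges using supp_Q pts_nonneg[OF Q] by blast

lemma E_atoms: "E \<subseteq> atoms \<nu> \<times> atoms \<nu>"
  using edges_P edges_Q by (fastforce simp: E_def atoms_def)

lemma finite_E: "finite (E \<inter> {0..a} \<times> {0..a})"
proof -
  have "finite (edges R \<inter> {0..a} \<times> {0..a})" if "lattice_points R" for R
  proof -
    have "edges R \<inter> {0..a} \<times> {0..a} = (pts R \<inter> {0..a} \<times> {0..a}) \<union> prod.swap ` (pts R \<inter> {0..a} \<times> {0..a})"
      by (force simp: edges_def image_iff)
    then show ?thesis using finite_pts_bounded[OF that] by simp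
  qed
  then show ?thesis using P Q by (simp add: E_def Int_Un_distrib2)
qed

lemma measure_singleton:
  assumes R: "lattice_points R" and xy: "x \<ge> 0" "y \<ge> 0"
  shows "measure R {(x, y)} = 0 \<longleftrightarrow> (x, y) \<notin> pts R" "(x, y) \<in> pts R \<Longrightarrow> measure R {(x, y)} \<ge> 1"
proof -
  obtain n :: nat where n: "emeasure R {(x, y)} = of_nat n"
    using lattice_points_singleton_nat[OF assms] by auto
  have m: "measure R {(x, y)} = real n" by (simp add: measure_def n)
  show "measure R {(x, y)} = 0 \<longleftrightarrow> (x, y) \<notin> pts R" by (simp add: m pts_def n)
  assume "(x, y) \<in> pts R"
  then have "n \<noteq> 0" by (auto simp: pts_def n)
  then show "measure R {(x, y)} \<ge> 1" by (simp add: m)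
qed

text \<open>The sign of the weights keeps edges of \<open>P\<close> and of \<open>Q\<close> apart,
  so at most one of the two measures contributes. Its masses are natural numbers, so a nonzero sum
  has modulus at least 1 and the truncation turns it into exactly 1 or -1.\<close>

lemma sign_value:
  assumes xy: "x \<ge> 0" "y \<ge> 0"
  defines "z \<equiv> signed_diff P Q {(x, y)} + signed_diff P Q {(y, x)}"
  shows "sgn z * min \<bar>z\<bar> 1 = indicator (edges P) (x, y) - indicator (edges Q) (x, y)"
proof -
  have z: "z = measure P {(x, y)} + measure P {(y, x)} - (measure Q {(x, y)} + measure Q {(y, x)})"
    by (simp add: z_def signed_diff_def)
  note ms = measure_singleton[OF P xy] measure_singleton[OF P xy(2,1)] measure_singleton[OF Q xy] measure_singleton[OF Q xy(2,1)]
  have nn: "measure R A \<ge> 0" for R :: "(real \<times> real) measure" and A by simp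
  consider "(x, y) \<in> edges P" | "(x, y) \<in> edges Q" | "(x, y) \<notin> edges P" "(x, y) \<notin> edges Q" by blast
  then show ?thesis
  proof cases
    case 1
    then have nq: "(x, y) \<notin> edges Q" using edges_P edges_Q by force
    have "z = measure P {(x, y)} + measure P {(y, x)}" using nq ms by (simp add: z mem_edges)
    moreover have "measure P {(x, y)} + measure P {(y, x)} \<ge> 1"
      using 1 ms nn[of P "{(x, y)}"] nn[of P "{(y, x)}"] unfolding mem_edges by linarith
    ultimately have "z \<ge> 1" by simp
    then show ?thesis using 1 nq by simp
  next
    case 2
    then have np: "(x, y) \<notin> edges P" using edges_P edges_Q by force
    have "z = - (measure Q {(x, y)} + measure Q {(y, x)})" using np ms by (simp add: z mem_edges)
    moreover have "measure Q {(x, y)} + measure Q {(y, x)} \<ge> 1"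
      using 2 ms nn[of Q "{(x, y)}"] nn[of Q "{(y, x)}"] unfolding mem_edges by linarith
    ultimately have "z \<le> - 1" by simp
    then show ?thesis using 2 np by simp
  next
    case 3
    then have "z = 0" using ms by (simp add: z mem_edges)
    then show ?thesis using 3 by simp
  qed
qed

text \<open>Inside a bounded square only finitely many terms are nonzero, so the sum over the
  possibly infinite set of pairs of atoms is a finite count with signs.\<close>

lemma signed_graph_eq:
  assumes A: "A \<subseteq> {0..a} \<times> {0..a}"
  shows "\<zeta> A = real (card (A \<inter> edges P)) - real (card (A \<inter> edges Q))"
proof -
  have fE: "finite (A \<inter> E)" using finite_E[of a] by (rule rev_finite_subset) (use A in auto)
  have fP: "finite (A \<inter> edges P)" "finite (A \<inter> edges Q)" by (rule finite_subset[OF _ fE], auto simp: E_def)+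
  have "\<zeta> A = infsum (\<lambda>p. indicator (edges P) p - indicator (edges Q) p) (A \<inter> E)"
    unfolding signed_graph_def
  proof (rule infsum_cong_neutral)
    fix p assume p: "p \<in> A \<inter> atoms \<nu> \<times> atoms \<nu> - A \<inter> E"
    obtain x y where xy: "p = (x, y)" "x \<ge> 0" "y \<ge> 0" using p by (auto simp: atoms_def)
    then show "(case p of (x, y) \<Rightarrow> sgn (signed_diff P Q {(x, y)} + signed_diff P Q {(y, x)}) *
        min \<bar>signed_diff P Q {(x, y)} + signed_diff P Q {(y, x)}\<bar> 1) = 0"
      using p sign_value[OF xy(2,3)] by (auto simp: E_def)
  next
    fix p assume p: "p \<in> A \<inter> atoms \<nu> \<times> atoms \<nu> \<inter> (A \<inter> E)"
    obtain x y where xy: "p = (x, y)" "x \<ge> 0" "y \<ge> 0" using p by (auto simp: atoms_def)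
    then show "(case p of (x, y) \<Rightarrow> sgn (signed_diff P Q {(x, y)} + signed_diff P Q {(y, x)}) *
        min \<bar>signed_diff P Q {(x, y)} + signed_diff P Q {(y, x)}\<bar> 1) = indicator (edges P) p - indicator (edges Q) p"
      using sign_value[OF xy(2,3)] by simp
  qed (use E_atoms in auto)
  also have "\<dots> = (\<Sum>p\<in>A \<inter> E. indicator (edges P) p - indicator (edges Q) p)"
    using fE by (rule infsum_finite)
  also have "\<dots> = (\<Sum>p\<in>A \<inter> E. indicator (edges P) p) - (\<Sum>p\<in>A \<inter> E. indicator (edges Q) p)"
    by (rule sum_subtractf)
  also have "(\<Sum>p\<in>A \<inter> E. indicator (edges P) p) = real (card (A \<inter> edges P))"
  proof -
    have "A \<inter> E \<inter> edges P = A \<inter> edges P" by (auto simp: E_def)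
    then show ?thesis using fE by (simp add: sum.If_cases indicator_def Int_def)
  qed
  also have "(\<Sum>p\<in>A \<inter> E. indicator (edges Q) p) = real (card (A \<inter> edges Q))"
  proof -
    have "A \<inter> E \<inter> edges Q = A \<inter> edges Q" by (auto simp: E_def)
    then show ?thesis using fE by (simp add: sum.If_cases indicator_def Int_def)
  qed
  finally show ?thesis .
qed

text \<open>All edges in the row of \<open>x\<close> carry the sign of the weight at
  \<open>x\<close>, so the value of the graph on a row vanishes only if the row contains no
  edge.\<close>

lemma num_nodes_eq: "num_nodes \<nu> \<zeta> \<alpha> = card (nodes \<alpha>)"
proof -
  have "{\<theta> \<in> atoms \<nu> \<inter> {0..\<alpha>}. \<zeta> ({\<theta>} \<times> {0..\<alpha>}) \<noteq> 0} = nodes \<alpha>"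
  proof (intro equalityI subsetI)
    fix x assume "x \<in> {\<theta> \<in> atoms \<nu> \<inter> {0..\<alpha>}. \<zeta> ({\<theta>} \<times> {0..\<alpha>}) \<noteq> 0}"
    then have x: "x \<in> {0..\<alpha>}" "\<zeta> ({x} \<times> {0..\<alpha>}) \<noteq> 0" by auto
    have "{x} \<times> {0..\<alpha>} \<subseteq> {0..\<alpha>} \<times> {0..\<alpha>}" using x by auto
    from signed_graph_eq[OF this] x(2) have "{x} \<times> {0..\<alpha>} \<inter> edges P \<noteq> {} \<or> {x} \<times> {0..\<alpha>} \<inter> edges Q \<noteq> {}" by auto
    then show "x \<in> nodes \<alpha>" using x(1) by (auto simp: nodes_def E_def)
  next
    fix x assume "x \<in> nodes \<alpha>"
    then obtain y where xy: "x \<in> {0..\<alpha>}" "y \<in> {0..\<alpha>}" "(x, y) \<in> E" by (auto simp: nodes_def)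
    let ?A = "{x} \<times> {0..\<alpha>}"
    have A: "?A \<subseteq> {0..\<alpha>} \<times> {0..\<alpha>}" using xy by auto
    have fE: "finite (?A \<inter> E)" using finite_E[of \<alpha>] by (rule rev_finite_subset) (use A in auto)
    have f: "finite (?A \<inter> edges P)" "finite (?A \<inter> edges Q)" by (rule finite_subset[OF _ fE], auto simp: E_def)+
    have "\<zeta> ?A \<noteq> 0"
    proof (cases "(x, y) \<in> edges P")
      case True
      then have "?A \<inter> edges Q = {}" using edges_P edges_Q by force
      moreover have "(x, y) \<in> ?A \<inter> edges P" using True xy by simp
      then have "card (?A \<inter> edges P) \<noteq> 0" using f(1) by (metis card_0_eq empty_iff)
      ultimately show ?thesis unfolding signed_graph_eq[OF A] by simp
    next
      case False
      then have "(x, y) \<in> edges Q" using xy by (simp add: E_def)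
      then have "?A \<inter> edges P = {}" using edges_P edges_Q by force
      moreover have "(x, y) \<in> ?A \<inter> edges Q" using \<open>(x, y) \<in> edges Q\<close> xy by simp
      then have "card (?A \<inter> edges Q) \<noteq> 0" using f(2) by (metis card_0_eq empty_iff)
      ultimately show ?thesis unfolding signed_graph_eq[OF A] by simp
    qed
    then show "x \<in> {\<theta> \<in> atoms \<nu> \<inter> {0..\<alpha>}. \<zeta> ({\<theta>} \<times> {0..\<alpha>}) \<noteq> 0}"
      using xy E_atoms by auto
  qed
  then show ?thesis by (simp add: num_nodes_def)
qed

lemma finite_upper_edges: "finite (upper_edges \<alpha>)"
  using finite_E[of \<alpha>] by (rule rev_finite_subset) (auto simp: upper_edges_def)

lemma finite_nodes: "finite (nodes \<alpha>)"
proof -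
  have "nodes \<alpha> \<subseteq> fst ` (E \<inter> {0..\<alpha>} \<times> {0..\<alpha>})" by (force simp: nodes_def)
  then show ?thesis using finite_E finite_surj by blast
qed

text \<open>On each member of a disjoint family the modulus is at most the number of edges in it;
  the family of singletons of edges attains the supremum, each contributing 1.\<close>

lemma num_edges_eq: "num_edges \<zeta> \<alpha> = real (card (upper_edges \<alpha>))"
proof -
  let ?T = "{(x, y). 0 \<le> x \<and> x \<le> y \<and> y \<le> \<alpha>}"
  let ?S = "half_line \<Otimes>\<^sub>M half_line"
  have T: "?T \<subseteq> {0..\<alpha>} \<times> {0..\<alpha>}" by auto
  have le: "(\<Sum>B\<in>X. ennreal \<bar>\<zeta> B\<bar>) \<le> of_nat (card (upper_edges \<alpha>))"
    if X: "finite X" "disjoint X" "\<Union>X \<subseteq> ?T" for X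
  proof -
    have each: "\<bar>\<zeta> B\<bar> \<le> real (card (B \<inter> E))" if "B \<in> X" for B
    proof -
      have B: "B \<subseteq> ?T" "B \<subseteq> {0..\<alpha>} \<times> {0..\<alpha>}" using X that T by auto
      have fE: "finite (B \<inter> E)" using finite_E[of \<alpha>] by (rule rev_finite_subset) (use B in auto)
      have "card (B \<inter> edges P) \<le> card (B \<inter> E)" by (rule card_mono[OF fE]) (auto simp: E_def)
      moreover have "card (B \<inter> edges Q) \<le> card (B \<inter> E)" by (rule card_mono[OF fE]) (auto simp: E_def)
      ultimately show ?thesis unfolding signed_graph_eq[OF B(2)] by linarith
    qed
    have "(\<Sum>B\<in>X. \<bar>\<zeta> B\<bar>) \<le> (\<Sum>B\<in>X. real (card (B \<inter> E)))" by (intro sum_mono each)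
    also have "\<dots> = real (\<Sum>B\<in>X. card (B \<inter> E))" by simp
    also have "(\<Sum>B\<in>X. card (B \<inter> E)) = card (\<Union>B\<in>X. B \<inter> E)"
    proof (rule card_UN_disjoint[symmetric])
      show "\<forall>B\<in>X. finite (B \<inter> E)"
      proof
        fix B assume "B \<in> X"
        then have "B \<subseteq> {0..\<alpha>} \<times> {0..\<alpha>}" using X T by auto
        then show "finite (B \<inter> E)" by (intro finite_subset[OF _ finite_E[of \<alpha>]]) auto
      qed
      show "\<forall>i\<in>X. \<forall>j\<in>X. i \<noteq> j \<longrightarrow> i \<inter> E \<inter> (j \<inter> E) = {}" using X(2) by (auto simp: disjoint_def)
    qed (rule X)
    also have "\<dots> \<le> card (upper_edges \<alpha>)"
      using X by (intro card_mono finite_upper_edges) (auto simp: upper_edges_def)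
    finally have "(\<Sum>B\<in>X. \<bar>\<zeta> B\<bar>) \<le> real (card (upper_edges \<alpha>))" by simp
    then have "ennreal (\<Sum>B\<in>X. \<bar>\<zeta> B\<bar>) \<le> ennreal (real (card (upper_edges \<alpha>)))" by (rule ennreal_leI)
    then show ?thesis by (simp add: sum_ennreal ennreal_of_nat_eq_real_of_nat)
  qed
  define X where "X = (\<lambda>p. {p}) ` upper_edges \<alpha>"
  have X: "finite X" "disjoint X" "X \<subseteq> sets ?S" "\<Union>X \<subseteq> ?T"
  proof -
    show "X \<subseteq> sets ?S" using singleton_half_plane by (auto simp: X_def upper_edges_def)
  qed (use finite_upper_edges in \<open>auto simp: X_def disjoint_def upper_edges_def\<close>)
  have eq: "(\<Sum>B\<in>X. ennreal \<bar>\<zeta> B\<bar>) = of_nat (card (upper_edges \<alpha>))"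
  proof -
    have one: "\<bar>\<zeta> {p}\<bar> = 1" if p: "p \<in> upper_edges \<alpha>" for p
    proof -
      have A: "{p} \<subseteq> {0..\<alpha>} \<times> {0..\<alpha>}" using p T by (auto simp: upper_edges_def)
      have "p \<in> edges P \<and> p \<notin> edges Q \<or> p \<in> edges Q \<and> p \<notin> edges P"
        using p edges_P[of "fst p" "snd p"] edges_Q[of "fst p" "snd p"] by (auto simp: upper_edges_def E_def)
      then show ?thesis unfolding signed_graph_eq[OF A] by auto
    qed
    have "(\<Sum>B\<in>X. ennreal \<bar>\<zeta> B\<bar>) = (\<Sum>p\<in>upper_edges \<alpha>. ennreal \<bar>\<zeta> {p}\<bar>)"
      unfolding X_def by (subst sum.reindex) (auto simp: inj_on_def)
    also have "\<dots> = (\<Sum>p\<in>upper_edges \<alpha>. 1)" using one by (intro sum.cong) auto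
    finally show ?thesis by simp
  qed
  have "total_variation ?S \<zeta> ?T = of_nat (card (upper_edges \<alpha>))"
    unfolding total_variation_def
  proof (rule antisym)
    show "(SUP X\<in>{X. finite X \<and> disjoint X \<and> X \<subseteq> sets ?S \<and> \<Union>X \<subseteq> ?T}. \<Sum>B\<in>X. ennreal \<bar>\<zeta> B\<bar>) \<le> of_nat (card (upper_edges \<alpha>))"
      using le by (intro SUP_least) auto
    show "of_nat (card (upper_edges \<alpha>)) \<le> (SUP X\<in>{X. finite X \<and> disjoint X \<and> X \<subseteq> sets ?S \<and> \<Union>X \<subseteq> ?T}. \<Sum>B\<in>X. ennreal \<bar>\<zeta> B\<bar>)"
      unfolding eq[symmetric] using X by (intro SUP_upper) auto
  qed
  then show ?thesis by (simp add: num_edges_def)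
qed

lemma swap_E: "(x, y) \<in> E \<Longrightarrow> (y, x) \<in> E"
  by (auto simp: E_def mem_edges)

lemma upper_edges_nodes: "upper_edges \<alpha> \<subseteq> nodes \<alpha> \<times> nodes \<alpha>"
proof
  fix p assume "p \<in> upper_edges \<alpha>"
  then obtain x y where p: "p = (x, y)" "0 \<le> x" "x \<le> y" "y \<le> \<alpha>" "(x, y) \<in> E" by (auto simp: upper_edges_def)
  then show "p \<in> nodes \<alpha> \<times> nodes \<alpha>" using swap_E[OF p(5)] by (auto simp: nodes_def)
qed

lemma card_upper_edges_le: "card (upper_edges \<alpha>) \<le> (card (nodes \<alpha>))\<^sup>2"
  using card_mono[OF _ upper_edges_nodes[of \<alpha>]] finite_nodes[of \<alpha>] by (simp add: card_cartesian_product power2_eq_square)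

lemma nodes_subset: "nodes \<alpha> \<subseteq> {x \<in> {0..\<alpha>}. \<nu> {x} \<noteq> 0}"
  using E_atoms by (auto simp: nodes_def atoms_def)

lemma pts_E: "R \<in> {P, Q} \<Longrightarrow> pts R \<subseteq> E"
  by (auto simp: E_def edges_def)

text \<open>Cells with \<open>i < j\<close> are ordered, so the point found in their product
  satisfies \<open>x <= y\<close>; disjoint products yield distinct edges.\<close>

lemma card_upper_edges_ge:
  assumes R: "R \<in> {P, Q}" and \<alpha>: "2 ^ r \<le> \<alpha>"
  shows "card {(i, j) \<in> {..<2 ^ r} \<times> {..<2 ^ r}. i < j \<and> emeasure R (cell 0 i \<times> cell 0 j) \<noteq> 0} \<le> card (upper_edges \<alpha>)"
proof (rule card_le_by_cells[where c = "\<lambda>(i, j). cell 0 i \<times> cell 0 j"])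
  have RL: "lattice_points R" using R P Q by auto
  show "\<exists>b\<in>upper_edges \<alpha>. b \<in> (case p of (i, j) \<Rightarrow> cell 0 i \<times> cell 0 j)"
    if "p \<in> {(i, j) \<in> {..<2 ^ r} \<times> {..<2 ^ r}. i < j \<and> emeasure R (cell 0 i \<times> cell 0 j) \<noteq> 0}" for p
  proof -
    obtain i j where ij: "p = (i, j)" "i < j" "j < 2 ^ r" "emeasure R (cell 0 i \<times> cell 0 j) \<noteq> 0" using \<open>p \<in> _\<close> by auto
    obtain x y where xy: "(x, y) \<in> pts R" "x \<in> cell 0 i" "y \<in> cell 0 j" using lattice_points_hit[OF RL ij(4)] by auto
    have "x \<le> y" using xy(2,3) ij(2) by (auto simp: cell_def)
    moreover have "y < 2 ^ r" using xy(3) cell_subset[of j r 0] ij(3) by auto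
    moreover have "0 \<le> x" using xy(2) by (simp add: mem_cell)
    ultimately have "(x, y) \<in> upper_edges \<alpha>" using \<alpha> pts_E[OF R] xy(1) by (auto simp: upper_edges_def)
    then show ?thesis using xy ij by auto
  qed
qed (use finite_upper_edges in \<open>auto simp: mem_cell\<close>)

lemma card_nodes_ge:
  assumes R: "R \<in> {P, Q}" and \<alpha>: "2 ^ r \<le> \<alpha>"
  shows "card {i \<in> {..<2 ^ (r + m)}. emeasure R (cell m i \<times> {0..<2 ^ r}) \<noteq> 0} \<le> card (nodes \<alpha>)"
proof (rule card_le_by_cells[where c = "cell m"])
  have RL: "lattice_points R" using R P Q by auto
  show "\<exists>b\<in>nodes \<alpha>. b \<in> cell m i" if "i \<in> {i \<in> {..<2 ^ (r + m)}. emeasure R (cell m i \<times> {0..<2 ^ r}) \<noteq> 0}" for i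
  proof -
    have i: "i < 2 ^ (r + m)" "emeasure R (cell m i \<times> {0..<2 ^ r}) \<noteq> 0" using that by auto
    obtain x y where xy: "(x, y) \<in> pts R" "x \<in> cell m i" "y \<in> {0..<2 ^ r}" using lattice_points_hit_row[OF RL i(2)] by auto
    have "x \<in> {0..<2 ^ r}" using xy(2) cell_subset[OF i(1)] by auto
    then have "x \<in> nodes \<alpha>" using xy \<alpha> pts_E[OF R] by (force simp: nodes_def)
    then show ?thesis using xy by auto
  qed
qed (use finite_nodes in \<open>auto simp: mem_cell\<close>)

text \<open>An edge either joins two light points or has an endpoint in \<open>H\<close>. The first
  kind costs \<open>2 * C * 4 ^ r\<close> for each sign, the 2 coming from the symmetrisation; the
  second lies in \<open>H \<times> nodes \<alpha>\<close> or its transpose, where \<open>H\<close>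
  collects at most \<open>C * 2 ^ r\<close> heavy points of each sign.\<close>

lemma card_upper_edges_light_heavy:
  fixes C r :: nat
  assumes v: "locally_finite (spart 1 \<nu>)" "locally_finite (spart (- 1) \<nu>)"
    and \<alpha>: "\<alpha> < 2 ^ r"
    and LP: "emeasure P (light (spart 1 \<nu>) 1 r \<times> light (spart 1 \<nu>) 1 r) \<le> of_nat (C * 4 ^ r)"
    and LQ: "emeasure Q (light (spart (- 1) \<nu>) 1 r \<times> light (spart (- 1) \<nu>) 1 r) \<le> of_nat (C * 4 ^ r)"
    and HP: "finite {x \<in> {0..<2 ^ r}. 1 * \<nu> {x} \<ge> 1}" "card {x \<in> {0..<2 ^ r}. 1 * \<nu> {x} \<ge> 1} \<le> C * 2 ^ r"
    and HQ: "finite {x \<in> {0..<2 ^ r}. - 1 * \<nu> {x} \<ge> 1}" "card {x \<in> {0..<2 ^ r}. - 1 * \<nu> {x} \<ge> 1} \<le> C * 2 ^ r"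
  shows "card (upper_edges \<alpha>) \<le> 4 * C * 4 ^ r + 4 * C * 2 ^ r * card (nodes \<alpha>)"
proof -
  let ?LP = "light (spart 1 \<nu>) 1 r" and ?LQ = "light (spart (- 1) \<nu>) 1 r"
  define H where "H = {x \<in> {0..<2 ^ r}. 1 * \<nu> {x} \<ge> 1} \<union> {x \<in> {0..<2 ^ r}. - 1 * \<nu> {x} \<ge> 1}"
  have fH: "finite H" using HP HQ by (simp add: H_def)
  have cH: "card H \<le> 2 * C * 2 ^ r" unfolding H_def using card_Un_le HP(2) HQ(2) by (smt (verit) add_mono mult_2 mult.assoc order_trans)
  note eP = card_edges_light_le[OF P sets_light[OF v(1)] LP]
  note eQ = card_edges_light_le[OF Q sets_light[OF v(2)] LQ]
  have sub: "upper_edges \<alpha> \<subseteq> (edges P \<inter> ?LP \<times> ?LP \<union> edges Q \<inter> ?LQ \<times> ?LQ) \<union> (H \<times> nodes \<alpha> \<union> nodes \<alpha> \<times> H)"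
  proof
    fix p assume p: "p \<in> upper_edges \<alpha>"
    obtain x y where xy: "p = (x, y)" "0 \<le> x" "x \<le> y" "y \<le> \<alpha>" "(x, y) \<in> E" using p by (auto simp: upper_edges_def)
    have n: "x \<in> nodes \<alpha>" "y \<in> nodes \<alpha>" using upper_edges_nodes p xy(1) by auto
    have b: "x \<in> {0..<2 ^ r}" "y \<in> {0..<2 ^ r}" using xy \<alpha> by auto
    show "p \<in> (edges P \<inter> ?LP \<times> ?LP \<union> edges Q \<inter> ?LQ \<times> ?LQ) \<union> (H \<times> nodes \<alpha> \<union> nodes \<alpha> \<times> H)"
    proof (cases "x \<in> H \<or> y \<in> H")
      case True
      then show ?thesis using n xy(1) by auto
    next
      case False
      \<comment> \<open>Outside \<open>H\<close> a point is light for both parts: the part of the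
        opposite sign gives it mass 0.\<close>
      have l: "z \<in> ?LP" "z \<in> ?LQ" if "z \<in> {0..<2 ^ r}" "z \<notin> H" for z
        using that by (auto simp: light_def H_def emeasure_spart_singleton ennreal_less_one_iff)
      then show ?thesis using False b xy(1,5) by (auto simp: E_def)
    qed
  qed
  have "card (upper_edges \<alpha>) \<le> card ((edges P \<inter> ?LP \<times> ?LP \<union> edges Q \<inter> ?LQ \<times> ?LQ) \<union> (H \<times> nodes \<alpha> \<union> nodes \<alpha> \<times> H))"
    using eP(1) eQ(1) fH finite_nodes by (intro card_mono[OF _ sub]) auto
  also have "\<dots> \<le> (card (edges P \<inter> ?LP \<times> ?LP) + card (edges Q \<inter> ?LQ \<times> ?LQ)) + (card (H \<times> nodes \<alpha>) + card (nodes \<alpha> \<times> H))"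
    by (rule order_trans[OF card_Un_le add_mono[OF card_Un_le card_Un_le]])
  also have "\<dots> \<le> (2 * (C * 4 ^ r) + 2 * (C * 4 ^ r)) + (card H * card (nodes \<alpha>) + card (nodes \<alpha>) * card H)"
    using eP(2) eQ(2) by (simp add: card_cartesian_product)
  also have "\<dots> = 4 * C * 4 ^ r + 2 * card H * card (nodes \<alpha>)" by simp
  also have "\<dots> \<le> 4 * C * 4 ^ r + 2 * (2 * C * 2 ^ r) * card (nodes \<alpha>)"
    using cH by (intro add_mono mult_mono) auto
  finally show ?thesis by simp
qed

end

section \<open>Asymptotic comparison of edges and nodes\<close>

lemma ex_dyadic_bracket:
  assumes "(2::real) ^ n \<le> a" shows "\<exists>r\<ge>n. 2 ^ r \<le> a \<and> a < 2 ^ Suc r"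
proof -
  define k where "k = (LEAST k::nat. a < 2 ^ k)"
  have k: "a < 2 ^ k" unfolding k_def using ex_real_less_power2[of a] by (rule LeastI_ex)
  have nk: "n < k"
  proof (rule ccontr)
    assume "\<not> n < k"
    then have "(2::real) ^ k \<le> 2 ^ n" by (intro power_increasing) auto
    then show False using k assms by linarith
  qed
  then obtain r where r: "k = Suc r" "n \<le> r" by (cases k) auto
  have "\<not> a < 2 ^ r" using not_less_Least[of r "\<lambda>k. a < 2 ^ k"] r by (simp add: k_def)
  then show ?thesis using k r by (intro exI[of _ r]) auto
qed

text \<open>Two consecutive scales are supplied because, by monotonicity, lower bounds are read off
  at \<open>2 ^ r\<close> and upper bounds at \<open>2 ^ Suc r\<close>.\<close>

lemma eventually_dyadic:
  assumes "\<forall>\<^sub>F r in sequentially. A r"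
  shows "\<forall>\<^sub>F \<alpha> in at_top. \<exists>r. A r \<and> A (Suc r) \<and> 2 ^ r \<le> (\<alpha>::real) \<and> \<alpha> < 2 ^ Suc r"
proof -
  obtain n where n: "\<And>r. r \<ge> n \<Longrightarrow> A r" using assms by (auto simp: eventually_sequentially)
  have "\<exists>r. A r \<and> A (Suc r) \<and> 2 ^ r \<le> \<alpha> \<and> \<alpha> < 2 ^ Suc r" if \<alpha>: "2 ^ n \<le> \<alpha>" for \<alpha> :: real
  proof -
    obtain r where "r \<ge> n" "2 ^ r \<le> \<alpha>" "\<alpha> < 2 ^ Suc r" using ex_dyadic_bracket[OF \<alpha>] by blast
    then show ?thesis using n[of r] n[of "Suc r"] by auto
  qed
  then show ?thesis by (auto simp: eventually_at_top_linorder)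
qed

text \<open>The infinite mass may sit on one side of 0 only. If the masses of \<open>up s k\<close>
  were bounded in \<open>k\<close> for both signs, exhausting the nonzero reals would give finite
  total mass. One such sign already supplies enough nodes.\<close>

lemma infinite_activity_one_sign:
  assumes r: "jump_measure \<rho>" and inf: "emeasure \<rho> (- {0}) = \<infinity>"
  shows "\<exists>s\<in>signs. \<forall>m::nat. \<exists>k. emeasure \<rho> (up s k) \<ge> ennreal (2 ^ m)"
proof (rule ccontr)
  assume "\<not> ?thesis"
  then have "\<exists>m::nat. \<forall>k. emeasure \<rho> (up s k) < ennreal (2 ^ m)" if "s \<in> signs" for s
    using that by (auto simp: not_le)
  then obtain m :: "real \<Rightarrow> nat" where m: "\<And>s k. s \<in> signs \<Longrightarrow> emeasure \<rho> (up s k) < ennreal (2 ^ m s)" by metis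
  have sets: "sets \<rho> = sets nonzero_reals" using r by (simp add: jump_measure_def)
  let ?A = "\<lambda>n::nat. up 1 (- int n) \<union> up (- 1) (- int n)"
  have inc: "incseq ?A"
  proof (rule incseq_SucI)
    fix n
    have "up s (- int n) \<subseteq> up s (- int (Suc n))" for s
      using power_int_increasing[of "- int (Suc n)" "- int n" "2::real"] by (auto simp: up_def)
    then show "?A n \<subseteq> ?A (Suc n)" by blast
  qed
  have "range ?A \<subseteq> sets \<rho>" by (auto simp: sets)
  from SUP_emeasure_incseq[OF this inc] have "(SUP n. emeasure \<rho> (?A n)) = \<infinity>" using inf by (simp only: UN_up)
  moreover have "(SUP n. emeasure \<rho> (?A n)) \<le> ennreal (2 ^ m 1) + ennreal (2 ^ m (- 1))"
  proof (rule SUP_least)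
    fix n
    have "emeasure \<rho> (?A n) \<le> emeasure \<rho> (up 1 (- int n)) + emeasure \<rho> (up (- 1) (- int n))"
      by (intro emeasure_subadditive) (auto simp: sets)
    also have "\<dots> \<le> ennreal (2 ^ m 1) + ennreal (2 ^ m (- 1))"
      by (intro add_mono less_imp_le m) auto
    finally show "emeasure \<rho> (?A n) \<le> ennreal (2 ^ m 1) + ennreal (2 ^ m (- 1))" .
  qed
  ultimately have "(\<infinity> :: ennreal) \<le> ennreal (2 ^ m 1) + ennreal (2 ^ m (- 1))" by (simp only:)
  then show False by (simp add: top_unique)
qed

lemma ex_up_nonzero:
  assumes r: "jump_measure \<rho>" and nz: "emeasure \<rho> (- {0}) \<noteq> 0"
  shows "\<exists>s\<in>signs. \<exists>k. emeasure \<rho> (up s k) \<noteq> 0"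
proof (rule ccontr)
  assume z: "\<not> ?thesis"
  have sets: "sets \<rho> = sets nonzero_reals" using r by (simp add: jump_measure_def)
  have "(\<Union>n::nat. up 1 (- int n) \<union> up (- 1) (- int n)) \<in> null_sets \<rho>"
    using z by (intro null_sets_UN null_sets.Un) (auto simp: sets null_sets_def)
  then show False using nz unfolding UN_up by auto
qed

text \<open>The atoms of \<open>D_pos\<close> lie over pairs of atoms of
  \<open>spart 1 (W \<omega>)\<close>, whose weights are positive, and those of \<open>D_neg\<close>
  over negative ones; natural counts on products of cells give the lattice property.\<close>

lemma cond_poisson_signed_points:
  assumes M: "prob_space M"
    and N: "AE \<omega> in M. locally_finite (spart 1 (W \<omega>)) \<and> locally_finite (spart (- 1) (W \<omega>))"
    and P: "cond_poisson_square M half_line (\<lambda>\<omega>. spart 1 (W \<omega>)) D_pos"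
    and Q: "cond_poisson_square M half_line (\<lambda>\<omega>. spart (- 1) (W \<omega>)) D_neg"
  shows "AE \<omega> in M. signed_points (W \<omega>) (D_pos \<omega>) (D_neg \<omega>)"
proof -
  have lf: "AE \<omega> in M. locally_finite (spart s (W \<omega>))" if "s \<in> signs" for s using that N by auto
  have at: "AE \<omega> in M. atomic (spart s (W \<omega>))" for s
    by (simp add: spart_def atomic_pos_part)
  have lat: "AE \<omega> in M. lattice_points (D \<omega>)" if "cond_poisson_square M half_line (\<lambda>\<omega>. spart s (W \<omega>)) D" "s \<in> signs" for s D
  proof -
    have Dm: "D \<in> M \<rightarrow>\<^sub>M measure_algebra (half_line \<Otimes>\<^sub>M half_line)"
      using that by (auto simp: cond_poisson_square_def regular_cond_distr_def)
    show ?thesis using cond_poisson_AE_nat[OF M that(1) lf[OF that(2)]] AE_space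
    proof eventually_elim
      case (elim \<omega>)
      then show ?case using measurable_space[OF Dm elim(2)] by (auto simp: lattice_points_def)
    qed
  qed
  have signs: "1 \<in> signs" "- 1 \<in> signs" by auto
  show ?thesis
    using lat[OF P signs(1)] lat[OF Q signs(2)]
      cond_poisson_AE_support[OF M P lf[OF signs(1)] at] cond_poisson_AE_support[OF M Q lf[OF signs(2)] at]
  proof eventually_elim
    case (elim \<omega>)
    have P: "lattice_points (D_pos \<omega>)" and Q: "lattice_points (D_neg \<omega>)" using elim by auto
    show ?case
    proof
      show "0 < W \<omega> {x} \<and> 0 < W \<omega> {y}" if "(x, y) \<in> pts (D_pos \<omega>)" for x y
      proof -
        have "emeasure (spart 1 (W \<omega>)) {x} \<noteq> 0 \<and> emeasure (spart 1 (W \<omega>)) {y} \<noteq> 0"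
          using elim(3) that unfolding pts_def by blast
        then show ?thesis using pts_nonneg[OF P that] by (auto simp: emeasure_spart_singleton ennreal_eq_0_iff not_le)
      qed
      show "W \<omega> {x} < 0 \<and> W \<omega> {y} < 0" if "(x, y) \<in> pts (D_neg \<omega>)" for x y
      proof -
        have "emeasure (spart (- 1) (W \<omega>)) {x} \<noteq> 0 \<and> emeasure (spart (- 1) (W \<omega>)) {y} \<noteq> 0"
          using elim(4) that unfolding pts_def by blast
        then show ?thesis using pts_nonneg[OF Q that] by (auto simp: emeasure_spart_singleton ennreal_eq_0_iff not_le)
      qed
    qed (use P Q in auto)
  qed
qed

context signed_points
begin

text \<open>Nodes are atoms, hence at most \<open>C * 2 ^ Suc r\<close>, while the edges number at
  least \<open>h * 4 ^ r\<close>. The quotient of the square of the former by the latter is the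
  constant \<open>4 * (real C)\<^sup>2 / h\<close>.\<close>

lemma edges_bigtheta_nodes:
  assumes A: "\<forall>\<^sub>F r in sequentially. finite {x \<in> {0..<2 ^ r}. \<nu> {x} \<noteq> 0} \<and> card {x \<in> {0..<2 ^ r}. \<nu> {x} \<noteq> 0} \<le> C * 2 ^ r"
    and R: "R \<in> {P, Q}" and h: "h > 0"
    and hits: "\<forall>\<^sub>F r in sequentially. real (card {(i, j) \<in> {..<2 ^ r} \<times> {..<2 ^ r}. i < j \<and> emeasure R (cell 0 i \<times> cell 0 j) \<noteq> 0}) \<ge> h * 4 ^ r"
  shows "(\<lambda>\<alpha>. num_edges \<zeta> \<alpha>) \<in> \<Theta>[at_top](\<lambda>\<alpha>. (real (num_nodes \<nu> \<zeta> \<alpha>))\<^sup>2)"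
  unfolding num_edges_eq num_nodes_eq
proof (rule bigthetaI)
  have "real (card (upper_edges \<alpha>)) \<le> (real (card (nodes \<alpha>)))\<^sup>2" for \<alpha>
    using card_upper_edges_le[of \<alpha>] by (metis of_nat_le_iff of_nat_power)
  then show "(\<lambda>\<alpha>. real (card (upper_edges \<alpha>))) \<in> O[at_top](\<lambda>\<alpha>. (real (card (nodes \<alpha>)))\<^sup>2)"
    by (intro landau_o.bigI[of 1] always_eventually) auto
  have "\<forall>\<^sub>F r in sequentially. (finite {x \<in> {0..<2 ^ r}. \<nu> {x} \<noteq> 0} \<and> card {x \<in> {0..<2 ^ r}. \<nu> {x} \<noteq> 0} \<le> C * 2 ^ r) \<and>
     real (card {(i, j) \<in> {..<2 ^ r} \<times> {..<2 ^ r}. i < j \<and> emeasure R (cell 0 i \<times> cell 0 j) \<noteq> 0}) \<ge> h * 4 ^ r"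
    using A hits by eventually_elim simp
  from eventually_dyadic[OF this]
  have "\<forall>\<^sub>F \<alpha> in at_top. (real (card (nodes \<alpha>)))\<^sup>2 \<le> (4 * (real C)\<^sup>2 / h) * real (card (upper_edges \<alpha>))"
  proof eventually_elim
    case (elim \<alpha>)
    then obtain r where r: "2 ^ r \<le> \<alpha>" "\<alpha> < 2 ^ Suc r"
      and e: "h * 4 ^ r \<le> real (card {(i, j) \<in> {..<2 ^ r} \<times> {..<2 ^ r}. i < j \<and> emeasure R (cell 0 i \<times> cell 0 j) \<noteq> 0})"
      and a: "finite {x \<in> {0..<2 ^ Suc r}. \<nu> {x} \<noteq> 0}" "card {x \<in> {0..<2 ^ Suc r}. \<nu> {x} \<noteq> 0} \<le> C * 2 ^ Suc r"
      by blast
    have "card (nodes \<alpha>) \<le> card {x \<in> {0..<2 ^ Suc r}. \<nu> {x} \<noteq> 0}"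
      using nodes_subset[of \<alpha>] r(2) by (intro card_mono a(1)) auto
    also have "\<dots> \<le> C * 2 ^ Suc r" by (rule a)
    finally have "real (card (nodes \<alpha>)) \<le> real (C * 2 ^ Suc r)" by (simp only: of_nat_le_iff)
    then have "(real (card (nodes \<alpha>)))\<^sup>2 \<le> (real (C * 2 ^ Suc r))\<^sup>2" by (intro power_mono) auto
    also have "\<dots> = 4 * (real C)\<^sup>2 * 4 ^ r"
    proof -
      have "((2::real) ^ r)\<^sup>2 = 4 ^ r" by (simp add: power2_eq_square power_mult_distrib[symmetric])
      then show ?thesis by (simp add: power_mult_distrib)
    qed
    also have "\<dots> = (4 * (real C)\<^sup>2 / h) * (h * 4 ^ r)" using h by simp
    also have "\<dots> \<le> (4 * (real C)\<^sup>2 / h) * real (card (upper_edges \<alpha>))"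
    proof (intro mult_left_mono)
      show "h * 4 ^ r \<le> real (card (upper_edges \<alpha>))"
        using e card_upper_edges_ge[OF R r(1)] by linarith
    qed (use h in auto)
    finally show ?case .
  qed
  then have "(\<lambda>\<alpha>. (real (card (nodes \<alpha>)))\<^sup>2) \<in> O[at_top](\<lambda>\<alpha>. real (card (upper_edges \<alpha>)))"
    by (intro bigoI[where c = "4 * (real C)\<^sup>2 / h"]) (auto elim: eventually_mono)
  then show "(\<lambda>\<alpha>. real (card (upper_edges \<alpha>))) \<in> \<Omega>[at_top](\<lambda>\<alpha>. (real (card (nodes \<alpha>)))\<^sup>2)"
    by (simp add: bigomega_iff_bigo)
qed

text \<open>Dividing the light/heavy bound by the squared number of nodes leaves a multiple of
  \<open>1 / 2 ^ m\<close>, because the nodes number at least \<open>2 ^ (r + m) / 16\<close>; as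
  \<open>m\<close> is free, every \<open>c\<close> is reached.\<close>

lemma edges_smallo_nodes:
  assumes v: "locally_finite (spart 1 \<nu>)" "locally_finite (spart (- 1) \<nu>)"
    and L: "\<forall>\<^sub>F r in sequentially. emeasure P (light (spart 1 \<nu>) 1 r \<times> light (spart 1 \<nu>) 1 r) \<le> of_nat (C * 4 ^ r) \<and>
       finite {x \<in> {0..<2 ^ r}. 1 * \<nu> {x} \<ge> 1} \<and> card {x \<in> {0..<2 ^ r}. 1 * \<nu> {x} \<ge> 1} \<le> C * 2 ^ r"
      "\<forall>\<^sub>F r in sequentially. emeasure Q (light (spart (- 1) \<nu>) 1 r \<times> light (spart (- 1) \<nu>) 1 r) \<le> of_nat (C * 4 ^ r) \<and>
       finite {x \<in> {0..<2 ^ r}. - 1 * \<nu> {x} \<ge> 1} \<and> card {x \<in> {0..<2 ^ r}. - 1 * \<nu> {x} \<ge> 1} \<le> C * 2 ^ r"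
    and R: "R \<in> {P, Q}"
    and hits: "\<And>m. \<forall>\<^sub>F r in sequentially. real (card {i \<in> {..<2 ^ (r + m)}. emeasure R (cell m i \<times> {0..<2 ^ r}) \<noteq> 0}) \<ge> 2 ^ (r + m) / 16"
  shows "(\<lambda>\<alpha>. num_edges \<zeta> \<alpha>) \<in> o[at_top](\<lambda>\<alpha>. (real (num_nodes \<nu> \<zeta> \<alpha>))\<^sup>2)"
  unfolding num_edges_eq num_nodes_eq
proof (rule landau_o.smallI)
  fix c :: real assume c: "c > 0"
  \<comment> \<open>The constant is \<open>16 * 256 + 8 * 16\<close>: the light and heavy terms are
    \<open>16 * C * t\<^sup>2\<close> and \<open>8 * C * t * N\<close> with
    \<open>t = 2 ^ r\<close>, into which \<open>t <= 16 * N / 2 ^ m\<close> is inserted. Of the two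
    factors \<open>1 / 2 ^ m\<close> in the light term one is dropped.\<close>
  obtain m :: nat where m: "4224 * real C / c < 2 ^ m" using ex_real_less_power2 by blast
  have "\<forall>\<^sub>F r in sequentially. (emeasure P (light (spart 1 \<nu>) 1 r \<times> light (spart 1 \<nu>) 1 r) \<le> of_nat (C * 4 ^ r) \<and>
       finite {x \<in> {0..<2 ^ r}. 1 * \<nu> {x} \<ge> 1} \<and> card {x \<in> {0..<2 ^ r}. 1 * \<nu> {x} \<ge> 1} \<le> C * 2 ^ r) \<and>
     (emeasure Q (light (spart (- 1) \<nu>) 1 r \<times> light (spart (- 1) \<nu>) 1 r) \<le> of_nat (C * 4 ^ r) \<and>
       finite {x \<in> {0..<2 ^ r}. - 1 * \<nu> {x} \<ge> 1} \<and> card {x \<in> {0..<2 ^ r}. - 1 * \<nu> {x} \<ge> 1} \<le> C * 2 ^ r) \<and>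
     real (card {i \<in> {..<2 ^ (r + m)}. emeasure R (cell m i \<times> {0..<2 ^ r}) \<noteq> 0}) \<ge> 2 ^ (r + m) / 16"
    using L hits[of m] by eventually_elim blast
  from eventually_dyadic[OF this]
  show "\<forall>\<^sub>F \<alpha> in at_top. norm (real (card (upper_edges \<alpha>))) \<le> c * norm ((real (card (nodes \<alpha>)))\<^sup>2)"
  proof eventually_elim
    case (elim \<alpha>)
    then obtain r where r: "2 ^ r \<le> \<alpha>" "\<alpha> < 2 ^ Suc r"
      and LP: "emeasure P (light (spart 1 \<nu>) 1 (Suc r) \<times> light (spart 1 \<nu>) 1 (Suc r)) \<le> of_nat (C * 4 ^ Suc r)"
        "finite {x \<in> {0..<2 ^ Suc r}. 1 * \<nu> {x} \<ge> 1}" "card {x \<in> {0..<2 ^ Suc r}. 1 * \<nu> {x} \<ge> 1} \<le> C * 2 ^ Suc r"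
      and LQ: "emeasure Q (light (spart (- 1) \<nu>) 1 (Suc r) \<times> light (spart (- 1) \<nu>) 1 (Suc r)) \<le> of_nat (C * 4 ^ Suc r)"
        "finite {x \<in> {0..<2 ^ Suc r}. - 1 * \<nu> {x} \<ge> 1}" "card {x \<in> {0..<2 ^ Suc r}. - 1 * \<nu> {x} \<ge> 1} \<le> C * 2 ^ Suc r"
      and n: "real (card {i \<in> {..<2 ^ (r + m)}. emeasure R (cell m i \<times> {0..<2 ^ r}) \<noteq> 0}) \<ge> 2 ^ (r + m) / 16"
      by blast
    define N where "N = real (card (nodes \<alpha>))"
    define t where "t = (2::real) ^ r"
    have t0: "t > 0" by (simp add: t_def)
    have N: "N \<ge> t * 2 ^ m / 16"
      using n card_nodes_ge[OF R r(1), of m] unfolding N_def t_def by (simp add: power_add)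
    have tt: "(4::real) ^ r = t * t" by (simp add: t_def power_mult_distrib[symmetric])
    have "real (card (upper_edges \<alpha>)) \<le> real (4 * C * 4 ^ Suc r + 4 * C * 2 ^ Suc r * card (nodes \<alpha>))"
      using card_upper_edges_light_heavy[OF v r(2) LP(1) LQ(1) LP(2,3) LQ(2,3)] by (simp only: of_nat_le_iff)
    also have "\<dots> = 16 * real C * (t * t) + 8 * real C * t * N"
      by (simp add: N_def tt t_def)
    also have "\<dots> \<le> 4224 * real C / 2 ^ m * N\<^sup>2"
    proof -
      define d where "d = (2::real) ^ m"
      have d1: "d \<ge> 1" by (simp add: d_def)
      have tN: "t \<le> 16 * N / d" using N d1 by (simp add: d_def field_simps)
      have N0: "N \<ge> 0" by (simp add: N_def)
      have "t * t \<le> (16 * N / d) * (16 * N / d)" using tN t0 by (intro mult_mono) auto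
      also have "\<dots> = 256 * N\<^sup>2 / d * (1 / d)" by (simp add: power2_eq_square)
      also have "\<dots> \<le> 256 * N\<^sup>2 / d * 1" using d1 by (intro mult_left_mono) auto
      finally have 1: "t * t \<le> 256 * N\<^sup>2 / d" by simp
      have 2: "t * N \<le> 16 * N / d * N" using tN N0 by (rule mult_right_mono)
      have "16 * real C * (t * t) + 8 * real C * (t * N) \<le> 16 * real C * (256 * N\<^sup>2 / d) + 8 * real C * (16 * N / d * N)"
        using 1 2 by (intro add_mono mult_left_mono) auto
      also have "\<dots> = 4224 * real C / d * N\<^sup>2" by (simp add: power2_eq_square field_simps)
      finally show ?thesis by (simp add: d_def mult.assoc)
    qed
    also have "\<dots> \<le> c * N\<^sup>2"
    proof (rule mult_right_mono)
      show "4224 * real C / 2 ^ m \<le> c" using m c by (simp add: field_simps)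
    qed simp
    finally show ?case by (simp add: N_def)
  qed
qed

text \<open>Without atoms both sides are identically 0, and the zero function is of its own
  order.\<close>

lemma edges_bigtheta_nodes_trivial:
  assumes "\<And>x. x \<ge> 0 \<Longrightarrow> \<nu> {x} = 0"
  shows "(\<lambda>\<alpha>. num_edges \<zeta> \<alpha>) \<in> \<Theta>[at_top](\<lambda>\<alpha>. (real (num_nodes \<nu> \<zeta> \<alpha>))\<^sup>2)"
proof -
  have n: "nodes \<alpha> = {}" for \<alpha> using nodes_subset[of \<alpha>] assms by auto
  then have "card (upper_edges \<alpha>) = 0" for \<alpha> using card_upper_edges_le[of \<alpha>] by simp
  then show ?thesis unfolding num_edges_eq num_nodes_eq n by simp
qed

end

theorem proposition4p5:
  fixes M :: "'w measure"
    and \<rho> :: "real measure"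
    and W :: "'w \<Rightarrow> real set \<Rightarrow> real"
    and D_pos D_neg :: "'w \<Rightarrow> (real \<times> real) measure"
    and D Z :: "'w \<Rightarrow> (real \<times> real) set \<Rightarrow> real"
  assumes "prob_space M"
    and "levy_measure \<rho>"
    and "crsm M \<rho> lebesgue_half_line W"
    and "cond_poisson_square M half_line (\<lambda>\<omega>. pos_part (W \<omega>)) D_pos"
    and "cond_poisson_square M half_line (\<lambda>\<omega>. neg_part (W \<omega>)) D_neg"
    and "prob_space.indep_var M
           (measure_algebra (half_line \<Otimes>\<^sub>M half_line)) D_pos
           (measure_algebra (half_line \<Otimes>\<^sub>M half_line)) D_neg"
    and "D = (\<lambda>\<omega>. signed_diff (D_pos \<omega>) (D_neg \<omega>))"
    and "Z = (\<lambda>\<omega>. signed_graph (W \<omega>) (D \<omega>))"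
    and "(\<integral>\<^sup>+ w. ennreal \<bar>w\<bar> \<partial>\<rho>) < \<infinity>"
  shows "(emeasure \<rho> (space \<rho>) < \<infinity> \<longrightarrow>
            (AE \<omega> in M. (\<lambda>\<alpha>. num_edges (Z \<omega>) \<alpha>)
               \<in> \<Theta>[at_top](\<lambda>\<alpha>. (real (num_nodes (W \<omega>) (Z \<omega>) \<alpha>))\<^sup>2))) \<and>
         (emeasure \<rho> (space \<rho>) = \<infinity> \<longrightarrow>
            (AE \<omega> in M. (\<lambda>\<alpha>. num_edges (Z \<omega>) \<alpha>)
               \<in> o[at_top](\<lambda>\<alpha>. (real (num_nodes (W \<omega>) (Z \<omega>) \<alpha>))\<^sup>2)))"
proof -
  note M = \<open>prob_space M\<close>
  note Z = \<open>Z = (\<lambda>\<omega>. signed_graph (W \<omega>) (D \<omega>))\<close> \<open>D = (\<lambda>\<omega>. signed_diff (D_pos \<omega>) (D_neg \<omega>))\<close>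
  have sets: "sets \<rho> = sets nonzero_reals" using \<open>levy_measure \<rho>\<close> by (simp add: levy_measure_def)
  have jump_measure: "jump_measure \<rho>" using sets \<open>crsm M \<rho> lebesgue_half_line W\<close> by (auto simp: jump_measure_def crsm_def)
  have sp: "space \<rho> = - {0}" using sets_eq_imp_space_eq[OF sets] by (simp add: space_restrict_space)
  obtain \<Psi> where X: "poisson_process M (lebesgue_half_line \<Otimes>\<^sub>M \<rho>) \<Psi>"
    and W: "AE \<omega> in M. \<forall>B\<in>bounded_borel. W \<omega> B = (LINT z:(B \<times> (- {0}))|\<Psi> \<omega>. snd z)"
    using \<open>crsm M \<rho> lebesgue_half_line W\<close> by (auto simp: crsm_def)
  interpret prob_space M by (rule M)
  interpret poisson_jumps M \<rho> \<Psi> by unfold_locales (rule jump_measure, rule X)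
  have N: "AE \<omega> in M. realizes (\<Psi> \<omega>) (W \<omega>)"
    using AE_simple_points W
  proof eventually_elim
    case (elim \<omega>)
    \<comment> \<open>The Poisson representation of \<open>W\<close> is evaluated at singletons,
      where it gives the weights of the atoms.\<close>
    have "{x} \<in> bounded_borel" if "x \<ge> 0" for x using that by (simp add: bounded_borel_def)
    then show ?case using elim by (simp add: realizes_def)
  qed
  interpret poisson_signed_measure M \<rho> \<Psi> W by unfold_locales (rule N)
  have P: "cond_poisson_square M half_line (\<lambda>\<omega>. spart 1 (W \<omega>)) D_pos"
    and Q: "cond_poisson_square M half_line (\<lambda>\<omega>. spart (- 1) (W \<omega>)) D_neg"
    using assms(4,5) by (simp_all add: spart_simps)
  have lf: "AE \<omega> in M. locally_finite (spart 1 (W \<omega>)) \<and> locally_finite (spart (- 1) (W \<omega>))"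
    using AE_spart_locally_finite by simp
  have SP: "AE \<omega> in M. signed_points (W \<omega>) (D_pos \<omega>) (D_neg \<omega>)"
    by (rule cond_poisson_signed_points[OF M lf P Q])
  \<comment> \<open>The process driven by the sign \<open>s\<close>; the lower bounds on edges and
    nodes come from one suitable sign.\<close>
  define R where "R s = (if s = (1::real) then D_pos else D_neg)" for s
  have R: "cond_poisson_square M half_line (\<lambda>\<omega>. spart s (W \<omega>)) (R s)" if "s \<in> signs" for s
    using that P Q by (auto simp: R_def)
  have R_in: "R s \<omega> \<in> {D_pos \<omega>, D_neg \<omega>}" for s \<omega> by (simp add: R_def)
  show ?thesis
  proof (intro conjI impI)
    assume fin: "emeasure \<rho> (space \<rho>) < \<infinity>"
    show "AE \<omega> in M. (\<lambda>\<alpha>. num_edges (Z \<omega>) \<alpha>) \<in> \<Theta>[at_top](\<lambda>\<alpha>. (real (num_nodes (W \<omega>) (Z \<omega>) \<alpha>))\<^sup>2)"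
    \<comment> \<open>A vanishing jump measure charges no set \<open>up s k\<close>, so the lower
      bound on edges has no source; it is a case apart.\<close>
    proof (cases "emeasure \<rho> (- {0}) = 0")
      case True
      show ?thesis using SP AE_no_atoms[OF True]
      proof eventually_elim
        case (elim \<omega>)
        interpret signed_points "W \<omega>" "D_pos \<omega>" "D_neg \<omega>" by (rule elim)
        show ?case unfolding Z using elim(2) by (intro edges_bigtheta_nodes_trivial) auto
      qed
    next
      case False
      obtain s k where s: "s \<in> signs" "emeasure \<rho> (up s k) \<noteq> 0" using ex_up_nonzero[OF jump_measure False] by blast
      obtain C where C: "AE \<omega> in M. \<forall>\<^sub>F r in sequentially.
          finite {x \<in> {0..<2 ^ r}. W \<omega> {x} \<noteq> 0} \<and> card {x \<in> {0..<2 ^ r}. W \<omega> {x} \<noteq> 0} \<le> C * 2 ^ r"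
        using AE_card_atoms fin unfolding sp by blast
      obtain h where h: "h > 0" "AE \<omega> in M. \<forall>\<^sub>F r in sequentially.
          real (card {(i, j) \<in> {..<2 ^ r} \<times> {..<2 ^ r}. i < j \<and> emeasure (R s \<omega>) (cell 0 i \<times> cell 0 j) \<noteq> 0}) \<ge> h * 4 ^ r"
        using AE_edge_hits[OF s(1) R[OF s(1)] s(2)] by blast
      show ?thesis using SP C h(2)
      proof eventually_elim
        case (elim \<omega>)
        interpret signed_points "W \<omega>" "D_pos \<omega>" "D_neg \<omega>" by (rule elim)
        show ?case unfolding Z by (rule edges_bigtheta_nodes[OF elim(2) R_in h(1) elim(3)])
      qed
    qed
  next
    assume inf: "emeasure \<rho> (space \<rho>) = \<infinity>"
    obtain s where s: "s \<in> signs" "\<And>m::nat. \<exists>k. emeasure \<rho> (up s k) \<ge> ennreal (2 ^ m)"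
      using infinite_activity_one_sign[OF jump_measure] inf unfolding sp by blast
    obtain C1 where C1: "AE \<omega> in M. \<forall>\<^sub>F r in sequentially.
        emeasure (D_pos \<omega>) (light (spart 1 (W \<omega>)) 1 r \<times> light (spart 1 (W \<omega>)) 1 r) \<le> of_nat (C1 * 4 ^ r) \<and>
        finite {x \<in> {0..<2 ^ r}. 1 * W \<omega> {x} \<ge> 1} \<and> card {x \<in> {0..<2 ^ r}. 1 * W \<omega> {x} \<ge> 1} \<le> C1 * 2 ^ r"
      using AE_light_heavy_bounds[OF _ P] by blast
    obtain C2 where C2: "AE \<omega> in M. \<forall>\<^sub>F r in sequentially.
        emeasure (D_neg \<omega>) (light (spart (- 1) (W \<omega>)) 1 r \<times> light (spart (- 1) (W \<omega>)) 1 r) \<le> of_nat (C2 * 4 ^ r) \<and>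
        finite {x \<in> {0..<2 ^ r}. - 1 * W \<omega> {x} \<ge> 1} \<and> card {x \<in> {0..<2 ^ r}. - 1 * W \<omega> {x} \<ge> 1} \<le> C2 * 2 ^ r"
      using AE_light_heavy_bounds[OF _ Q] by blast
    define C where "C = max C1 C2"
    have mono: "x \<le> of_nat (C * b)" if "x \<le> of_nat (C' * b)" "C' \<le> C" for x :: ennreal and b C' :: nat
      using that(1) by (rule order_trans) (intro of_nat_mono mult_right_mono, use that in auto)
    have mono': "x \<le> C * b" if "x \<le> C' * b" "C' \<le> C" for x b C' :: nat
      using that(1) by (rule order_trans) (intro mult_right_mono, use that in auto)
    have C12: "C1 \<le> C" "C2 \<le> C" by (simp_all add: C_def)
    have "AE \<omega> in M. \<forall>\<^sub>F r in sequentially.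
       real (card {i \<in> {..<2 ^ (r + m)}. emeasure (R s \<omega>) (cell m i \<times> {0..<2 ^ r}) \<noteq> 0}) \<ge> 2 ^ (r + m) / 16" for m
      using s(2)[of m] AE_node_hits[OF s(1) R[OF s(1)]] by blast
    \<comment> \<open>The level \<open>m\<close> is chosen only after the constant in the little-o,
      so one null set has to serve all \<open>m\<close>.\<close>
    then have "AE \<omega> in M. \<forall>m. \<forall>\<^sub>F r in sequentially.
       real (card {i \<in> {..<2 ^ (r + m)}. emeasure (R s \<omega>) (cell m i \<times> {0..<2 ^ r}) \<noteq> 0}) \<ge> 2 ^ (r + m) / 16"
      unfolding AE_all_countable by blast
    with SP lf C1 C2
    show "AE \<omega> in M. (\<lambda>\<alpha>. num_edges (Z \<omega>) \<alpha>) \<in> o[at_top](\<lambda>\<alpha>. (real (num_nodes (W \<omega>) (Z \<omega>) \<alpha>))\<^sup>2)"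
    proof eventually_elim
      case (elim \<omega>)
      interpret signed_points "W \<omega>" "D_pos \<omega>" "D_neg \<omega>" by (rule elim)
      show ?case unfolding Z
      proof (rule edges_smallo_nodes[OF _ _ _ _ R_in])
        show "\<forall>\<^sub>F r in sequentially. emeasure (D_pos \<omega>) (light (spart 1 (W \<omega>)) 1 r \<times> light (spart 1 (W \<omega>)) 1 r) \<le> of_nat (C * 4 ^ r) \<and>
          finite {x \<in> {0..<2 ^ r}. 1 * W \<omega> {x} \<ge> 1} \<and> card {x \<in> {0..<2 ^ r}. 1 * W \<omega> {x} \<ge> 1} \<le> C * 2 ^ r"
          using elim(3) by eventually_elim (use mono mono' C12 in blast)
        show "\<forall>\<^sub>F r in sequentially. emeasure (D_neg \<omega>) (light (spart (- 1) (W \<omega>)) 1 r \<times> light (spart (- 1) (W \<omega>)) 1 r) \<le> of_nat (C * 4 ^ r) \<and>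
          finite {x \<in> {0..<2 ^ r}. - 1 * W \<omega> {x} \<ge> 1} \<and> card {x \<in> {0..<2 ^ r}. - 1 * W \<omega> {x} \<ge> 1} \<le> C * 2 ^ r"
          using elim(4) by eventually_elim (use mono mono' C12 in blast)
      qed (use elim in auto)
    qed
  qed
qed

end
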